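(* Let $k\ge 2$ be an integer and $p\in(0,1)$, and consider the OFA-kf model at density $p$; let $p_c=1/k$. There exists a constant $c>0$ such that, for all integers $L\ge 1$, $$\frac1c\,L\,T_{\rm rel}\bigl(\mathbb T^k_{\lfloor L/2\rfloor}\bigr)\le T_1(\mathbb T^k_L)\le T_2(\mathbb T^k_L)\le c\,L\,T_{\rm rel}(\mathbb T^k_L).$$ In particular, for some constants $\alpha,\beta\ge 0$ independent of $L$, and for all integers $L\ge1$: (i) if $p=p_c$, then $c^{-1}L^3\le T_1(\mathbb T^k_L)\le c\,L^{3+\beta}$; (ii) if $p<p_c$, then $\frac1c\,(p_c-p)^{-2}L\le T_1(\mathbb T^k_L)\le c\,L\,(p_c-p)^{-(2+\alpha)}$.
   Context: Let $k\ge 2$ and let $\mathbb T^k$ be the infinite rooted $k$-ary tree (every vertex has exactly $k$ children) with root $r$. For a vertex $x$, $\mathcal K_x$ denotes the set of its $k$ children and $d_x$ its depth, i.e. the graph distance to $r$. For an integer $n\ge 0$ let $\mathbb T^k_n=\{x\in\mathbb T^k: d_x\le n\}$. Fix $p\in(0,1)$, $q=1-p$. Let $\mu_x$ be the Bernoulli measure on $\{0,1\}$ with $\mu_x(1)=p$, $\mu_x(0)=q$, and for a finite subtree $\mathbb T$ of $\mathbb T^k$ let $\mu_{\mathbb T}=\bigotimes_{x\in\mathbb T}\mu_x$ on $\Omega_{\mathbb T}=\{0,1\}^{\mathbb T}$. For $f:\Omega_{\mathbb T}\to\mathbb R$, $\mu_x(f)$ denotes the function obtained by averaging $f$ over the variable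 at $x$ with respect to $\mu_x$, the other variables being kept fixed; $\operatorname{Var}_{\mathbb T}$ is the variance under $\mu_{\mathbb T}$. Finite volume OFA-kf (oriented Fredrickson-Andersen $k$-facilitated) dynamics on $\mathbb T$: for $\eta\in\Omega_{\mathbb T}$ and $x\in\mathbb T$ let $c_{\mathbb T,x}(\eta)=1$ if $\eta_y=0$ for all $y\in\mathcal K_x\cap\mathbb T$ and $c_{\mathbb T,x}(\eta)=0$ otherwise (children of $x$ outside $\mathbb T$ are regarded as empty, so for $\mathbb T=\mathbb T^k_n$ the leaves are unconstrained). The generator of the continuous time Markov chain, irreducible and reversible with respect to $\mu_{\mathbb T}$, is $$\mathcal L_{\mathbb T}f=\sum_{x\in\mathbb T}c_{\mathbb T,x}\,[\mu_x(f)-f].$$ Its spectral gap is $\operatorname{gap}(\mathcal L_{\mathbb T})=\inf_{f\ne\text{const}}\frac{\mu_{\mathbb T}(f\cdot(-\mathcal L_{\mathbb T}f))}{\operatorname{Var}_{\mathbb T}(f)}$, and the relaxation time is $T_{\rm rel}(\mathbb T)=\operatorname{gap}(\mathcal L_{\mathbb T})^{-1}$. For $\eta\in\Omega_{\mathbb T}$ let $\nu^\eta_t$ be the law at time $t$ of the chain with generator $\mathcal L_{\mathbb T}$ started from $\eta$, and $h^\eta_t$ its density with respect to $\mu_{\mathbb T}$. For $a\ge 1$ the mixing time $T_a(\mathbb T)$ is $$T_a(\mathbb T)=\inf\Bigl\{t\ge 0:\ \max_{\eta}\,\mu_{\mathbb T}\bigl(|h^\eta_t-1|^a\bigr)^{1/a}\le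 \tfrac14\Bigr\}.$$ The critical density of the model is $p_c=1/k$. Constants may depend on the fixed parameters $k$ and $p$, but not on $L$. *)

theory Defs
  imports "HOL-Probability.Probability"
begin

text \<open>A vertex of the \<open>k\<close>-ary tree is the word of child labels on the path from the root \<open>[]\<close>
  to it, so the depth of a vertex is the length of the word.\<close>

type_synonym vertex = "nat list"

definition tree :: "nat \<Rightarrow> vertex set" where
  "tree k = lists {..<k}"

definition children :: "nat \<Rightarrow> vertex \<Rightarrow> vertex set" where
  "children k x = (\<lambda>i. x @ [i]) ` {..<k}"

definition tree_ball :: "nat \<Rightarrow> nat \<Rightarrow> vertex set" where
  "tree_ball k n = {x \<in> tree k. length x \<le> n}"

text \<open>The spin value 1 is \<open>True\<close>. A configuration on the finite volume \<open>V\<close> is extended by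
  \<open>False\<close> (that is, 0) outside \<open>V\<close>, the convention of \<open>Pi_pmf\<close>.\<close>

type_synonym config = "vertex \<Rightarrow> bool"

definition configs :: "vertex set \<Rightarrow> config set" where
  "configs V = PiE_dflt V False (\<lambda>_. UNIV)"

definition mu :: "real \<Rightarrow> vertex set \<Rightarrow> config pmf" where
  "mu p V = Pi_pmf V False (\<lambda>_. bernoulli_pmf p)"

definition site_avg :: "real \<Rightarrow> vertex \<Rightarrow> (config \<Rightarrow> real) \<Rightarrow> config \<Rightarrow> real" where
  "site_avg p x f \<eta> = measure_pmf.expectation (bernoulli_pmf p) (\<lambda>b. f (\<eta>(x := b)))"

definition constr :: "nat \<Rightarrow> vertex set \<Rightarrow> vertex \<Rightarrow> config \<Rightarrow> real" where
  "constr k V x \<eta> = (if \<forall>y \<in> children k x \<inter> V. \<not> \<eta> y then 1 else 0)"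

definition generator :: "nat \<Rightarrow> real \<Rightarrow> vertex set \<Rightarrow> (config \<Rightarrow> real) \<Rightarrow> config \<Rightarrow> real" where
  "generator k p V f \<eta> = (\<Sum>x\<in>V. constr k V x \<eta> * (site_avg p x f \<eta> - f \<eta>))"

definition spectral_gap :: "nat \<Rightarrow> real \<Rightarrow> vertex set \<Rightarrow> real" where
  "spectral_gap k p V =
     (INF f \<in> {f. \<not> f constant_on configs V}.
        measure_pmf.expectation (mu p V) (\<lambda>\<eta>. f \<eta> * - generator k p V f \<eta>)
        / measure_pmf.variance (mu p V) f)"

definition T_rel :: "nat \<Rightarrow> real \<Rightarrow> vertex set \<Rightarrow> real" where
  "T_rel k p V = inverse (spectral_gap k p V)"

text \<open>The Markov semigroup \<open>exp (t L)\<close> of the generator \<open>L\<close>, as a power series. For finite \<open>V\<close>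
  it converges on \<open>configs V\<close>, see \<open>summable_semigroup\<close> below.\<close>

definition semigroup :: "nat \<Rightarrow> real \<Rightarrow> vertex set \<Rightarrow> real \<Rightarrow> (config \<Rightarrow> real) \<Rightarrow> config \<Rightarrow> real" where
  "semigroup k p V t f \<eta> = (\<Sum>n. t ^ n / fact n * (generator k p V ^^ n) f \<eta>)"

definition law :: "nat \<Rightarrow> real \<Rightarrow> vertex set \<Rightarrow> config \<Rightarrow> real \<Rightarrow> config \<Rightarrow> real" where
  "law k p V \<eta> t \<sigma> = semigroup k p V t (indicator {\<sigma>}) \<eta>"

definition law_density :: "nat \<Rightarrow> real \<Rightarrow> vertex set \<Rightarrow> config \<Rightarrow> real \<Rightarrow> config \<Rightarrow> real" where
  "law_density k p V \<eta> t \<sigma> = law k p V \<eta> t \<sigma> / pmf (mu p V) \<sigma>"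

definition T_mix :: "nat \<Rightarrow> real \<Rightarrow> real \<Rightarrow> vertex set \<Rightarrow> real" where
  "T_mix k p a V =
     Inf {t. 0 \<le> t \<and>
       (MAX \<eta> \<in> configs V.
          measure_pmf.expectation (mu p V) (\<lambda>\<sigma>. \<bar>law_density k p V \<eta> t \<sigma> - 1\<bar> powr a) powr (1 / a))
       \<le> 1 / 4}"

definition p_crit :: "nat \<Rightarrow> real" where
  "p_crit k = 1 / real k"

lemma finite_tree_ball: "finite (tree_ball k n)"
proof -
  have "tree_ball k n = {xs. set xs \<subseteq> {..<k} \<and> length xs \<le> n}"
    by (auto simp: tree_ball_def tree_def in_lists_conv_set)
  then show ?thesis
    using finite_lists_length_le[of "{..<k}" n] by simp
qed

lemma finite_configs: "finite V \<Longrightarrow> finite (configs V)"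
  unfolding configs_def by (rule finite_PiE_dflt) auto

lemma configs_upd: "\<eta> \<in> configs V \<Longrightarrow> x \<in> V \<Longrightarrow> \<eta>(x := b) \<in> configs V"
  by (auto simp: configs_def PiE_dflt_def)

lemma set_pmf_mu:
  assumes "finite V" "0 < p" "p < 1"
  shows "set_pmf (mu p V) = configs V"
  unfolding mu_def configs_def using assms by (subst set_Pi_pmf) (auto simp: comp_def)

lemma generator_bound:
  assumes p: "0 \<le> p" "p \<le> 1" and M: "\<And>\<eta>. \<eta> \<in> configs V \<Longrightarrow> \<bar>f \<eta>\<bar> \<le> M"
    and \<eta>: "\<eta> \<in> configs V"
  shows "\<bar>generator k p V f \<eta>\<bar> \<le> (2 * real (card V)) * M"
proof -
  have M0: "0 \<le> M" using M[OF \<eta>] by linarith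
  have "\<bar>constr k V x \<eta> * (site_avg p x f \<eta> - f \<eta>)\<bar> \<le> 2 * M" if "x \<in> V" for x
  proof -
    have "\<bar>f (\<eta>(x := b))\<bar> \<le> M" for b using M configs_upd[OF \<eta> that] by blast
    then have T: "\<bar>f (\<eta>(x := True))\<bar> \<le> M" and F: "\<bar>f (\<eta>(x := False))\<bar> \<le> M" by blast+
    have "site_avg p x f \<eta> = p * f (\<eta>(x := True)) + (1 - p) * f (\<eta>(x := False))"
      unfolding site_avg_def using p by (simp add: integral_bernoulli_pmf)
    then have "\<bar>site_avg p x f \<eta>\<bar> \<le> \<bar>p * f (\<eta>(x := True))\<bar> + \<bar>(1 - p) * f (\<eta>(x := False))\<bar>"
      by linarith
    also have "\<dots> \<le> p * M + (1 - p) * M"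
      using p T F by (intro add_mono) (auto simp: abs_mult intro: mult_left_mono)
    finally have "\<bar>site_avg p x f \<eta>\<bar> \<le> M" by (simp add: algebra_simps)
    then show ?thesis using M[OF \<eta>] M0 by (auto simp: constr_def)
  qed
  then have "(\<Sum>x\<in>V. \<bar>constr k V x \<eta> * (site_avg p x f \<eta> - f \<eta>)\<bar>) \<le> (\<Sum>x\<in>V. 2 * M)"
    by (intro sum_mono)
  moreover have "\<bar>generator k p V f \<eta>\<bar> \<le> (\<Sum>x\<in>V. \<bar>constr k V x \<eta> * (site_avg p x f \<eta> - f \<eta>)\<bar>)"
    unfolding generator_def by (rule sum_abs)
  ultimately show ?thesis by simp
qed

lemma summable_semigroup:
  assumes V: "finite V" and p: "0 \<le> p" "p \<le> 1" and \<eta>: "\<eta> \<in> configs V"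
  shows "summable (\<lambda>n. t ^ n / fact n * (generator k p V ^^ n) f \<eta>)"
proof -
  define M where "M = Max ((\<lambda>\<eta>. \<bar>f \<eta>\<bar>) ` configs V)"
  have M: "\<bar>f \<xi>\<bar> \<le> M" if "\<xi> \<in> configs V" for \<xi>
    unfolding M_def using that V by (intro Max_ge) (auto simp: finite_configs)
  define C where "C = 2 * real (card V)"
  have B: "\<bar>(generator k p V ^^ n) f \<xi>\<bar> \<le> C ^ n * M" if "\<xi> \<in> configs V" for n \<xi>
    using that
  proof (induction n arbitrary: \<xi>)
    case 0
    then show ?case using M by simp
  next
    case (Suc n)
    have "\<bar>generator k p V ((generator k p V ^^ n) f) \<xi>\<bar> \<le> C * (C ^ n * M)"
      unfolding C_def using Suc by (intro generator_bound p) (auto simp: C_def)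
    then show ?case by (simp add: mult.assoc)
  qed
  have "summable (\<lambda>n. inverse (fact n) * (\<bar>t\<bar> * C) ^ n * M)"
    by (intro summable_mult2 summable_exp)
  then show ?thesis
  proof (rule summable_comparison_test'[where N = 0])
    fix n
    have "norm (t ^ n / fact n * (generator k p V ^^ n) f \<eta>)
        = \<bar>t\<bar> ^ n / fact n * \<bar>(generator k p V ^^ n) f \<eta>\<bar>"
      by (simp add: abs_mult power_abs)
    also have "\<dots> \<le> \<bar>t\<bar> ^ n / fact n * (C ^ n * M)"
      using B[OF \<eta>] by (intro mult_left_mono) auto
    finally show "norm (t ^ n / fact n * (generator k p V ^^ n) f \<eta>)
        \<le> inverse (fact n) * (\<bar>t\<bar> * C) ^ n * M"
      by (simp add: field_simps power_mult_distrib)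
  qed
qed

end

theory Submission imports Defs
begin

text \<open>
  Everything rests on Poincare inequalities \<open>poincare A T\<close>: for a finite vertex
  set \<open>A\<close> and every frozen configuration outside it, the variance over
  \<open>A\<close> is at most \<open>T\<close> times the averaged sum of the constrained site
  variances. For a ball the best \<open>T\<close> is the relaxation time.

  Relaxation times. A topmost vertex \<open>x\<close> of \<open>A\<close> enters no
  constraint, so variance and energy split along \<open>f = (f - \<mu>\<^sub>x f) +
  \<mu>\<^sub>x f\<close> (\<open>poincare_remove_top\<close>). Hence a forest is no worse
  than its trees (\<open>poincare_forest\<close>), and in a tree only functions centred at the
  root matter. For such a function on the ball of depth \<open>L\<close>,
  \<open>two_block\<close> compares two projections. \<open>Q1\<close> averages over the
  levels from \<open>m\<close> on. \<open>Q2\<close> explores the configuration upwards from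
  level \<open>l\<close>, inspecting a vertex only if one of its children is joined to level
  \<open>l\<close> by an occupied path, and then averages over the vertices never inspected.
  Children of the latter that were inspected are empty, so the uninspected part relaxes like a
  forest of depth less than \<open>l\<close>. The root is inspected only if an occupied path
  leads from a child to level \<open>l\<close>. This makes \<open>Q2\<close> small on
  root-centred functions of the levels above \<open>m\<close>
  (\<open>revealed_contraction\<close>), by the factor \<open>m\<close> times the probability
  that a vertex at level \<open>m - 1\<close> has a child joined to level \<open>l\<close>. If
  \<open>k p = 1\<close>, that probability is of order \<open>1 / (l - m)\<close>, so for a
  suitable constant factor larger than 1, multiplying the depth by it multiplies the
  relaxation time by at most 4, and growth is polynomial (\<open>critical_poincare\<close>).
  If \<open>k p < 1\<close>, it is exponentially small. The factor 2 caused by the overlap of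
  the blocks is then reduced to \<open>1 + 1 / w\<^sup>2\<close> by averaging over
  \<open>w\<^sup>2\<close> disjoint positions of the overlap, while the depth grows from
  \<open>w ^ 4\<close> to \<open>(w + 1) ^ 4\<close>. The product of these factors converges,
  so relaxation times are bounded (\<open>subcritical_poincare\<close>). In the other
  direction, at \<open>k p = 1\<close> the size of the occupied cluster of the root has
  variance of order \<open>L ^ 3\<close> and energy of order \<open>L\<close>
  (\<open>critical_poincare_lower\<close>).

  Mixing times, upper bound. The density of the law at time \<open>t\<close> is the semigroup
  applied to the density of the initial point mass, a product over vertices. For the factor
  that belongs to the subtree at \<open>x\<close>, averaging over the variable at
  \<open>x\<close> leaves the product of the factors of the child subtrees, which evolve
  independently. The rest has mean zero and decays at the rate of the spectral gap
  (\<open>mixing_step\<close>). So each further time span of a constant times the relaxation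
  time carries a bound on the second moment of the density one level up, and \<open>L +
  1\<close> spans suffice.

  Mixing times, lower bound. The bottom half of the tree consists of \<open>N = k ^ (L - L div
  2)\<close> independent copies of the ball of depth \<open>L div 2\<close>. Started in each
  copy from a point where an eigenfunction for the gap \<open>\<lambda>\<close> has maximal
  modulus \<open>M\<close>, the sum of the translated eigenfunctions has a mean of modulus
  \<open>N M exp (- \<lambda> t)\<close>, against a variance of at most \<open>N
  M\<^sup>2\<close> both at time \<open>t\<close> and in equilibrium. So the chain is not
  mixed before \<open>ln N / (2 \<lambda>)\<close>, a time of order \<open>L\<close>
  relaxation times (\<open>mixing_time_lower\<close>).
\<close>

section \<open>Averages over sets of vertices\<close>

text \<open>Functions take configurations of the whole tree as arguments, also when the
  dynamics lives on a finite volume. The coordinates that matter are recorded by this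
  predicate.\<close>

definition depends_on :: "(config \<Rightarrow> 'a) \<Rightarrow> vertex set \<Rightarrow> bool" where
  "depends_on f D \<longleftrightarrow> (\<forall>\<eta> \<xi>. (\<forall>x\<in>D. \<eta> x = \<xi> x) \<longrightarrow> f \<eta> = f \<xi>)"

lemma depends_onI: "(\<And>\<eta> \<xi>. (\<And>x. x \<in> D \<Longrightarrow> \<eta> x = \<xi> x) \<Longrightarrow> f \<eta> = f \<xi>) \<Longrightarrow> depends_on f D"
  unfolding depends_on_def by blast

lemma depends_onD: "depends_on f D \<Longrightarrow> (\<And>x. x \<in> D \<Longrightarrow> \<eta> x = \<xi> x) \<Longrightarrow> f \<eta> = f \<xi>"
  unfolding depends_on_def by blast

lemma depends_on_mono: "depends_on f D \<Longrightarrow> D \<subseteq> D' \<Longrightarrow> depends_on f D'"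
  unfolding depends_on_def by blast

lemma depends_on_upd: "depends_on f D \<Longrightarrow> x \<notin> D \<Longrightarrow> f (\<eta>(x := b)) = f \<eta>"
  by (rule depends_onD) auto

lemma depends_on_const: "depends_on (\<lambda>_. c) D"
  by (rule depends_onI) simp

lemma depends_on_coord: "x \<in> D \<Longrightarrow> depends_on (\<lambda>\<eta>. F (\<eta> x)) D"
  by (rule depends_onI) simp

lemma depends_on_comp: "depends_on f D \<Longrightarrow> depends_on (\<lambda>\<eta>. F (f \<eta>)) D"
  unfolding depends_on_def by metis

lemma depends_on_comp2:
  "depends_on f D \<Longrightarrow> depends_on g D \<Longrightarrow> depends_on (\<lambda>\<eta>. F (f \<eta>) (g \<eta>)) D"
  unfolding depends_on_def by metis

lemma depends_on_sum: "(\<And>i. i \<in> I \<Longrightarrow> depends_on (f i) D) \<Longrightarrow> depends_on (\<lambda>\<eta>. \<Sum>i\<in>I. f i \<eta>) D"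
  unfolding depends_on_def by (blast intro: sum.cong)

lemma depends_on_prod: "(\<And>i. i \<in> I \<Longrightarrow> depends_on (f i) D) \<Longrightarrow> depends_on (\<lambda>\<eta>. \<Prod>i\<in>I. f i \<eta>) D"
  unfolding depends_on_def by (blast intro: prod.cong)

definition grad :: "vertex \<Rightarrow> (config \<Rightarrow> real) \<Rightarrow> config \<Rightarrow> real" where
  "grad x f \<eta> = f (\<eta>(x := True)) - f (\<eta>(x := False))"

text \<open>Conditional expectation given the coordinates outside \<open>A\<close>. The result
  is again a function of the whole configuration, whose values outside \<open>A\<close> act as
  boundary condition. The order of the fold is immaterial because averages at different
  vertices commute.\<close>

definition avg :: "real \<Rightarrow> vertex set \<Rightarrow> (config \<Rightarrow> real) \<Rightarrow> config \<Rightarrow> real" where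
  "avg p A f = Finite_Set.fold (site_avg p) f A"

locale ofa =
  fixes k :: nat and p :: real
  assumes k2: "2 \<le> k" and p0: "0 < p" and p1: "p < 1"
begin

abbreviation sav :: "vertex \<Rightarrow> (config \<Rightarrow> real) \<Rightarrow> config \<Rightarrow> real" where
  "sav \<equiv> site_avg p"

abbreviation gen :: "vertex set \<Rightarrow> (config \<Rightarrow> real) \<Rightarrow> config \<Rightarrow> real" where
  "gen \<equiv> generator k p"

abbreviation sg :: "vertex set \<Rightarrow> real \<Rightarrow> (config \<Rightarrow> real) \<Rightarrow> config \<Rightarrow> real" where
  "sg \<equiv> semigroup k p"

abbreviation tball :: "nat \<Rightarrow> vertex set" where
  "tball \<equiv> tree_ball k"

abbreviation av :: "vertex set \<Rightarrow> (config \<Rightarrow> real) \<Rightarrow> config \<Rightarrow> real" where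
  "av \<equiv> avg p"

lemma sav_eq: "sav x f \<eta> = p * f (\<eta>(x := True)) + (1 - p) * f (\<eta>(x := False))"
  unfolding site_avg_def using p0 p1 by (simp add: integral_bernoulli_pmf)

lemma sav_commute: "sav x (sav y f) = sav y (sav x f)"
  by (cases "x = y") (auto simp: sav_eq fun_eq_iff fun_upd_twist algebra_simps)

sublocale sav: comp_fun_commute "site_avg p"
  by unfold_locales (simp add: fun_eq_iff sav_commute comp_def)

lemma av_empty [simp]: "av {} f = f"
  by (simp add: avg_def)

lemma av_insert: "finite A \<Longrightarrow> x \<notin> A \<Longrightarrow> av (insert x A) f = sav x (av A f)"
  unfolding avg_def by (rule sav.fold_insert) auto

lemma av_insert2: "finite A \<Longrightarrow> x \<notin> A \<Longrightarrow> av (insert x A) f = av A (sav x f)"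
  unfolding avg_def by (rule sav.fold_insert2) auto

lemma av_single: "av {x} f = sav x f"
  by (simp add: av_insert)

lemma av_Un: "finite A \<Longrightarrow> finite B \<Longrightarrow> A \<inter> B = {} \<Longrightarrow> av (A \<union> B) f = av A (av B f)"
  by (induction A rule: finite_induct) (auto simp: av_insert)

lemma av_Diff: "finite A \<Longrightarrow> B \<subseteq> A \<Longrightarrow> av A f = av (A - B) (av B f)"
  using av_Un[of "A - B" B f] by (auto simp: finite_subset Un_absorb2)

lemma av_remove: "finite A \<Longrightarrow> x \<in> A \<Longrightarrow> av A f = av (A - {x}) (sav x f)"
  using av_Diff[of A "{x}" f] by (simp add: av_single)

lemma sav_mono: "(\<And>b. f (\<eta>(x := b)) \<le> g (\<eta>(x := b))) \<Longrightarrow> sav x f \<eta> \<le> sav x g \<eta>"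
  unfolding sav_eq using p0 p1 by (intro add_mono mult_left_mono) auto

lemma av_mono:
  assumes "finite A" "\<And>\<xi>. (\<And>x. x \<notin> A \<Longrightarrow> \<xi> x = \<eta> x) \<Longrightarrow> f \<xi> \<le> g \<xi>"
  shows "av A f \<eta> \<le> av A g \<eta>"
  using assms
proof (induction A arbitrary: \<eta> rule: finite_induct)
  case (insert x A)
  show ?case
    unfolding av_insert[OF insert(1,2)]
    by (intro sav_mono insert.IH insert.prems) (auto simp: fun_upd_def)
qed simp

lemma av_cong:
  assumes "finite A" "\<And>\<xi>. (\<And>x. x \<notin> A \<Longrightarrow> \<xi> x = \<eta> x) \<Longrightarrow> f \<xi> = g \<xi>"
  shows "av A f \<eta> = av A g \<eta>"
  using assms by (intro antisym av_mono) auto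

lemma av_const: "finite A \<Longrightarrow> av A (\<lambda>_. c) = (\<lambda>_. c)"
  by (induction A rule: finite_induct) (simp_all add: av_insert, simp add: sav_eq fun_eq_iff algebra_simps)

lemma av_nonneg: "finite A \<Longrightarrow> (\<And>\<xi>. 0 \<le> f \<xi>) \<Longrightarrow> 0 \<le> av A f \<eta>"
  using av_mono[of A \<eta> "\<lambda>_. 0" f] by (simp add: av_const)

lemma sav_add: "sav x (\<lambda>\<xi>. f \<xi> + g \<xi>) = (\<lambda>\<xi>. sav x f \<xi> + sav x g \<xi>)"
  by (auto simp: sav_eq algebra_simps)

lemma sav_diff: "sav x (\<lambda>\<xi>. f \<xi> - g \<xi>) = (\<lambda>\<xi>. sav x f \<xi> - sav x g \<xi>)"
  by (auto simp: sav_eq algebra_simps)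

lemma sav_cmult: "sav x (\<lambda>\<xi>. c * f \<xi>) = (\<lambda>\<xi>. c * sav x f \<xi>)"
  by (auto simp: sav_eq algebra_simps)

lemma av_add: "finite A \<Longrightarrow> av A (\<lambda>\<xi>. f \<xi> + g \<xi>) = (\<lambda>\<xi>. av A f \<xi> + av A g \<xi>)"
  by (induction A rule: finite_induct) (simp_all add: av_insert sav_add)

lemma av_diff: "finite A \<Longrightarrow> av A (\<lambda>\<xi>. f \<xi> - g \<xi>) = (\<lambda>\<xi>. av A f \<xi> - av A g \<xi>)"
  by (induction A rule: finite_induct) (simp_all add: av_insert sav_diff)

lemma av_cmult: "finite A \<Longrightarrow> av A (\<lambda>\<xi>. c * f \<xi>) = (\<lambda>\<xi>. c * av A f \<xi>)"
  by (induction A rule: finite_induct) (simp_all add: av_insert sav_cmult)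

lemma av_sum: "finite A \<Longrightarrow> av A (\<lambda>\<xi>. \<Sum>i\<in>I. f i \<xi>) = (\<lambda>\<xi>. \<Sum>i\<in>I. av A (f i) \<xi>)"
  by (induction I rule: infinite_finite_induct) (simp_all add: av_const av_add)

lemma sav_pull: "(\<And>b. h (\<eta>(x := b)) = h \<eta>) \<Longrightarrow> sav x (\<lambda>\<xi>. h \<xi> * f \<xi>) \<eta> = h \<eta> * sav x f \<eta>"
  by (simp add: sav_eq algebra_simps)

lemma av_pull:
  assumes "finite A" "\<And>\<xi>. (\<And>x. x \<notin> A \<Longrightarrow> \<xi> x = \<eta> x) \<Longrightarrow> h \<xi> = h \<eta>"
  shows "av A (\<lambda>\<xi>. h \<xi> * f \<xi>) \<eta> = h \<eta> * av A f \<eta>"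
proof -
  have "av A (\<lambda>\<xi>. h \<xi> * f \<xi>) \<eta> = av A (\<lambda>\<xi>. h \<eta> * f \<xi>) \<eta>"
    by (rule av_cong[OF assms(1)], rule arg_cong2[where f = "(*)"], rule assms(2)) simp_all
  then show ?thesis by (simp add: av_cmult assms(1))
qed

lemma av_pull_dep:
  assumes "finite A" "depends_on h D" "A \<inter> D = {}"
  shows "av A (\<lambda>\<xi>. h \<xi> * f \<xi>) \<eta> = h \<eta> * av A f \<eta>"
  using assms(3) by (intro av_pull assms(1) depends_onD[OF assms(2)]) blast

lemma av_dep:
  assumes "finite A" "depends_on h D" "A \<inter> D = {}"
  shows "av A h \<eta> = h \<eta>"
  using av_pull_dep[OF assms, of "\<lambda>_. 1" \<eta>] by (simp add: av_const assms(1))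

lemma sav_dep: "depends_on h D \<Longrightarrow> x \<notin> D \<Longrightarrow> sav x h \<eta> = h \<eta>"
  using av_dep[of "{x}" h D \<eta>] by (simp add: av_single)

lemma sav_upd [simp]: "sav x f (\<eta>(x := b)) = sav x f \<eta>"
  by (simp add: sav_eq)

lemma sav_sav [simp]: "sav x (sav x f) = sav x f"
  by (simp add: sav_eq fun_eq_iff algebra_simps)

lemma depends_on_sav: "depends_on f (insert x D) \<Longrightarrow> depends_on (sav x f) D"
  unfolding sav_eq depends_on_def by (smt (verit, best) fun_upd_apply insertE)

lemma depends_on_av: "finite A \<Longrightarrow> depends_on f (D \<union> A) \<Longrightarrow> depends_on (av A f) D"
proof (induction A arbitrary: D rule: finite_induct)
  case (insert x A)
  then have "depends_on (av A f) (insert x D)" by (intro insert.IH) simp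
  then show ?case unfolding av_insert[OF insert(1,2)] by (rule depends_on_sav)
qed simp

lemma av_agree:
  assumes "finite A" "\<And>x. x \<notin> A \<Longrightarrow> \<xi> x = \<eta> x" shows "av A f \<xi> = av A f \<eta>"
proof -
  have "depends_on (av A f) (- A)"
  proof (intro depends_on_av assms(1) depends_onI)
    fix \<eta> \<xi> :: config assume "\<And>x. x \<in> - A \<union> A \<Longrightarrow> \<eta> x = \<xi> x"
    then have "\<eta> = \<xi>" by (auto simp: fun_eq_iff)
    then show "f \<eta> = f \<xi>" by simp
  qed
  then show ?thesis by (rule depends_onD) (simp add: assms(2))
qed

lemma av_idem: "finite A \<Longrightarrow> B \<subseteq> A \<Longrightarrow> av A (av B f) = av A f"
proof -
  assume A: "finite A" "B \<subseteq> A"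
  then have B: "finite B" by (rule finite_subset[rotated])
  have "av B (av B f) \<eta> = av B (\<lambda>_. av B f \<eta>) \<eta>" for \<eta>
    by (rule av_cong[OF B], rule av_agree[OF B]) simp
  then have "av B (av B f) = av B f" by (simp add: fun_eq_iff av_const B)
  then show ?thesis by (simp add: av_Diff[OF A])
qed

text \<open>Induction on the set averaged over: each vertex is seen by at most one of the two
  factors, and the other one passes through the average.\<close>

lemma av_indep:
  assumes "finite A" "depends_on f D" "depends_on g D'" "D \<inter> D' = {}"
  shows "av A (\<lambda>\<xi>. f \<xi> * g \<xi>) \<eta> = av A f \<eta> * av A g \<eta>"
  using assms
proof (induction A arbitrary: f g rule: finite_induct)
  case (insert x A)
  note I = av_insert2[OF insert(1,2)]
  consider "x \<notin> D" | "x \<notin> D'" using insert.prems by auto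
  then show ?case
  proof cases
    case 1
    then have 1: "sav x (\<lambda>\<xi>. f \<xi> * g \<xi>) = (\<lambda>\<xi>. f \<xi> * sav x g \<xi>)" "sav x f = f"
      using insert.prems by (auto simp: fun_eq_iff depends_on_upd sav_dep intro!: sav_pull)
    have "depends_on (sav x g) D'"
      using insert.prems(2) by (intro depends_on_sav) (auto elim: depends_on_mono)
    then show ?thesis unfolding I 1 using insert by simp
  next
    case 2
    then have 2: "sav x (\<lambda>\<xi>. f \<xi> * g \<xi>) = (\<lambda>\<xi>. sav x f \<xi> * g \<xi>)" "sav x g = g"
      using insert.prems sav_pull[of g _ x f] by (auto simp: fun_eq_iff depends_on_upd sav_dep mult.commute)
    have "depends_on (sav x f) D"
      using insert.prems(1) by (intro depends_on_sav) (auto elim: depends_on_mono)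
    then show ?thesis unfolding I 2 using insert by simp
  qed
qed simp

lemma av_prod:
  assumes "finite A" "finite I" "\<And>i. i \<in> I \<Longrightarrow> depends_on (f i) (D i)"
    "\<And>i j. i \<in> I \<Longrightarrow> j \<in> I \<Longrightarrow> i \<noteq> j \<Longrightarrow> D i \<inter> D j = {}"
  shows "av A (\<lambda>\<xi>. \<Prod>i\<in>I. f i \<xi>) \<eta> = (\<Prod>i\<in>I. av A (f i) \<eta>)"
  using assms(2-)
proof (induction I rule: finite_induct)
  case empty
  then show ?case by (simp add: av_const assms(1))
next
  case (insert i I)
  have D: "depends_on (\<lambda>\<xi>. \<Prod>j\<in>I. f j \<xi>) (\<Union>j\<in>I. D j)"
    using insert.prems(1) by (intro depends_on_prod depends_on_mono[OF insert.prems(1)]) auto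
  have "D i \<inter> D j = {}" if "j \<in> I" for j
    using insert.prems(2)[of i j] insert.hyps that by auto
  then have "D i \<inter> (\<Union>j\<in>I. D j) = {}" by blast
  then have "av A (\<lambda>\<xi>. f i \<xi> * (\<Prod>i\<in>I. f i \<xi>)) \<eta> = av A (f i) \<eta> * av A (\<lambda>\<xi>. \<Prod>i\<in>I. f i \<xi>) \<eta>"
    using insert.prems(1) by (intro av_indep[OF assms(1) _ D]) auto
  then show ?case using insert by simp
qed

lemma av_CS:
  assumes A: "finite A"
  shows "(av A (\<lambda>\<xi>. f \<xi> * g \<xi>) \<eta>)\<^sup>2 \<le> av A (\<lambda>\<xi>. (f \<xi>)\<^sup>2) \<eta> * av A (\<lambda>\<xi>. (g \<xi>)\<^sup>2) \<eta>"
proof -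
  let ?a = "av A (\<lambda>\<xi>. (f \<xi>)\<^sup>2) \<eta>" and ?b = "av A (\<lambda>\<xi>. f \<xi> * g \<xi>) \<eta>" and ?c = "av A (\<lambda>\<xi>. (g \<xi>)\<^sup>2) \<eta>"
  have q: "0 \<le> s\<^sup>2 * ?a + 2 * s * t * ?b + t\<^sup>2 * ?c" for s t
  proof -
    have "0 \<le> av A (\<lambda>\<xi>. (s * f \<xi> + t * g \<xi>)\<^sup>2) \<eta>" by (intro av_nonneg A) auto
    also have "(\<lambda>\<xi>. (s * f \<xi> + t * g \<xi>)\<^sup>2)
        = (\<lambda>\<xi>. s\<^sup>2 * (f \<xi>)\<^sup>2 + (2 * s * t * (f \<xi> * g \<xi>) + t\<^sup>2 * (g \<xi>)\<^sup>2))"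
      by (auto simp: fun_eq_iff power2_eq_square algebra_simps)
    finally show ?thesis by (simp add: av_add av_cmult A)
  qed
  have nn: "0 \<le> ?a" "0 \<le> ?c" by (intro av_nonneg A; simp)+
  show ?thesis
  proof (cases "?c = 0")
    case True
    have "?b = 0"
    proof (rule ccontr)
      assume b: "?b \<noteq> 0"
      have "0 \<le> ?a + 2 * (- (?a + 1) / (2 * ?b)) * ?b"
        using q[of 1 "- (?a + 1) / (2 * ?b)"] True by simp
      then show False using b by (simp add: field_simps)
    qed
    then show ?thesis using True by simp
  next
    case False
    then have c: "0 < ?c" using nn by simp
    have "0 \<le> ?c * (?a * ?c - ?b\<^sup>2)"
      using q[of ?c "- ?b"] by (simp add: power2_eq_square algebra_simps)
    then have "0 \<le> ?a * ?c - ?b\<^sup>2" using c by (simp add: zero_le_mult_iff)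
    then show ?thesis by simp
  qed
qed

lemma av_square_le: "finite A \<Longrightarrow> (av A f \<eta>)\<^sup>2 \<le> av A (\<lambda>\<xi>. (f \<xi>)\<^sup>2) \<eta>"
  using av_CS[of A f "\<lambda>_. 1" \<eta>] by (simp add: av_const)

lemma expectation_mu:
  assumes "finite V"
  shows "measure_pmf.expectation (mu p V) f = av V f (\<lambda>_. False)"
  using assms
proof (induction V arbitrary: f rule: finite_induct)
  case empty
  then show ?case by (simp add: mu_def)
next
  case (insert x V)
  let ?S = "set_pmf (mu p V)"
  have fin: "finite ?S"
    using insert p0 p1 by (simp add: set_pmf_mu finite_configs)
  have "mu p (insert x V) = mu p V \<bind> (\<lambda>\<xi>. map_pmf (\<lambda>b. \<xi>(x := b)) (bernoulli_pmf p))"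
    using insert.hyps unfolding mu_def
    by (simp add: Pi_pmf_insert' map_pmf_def bind_commute_pmf[of "bernoulli_pmf p"])
  moreover have "measure_pmf.expectation (mu p V \<bind> (\<lambda>\<xi>. map_pmf (\<lambda>b. \<xi>(x := b)) (bernoulli_pmf p))) f
    = (\<Sum>\<xi>\<in>?S. pmf (mu p V) \<xi> *\<^sub>R measure_pmf.expectation (map_pmf (\<lambda>b. \<xi>(x := b)) (bernoulli_pmf p)) f)"
    using fin by (intro pmf_expectation_bind) auto
  moreover have "\<dots> = measure_pmf.expectation (mu p V)
      (\<lambda>\<xi>. measure_pmf.expectation (map_pmf (\<lambda>b. \<xi>(x := b)) (bernoulli_pmf p)) f)"
    using fin by (intro integral_measure_pmf[symmetric]) auto
  ultimately show ?case
    by (simp add: insert av_insert2 site_avg_def[abs_def])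
qed

end

section \<open>Poincare inequalities for finite vertex sets\<close>

context ofa
begin

definition site_var :: "vertex \<Rightarrow> (config \<Rightarrow> real) \<Rightarrow> config \<Rightarrow> real" where
  "site_var y f \<eta> = p * (1 - p) * (grad y f \<eta>)\<^sup>2"

text \<open>The constraints are those of the finite volume \<open>A\<close>, so children
  outside \<open>A\<close> count as empty. Averaged over \<open>A\<close>, this is the
  Dirichlet form.\<close>

definition energy :: "vertex set \<Rightarrow> (config \<Rightarrow> real) \<Rightarrow> config \<Rightarrow> real" where
  "energy A f \<eta> = (\<Sum>y\<in>A. constr k A y \<eta> * site_var y f \<eta>)"

text \<open>The inequality is required for every configuration \<open>\<eta>\<close> outside
  \<open>A\<close>, so that it can be applied to volumes that themselves depend on the
  configuration.\<close>

definition poincare :: "vertex set \<Rightarrow> real \<Rightarrow> bool" where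
  "poincare A T \<longleftrightarrow> (\<forall>f \<eta>. av A (\<lambda>\<xi>. (f \<xi>)\<^sup>2) \<eta> - (av A f \<eta>)\<^sup>2 \<le> T * av A (energy A f) \<eta>)"

text \<open>For functions centred at \<open>x\<close> the variance is the second moment.\<close>

definition root_poincare :: "vertex set \<Rightarrow> vertex \<Rightarrow> real \<Rightarrow> bool" where
  "root_poincare A x T \<longleftrightarrow>
     (\<forall>f \<eta>. sav x f = (\<lambda>_. 0) \<longrightarrow> av A (\<lambda>\<xi>. (f \<xi>)\<^sup>2) \<eta> \<le> T * av A (energy A f) \<eta>)"

lemma constr_nonneg: "0 \<le> constr k A y \<eta>"
  by (simp add: constr_def)

lemma constr_le_1: "constr k A y \<eta> \<le> 1"
  by (simp add: constr_def)

lemma constr_antimono: "A \<subseteq> B \<Longrightarrow> constr k B y \<eta> \<le> constr k A y \<eta>"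
  by (auto simp: constr_def)

lemma constr_closed: "A \<subseteq> B \<Longrightarrow> children k y \<inter> B \<subseteq> A \<Longrightarrow> constr k B y = constr k A y"
  by (auto simp: constr_def fun_eq_iff)

lemma depends_on_constr: "depends_on (constr k A y) (children k y \<inter> A)"
  unfolding constr_def by (rule depends_onI) auto

lemma not_child_self: "x \<notin> children k x"
  by (auto simp: children_def)

lemma site_var_nonneg: "0 \<le> site_var y f \<eta>"
  using p0 p1 by (simp add: site_var_def)

lemma energy_nonneg: "0 \<le> energy A f \<eta>"
  unfolding energy_def by (intro sum_nonneg mult_nonneg_nonneg constr_nonneg site_var_nonneg)

lemma grad_upd [simp]: "grad y f (\<eta>(y := b)) = grad y f \<eta>"
  by (simp add: grad_def)

lemma site_var_upd [simp]: "site_var y f (\<eta>(y := b)) = site_var y f \<eta>"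
  by (simp add: site_var_def)

lemma depends_on_grad: "depends_on f D \<Longrightarrow> depends_on (grad y f) D"
  unfolding grad_def
  by (intro depends_onI arg_cong2[where f = "(-)"]; elim depends_onD) auto

lemma depends_on_site_var: "depends_on f D \<Longrightarrow> depends_on (site_var y f) D"
  unfolding site_var_def
  by (rule depends_on_comp[where F = "\<lambda>x. p * (1 - p) * x\<^sup>2", OF depends_on_grad])

lemma grad_0: "depends_on f D \<Longrightarrow> y \<notin> D \<Longrightarrow> grad y f \<eta> = 0"
  by (simp add: grad_def depends_on_upd)

lemma site_var_0: "depends_on f D \<Longrightarrow> y \<notin> D \<Longrightarrow> site_var y f \<eta> = 0"
  by (simp add: site_var_def grad_0)

lemma depends_on_energy:
  "depends_on f D \<Longrightarrow> A \<subseteq> D \<Longrightarrow> depends_on (energy A f) D"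
  unfolding energy_def
  by (intro depends_on_sum depends_on_comp2[where F = "(*)"] depends_on_site_var
      depends_on_mono[OF depends_on_constr]) auto

lemma grad_sav: "x \<noteq> y \<Longrightarrow> grad y (sav x f) = sav x (grad y f)"
  by (auto simp: grad_def sav_eq fun_eq_iff fun_upd_twist algebra_simps)

lemma sav_square: "sav x (\<lambda>\<xi>. (f \<xi>)\<^sup>2) \<eta> = (sav x f \<eta>)\<^sup>2 + site_var x f \<eta>"
  by (simp add: sav_eq site_var_def grad_def power2_eq_square algebra_simps)

lemma poincareD: "poincare A T \<Longrightarrow> av A (\<lambda>\<xi>. (f \<xi>)\<^sup>2) \<eta> - (av A f \<eta>)\<^sup>2 \<le> T * av A (energy A f) \<eta>"
  by (simp add: poincare_def)

lemma poincare_weaken: "finite A \<Longrightarrow> poincare A T \<Longrightarrow> T \<le> T' \<Longrightarrow> poincare A T'"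
  unfolding poincare_def
  by (meson av_nonneg energy_nonneg mult_right_mono order_trans)

lemma root_poincare_weaken: "finite A \<Longrightarrow> root_poincare A x T \<Longrightarrow> T \<le> T' \<Longrightarrow> root_poincare A x T'"
  unfolding root_poincare_def
  by (meson av_nonneg energy_nonneg mult_right_mono order_trans)

lemma poincare_imp_root_poincare:
  assumes "finite A" "x \<in> A" "poincare A T"
  shows "root_poincare A x T"
  unfolding root_poincare_def
proof (intro allI impI)
  fix f \<eta> assume "sav x f = (\<lambda>_. 0)"
  then have "av A f \<eta> = 0" using assms by (simp add: av_remove av_const)
  then show "av A (\<lambda>\<xi>. (f \<xi>)\<^sup>2) \<eta> \<le> T * av A (energy A f) \<eta>"
    using poincareD[OF assms(3), of f \<eta>] by simp
qed

text \<open>The gradient at \<open>y\<close> commutes with the average at \<open>x\<close>, so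
  the parts \<open>f - \<mu>\<^sub>x f\<close> and \<open>\<mu>\<^sub>x f\<close> stay
  orthogonal after taking it.\<close>

lemma sav_site_var_split:
  assumes "x \<noteq> y" "\<And>b. c (\<eta>(x := b)) = c \<eta>"
  shows "sav x (\<lambda>\<xi>. c \<xi> * site_var y (\<lambda>\<zeta>. f \<zeta> - sav x f \<zeta>) \<xi>) \<eta> + sav x (\<lambda>\<xi>. c \<xi> * site_var y (sav x f) \<xi>) \<eta>
    = sav x (\<lambda>\<xi>. c \<xi> * site_var y f \<xi>) \<eta>"
proof -
  have g: "grad y (\<lambda>\<zeta>. f \<zeta> - sav x f \<zeta>) = (\<lambda>\<xi>. grad y f \<xi> - sav x (grad y f) \<xi>)"
    unfolding grad_sav[OF assms(1), symmetric] by (simp add: grad_def fun_eq_iff)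
  define a b where "a = grad y f (\<eta>(x := True))" and "b = grad y f (\<eta>(x := False))"
  have s: "sav x (grad y f) \<eta> = p * a + (1 - p) * b" by (simp add: sav_eq a_def b_def)
  have "sav x (\<lambda>\<xi>. c \<xi> * site_var y (\<lambda>\<zeta>. f \<zeta> - sav x f \<zeta>) \<xi> + c \<xi> * site_var y (sav x f) \<xi>) \<eta>
     = c \<eta> * (p * (1 - p)) * (p * ((a - (p * a + (1 - p) * b))\<^sup>2 + (p * a + (1 - p) * b)\<^sup>2)
          + (1 - p) * ((b - (p * a + (1 - p) * b))\<^sup>2 + (p * a + (1 - p) * b)\<^sup>2))"
    unfolding site_var_def g grad_sav[OF assms(1)] sav_eq[of x "\<lambda>\<xi>. _ \<xi> + _ \<xi>"] assms(2) sav_upd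
      a_def[symmetric] b_def[symmetric] s
    by (simp add: algebra_simps)
  also have "\<dots> = c \<eta> * (p * (1 - p)) * (p * a\<^sup>2 + (1 - p) * b\<^sup>2)"
    by algebra
  also have "\<dots> = sav x (\<lambda>\<xi>. c \<xi> * site_var y f \<xi>) \<eta>"
    by (simp add: sav_eq assms(2) site_var_def a_def b_def algebra_simps)
  finally show ?thesis by (simp add: sav_add)
qed

text \<open>The vertex \<open>x\<close> appears in no constraint of \<open>V\<close>.
  Therefore both sides of the inequality split along \<open>f = (f - \<mu>\<^sub>x f) +
  \<mu>\<^sub>x f\<close>: the first part is centred at \<open>x\<close> and is handled inside
  \<open>U\<close>, the part of \<open>V\<close> below \<open>x\<close>, and the second one is
  a function of the remaining vertices.\<close>

lemma poincare_remove_top: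
  assumes V: "finite V" "x \<in> V" "\<And>y. y \<in> V \<Longrightarrow> x \<notin> children k y"
    and U: "U \<subseteq> V" "x \<in> U" "\<And>y. y \<in> U \<Longrightarrow> children k y \<inter> V \<subseteq> U"
    and rp: "root_poincare U x T" and pi: "poincare (V - {x}) T" and T: "0 \<le> T"
  shows "poincare V T"
  unfolding poincare_def
proof (intro allI)
  fix f \<eta>
  define f1 where "f1 = sav x f"
  define g where "g = (\<lambda>\<xi>. f \<xi> - f1 \<xi>)"
  have fin: "finite U" "finite (V - {x})" "finite (V - U)" using V(1) U(1) by (auto intro: finite_subset)
  have avx: "av V (sav x h) = av V h" for h
    using av_idem[of V "{x}" h] V by (simp add: av_single)
  have g0: "sav x g = (\<lambda>_. 0)"
    by (simp add: g_def f1_def sav_diff fun_eq_iff)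
  have lg: "site_var x g = site_var x f"
    by (simp add: g_def f1_def site_var_def grad_def fun_eq_iff)
  have lf1: "site_var x f1 = (\<lambda>_. 0)"
    by (simp add: f1_def site_var_def grad_def fun_eq_iff)
  have c: "constr k V y (\<xi>(x := b)) = constr k V y \<xi>" if "y \<in> V" for y \<xi> b
    using V(3)[OF that] by (intro depends_on_upd[OF depends_on_constr]) auto
  have cx: "constr k (V - {x}) y = constr k V y" if "y \<in> V" for y
    using V(3)[OF that] by (intro constr_closed[symmetric]) auto
  have cU: "constr k U y = constr k V y" if "y \<in> U" for y
    using U(3)[OF that] by (intro constr_closed[symmetric] U(1))
  have step1: "av V (\<lambda>\<xi>. (g \<xi>)\<^sup>2) \<eta> \<le> T * av V (energy U g) \<eta>"
  proof -
    have "av V (\<lambda>\<xi>. (g \<xi>)\<^sup>2) \<eta> = av (V - U) (av U (\<lambda>\<xi>. (g \<xi>)\<^sup>2)) \<eta>"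
      by (simp add: av_Diff[OF V(1) U(1)])
    also have "\<dots> \<le> av (V - U) (\<lambda>\<xi>. T * av U (energy U g) \<xi>) \<eta>"
      using rp g0 unfolding root_poincare_def by (intro av_mono fin) auto
    also have "\<dots> = T * av V (energy U g) \<eta>"
      by (simp add: av_Diff[OF V(1) U(1)] av_cmult fin)
    finally show ?thesis .
  qed
  have step2: "av V (\<lambda>\<xi>. (f1 \<xi>)\<^sup>2) \<eta> - (av V f1 \<eta>)\<^sup>2 \<le> T * av V (energy (V - {x}) f1) \<eta>"
  proof -
    have e: "sav x (energy (V - {x}) f1) = energy (V - {x}) f1"
    proof
      fix \<xi>
      have "energy (V - {x}) f1 (\<xi>(x := b)) = energy (V - {x}) f1 \<xi>" for b
        unfolding energy_def
        by (rule sum.cong) (auto simp: cx c site_var_def grad_def f1_def fun_upd_twist)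
      then show "sav x (energy (V - {x}) f1) \<xi> = energy (V - {x}) f1 \<xi>"
        by (simp add: sav_eq algebra_simps)
    qed
    have s: "sav x f1 = f1" "sav x (\<lambda>\<xi>. (f1 \<xi>)\<^sup>2) = (\<lambda>\<xi>. (f1 \<xi>)\<^sup>2)"
      by (simp_all add: f1_def, simp add: fun_eq_iff sav_square lf1[unfolded f1_def])
    show ?thesis
      using poincareD[OF pi, of f1 \<eta>] unfolding av_remove[OF V(1,2)] s e .
  qed
  have step3: "av V (energy U g) \<eta> + av V (energy (V - {x}) f1) \<eta> \<le> av V (energy V f) \<eta>"
  proof -
    define R where "R = (\<lambda>\<xi>. constr k V x \<xi> * site_var x f \<xi>
       + (\<Sum>y\<in>V - {x}. constr k V y \<xi> * site_var y g \<xi> + constr k V y \<xi> * site_var y f1 \<xi>))"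
    have "energy U g \<xi> + energy (V - {x}) f1 \<xi> \<le> R \<xi>" for \<xi>
    proof -
      have "energy U g \<xi> = (\<Sum>y\<in>U. constr k V y \<xi> * site_var y g \<xi>)"
        unfolding energy_def by (simp add: cU)
      also have "\<dots> \<le> (\<Sum>y\<in>V. constr k V y \<xi> * site_var y g \<xi>)"
        by (intro sum_mono2 V U mult_nonneg_nonneg constr_nonneg site_var_nonneg)
      also have "\<dots> = constr k V x \<xi> * site_var x f \<xi> + (\<Sum>y\<in>V - {x}. constr k V y \<xi> * site_var y g \<xi>)"
        by (simp add: sum.remove[OF V(1,2)] lg)
      finally show ?thesis
        unfolding R_def by (simp add: energy_def cx sum.distrib)
    qed
    then have "av V (\<lambda>\<xi>. energy U g \<xi> + energy (V - {x}) f1 \<xi>) \<eta> \<le> av V R \<eta>"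
      by (intro av_mono V) auto
    moreover have "av V R = av V (energy V f)"
    proof -
      have "sav x R \<xi> = sav x (energy V f) \<xi>" for \<xi>
      proof -
        have sum_sav: "sav x (\<lambda>\<xi>. \<Sum>i\<in>I. F i \<xi>) \<xi> = (\<Sum>i\<in>I. sav x (F i) \<xi>)" for I and F :: "vertex \<Rightarrow> config \<Rightarrow> real"
          using av_sum[of "{x}" F I] by (simp add: av_single)
        have "sav x R \<xi> = sav x (\<lambda>\<xi>. constr k V x \<xi> * site_var x f \<xi>) \<xi>
            + (\<Sum>y\<in>V - {x}. sav x (\<lambda>\<xi>. constr k V y \<xi> * site_var y f \<xi>) \<xi>)"
          unfolding R_def sav_add sum_sav g_def f1_def
          by (intro arg_cong2[where f = "(+)"] refl sum.cong sav_site_var_split) (auto simp: c)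
        also have "\<dots> = sav x (energy V f) \<xi>"
          unfolding energy_def sum_sav by (simp add: sum.remove[OF V(1,2)])
        finally show ?thesis .
      qed
      then have "sav x R = sav x (energy V f)" by auto
      then show ?thesis using avx by metis
    qed
    ultimately show ?thesis by (simp add: av_add V)
  qed
  have "av V (\<lambda>\<xi>. (f \<xi>)\<^sup>2) \<eta> = av V (\<lambda>\<xi>. (f1 \<xi>)\<^sup>2) \<eta> + av V (\<lambda>\<xi>. (g \<xi>)\<^sup>2) \<eta>"
  proof -
    have "sav x (\<lambda>\<xi>. (f \<xi>)\<^sup>2) = sav x (\<lambda>\<xi>. (f1 \<xi>)\<^sup>2 + (g \<xi>)\<^sup>2)"
      unfolding sav_add by (rule ext) (simp add: sav_square lf1 lg g0, simp add: f1_def)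
    then have "av V (\<lambda>\<xi>. (f \<xi>)\<^sup>2) = av V (\<lambda>\<xi>. (f1 \<xi>)\<^sup>2 + (g \<xi>)\<^sup>2)" using avx by metis
    then show ?thesis by (simp add: av_add V)
  qed
  moreover have "av V f \<eta> = av V f1 \<eta>" by (simp add: f1_def avx)
  ultimately have "av V (\<lambda>\<xi>. (f \<xi>)\<^sup>2) \<eta> - (av V f \<eta>)\<^sup>2
      \<le> T * (av V (energy U g) \<eta> + av V (energy (V - {x}) f1) \<eta>)"
    using step1 step2 by (simp add: algebra_simps)
  also have "\<dots> \<le> T * av V (energy V f) \<eta>"
    by (intro mult_left_mono step3 T)
  finally show "av V (\<lambda>\<xi>. (f \<xi>)\<^sup>2) \<eta> - (av V f \<eta>)\<^sup>2 \<le> T * av V (energy V f) \<eta>" .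
qed

text \<open>Inserting the boundary values into \<open>f\<close> gives a function of the
  coordinates in \<open>A\<close> alone with the same variance and energy.\<close>

lemma localize:
  assumes A: "finite A"
  obtains f' where "depends_on f' A" "av A f' \<eta> = av A f \<eta>"
    "av A (\<lambda>\<xi>. (f' \<xi>)\<^sup>2) \<eta> = av A (\<lambda>\<xi>. (f \<xi>)\<^sup>2) \<eta>"
    "av A (energy A f') \<eta> = av A (energy A f) \<eta>"
proof -
  define f' :: "config \<Rightarrow> real" where "f' = (\<lambda>\<xi>. f (\<lambda>y. if y \<in> A then \<xi> y else \<eta> y))"
  have eqf: "f' \<xi> = f \<xi>" if "\<And>y. y \<notin> A \<Longrightarrow> \<xi> y = \<eta> y" for \<xi>
    unfolding f'_def using that by (intro arg_cong[where f = f]) auto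
  show ?thesis
  proof (rule that[of f'])
    show "depends_on f' A"
      unfolding f'_def by (intro depends_onI arg_cong[where f = f]) auto
    show "av A (energy A f') \<eta> = av A (energy A f) \<eta>"
    proof (rule av_cong[OF A])
      fix \<xi> assume \<xi>: "\<And>x. x \<notin> A \<Longrightarrow> \<xi> x = \<eta> x"
      show "energy A f' \<xi> = energy A f \<xi>"
        unfolding energy_def site_var_def grad_def using \<xi>
        by (intro sum.cong refl arg_cong2[where f = "(*)"] arg_cong[where f = "\<lambda>x. x\<^sup>2"]
            arg_cong2[where f = "(-)"] eqf) auto
    qed
  qed (auto intro!: av_cong[OF A] simp: eqf)
qed

text \<open>A function of the coordinates in \<open>A\<close> has no energy at the other
  vertices of \<open>B\<close>, and constraints only become more restrictive when the volume
  grows.\<close>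

lemma poincare_subset:
  assumes B: "finite B" "A \<subseteq> B" and pi: "poincare B T" and T: "0 \<le> T"
  shows "poincare A T"
  unfolding poincare_def
proof (intro allI)
  fix f \<eta>
  have A: "finite A" "finite (B - A)" using B by (auto intro: finite_subset)
  obtain f' where f': "depends_on f' A" and eq: "av A f' \<eta> = av A f \<eta>"
    "av A (\<lambda>\<xi>. (f' \<xi>)\<^sup>2) \<eta> = av A (\<lambda>\<xi>. (f \<xi>)\<^sup>2) \<eta>" "av A (energy A f') \<eta> = av A (energy A f) \<eta>"
    by (rule localize[OF A(1)])
  have avB: "av B h = av A h" if "depends_on h A" for h
  proof -
    have "av (B - A) h = h" using that by (intro ext av_dep[OF A(2)]) auto
    moreover have "av B h = av A (av (B - A) h)" using av_Un[of A "B - A" h] A B by (simp add: Un_absorb1)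
    ultimately show ?thesis by simp
  qed
  have "energy B f' \<xi> \<le> energy A f' \<xi>" for \<xi>
  proof -
    have "energy B f' \<xi> = (\<Sum>y\<in>A. constr k B y \<xi> * site_var y f' \<xi>)"
      unfolding energy_def using site_var_0[OF f'] by (intro sum.mono_neutral_right B) auto
    also have "\<dots> \<le> energy A f' \<xi>"
      unfolding energy_def by (intro sum_mono mult_right_mono constr_antimono site_var_nonneg B)
    finally show ?thesis .
  qed
  then have "av B (energy B f') \<eta> \<le> av A (energy A f') \<eta>"
    using av_mono[OF B(1), of \<eta> "energy B f'" "energy A f'"] avB[OF depends_on_energy[OF f']] by simp
  then have "T * av B (energy B f') \<eta> \<le> T * av A (energy A f) \<eta>"
    unfolding eq by (intro mult_left_mono T)
  then show "av A (\<lambda>\<xi>. (f \<xi>)\<^sup>2) \<eta> - (av A f \<eta>)\<^sup>2 \<le> T * av A (energy A f) \<eta>"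
    using poincareD[OF pi, of f' \<eta>] avB[OF f'] avB[OF depends_on_comp[OF f', of "\<lambda>x. x\<^sup>2"]]
    by (simp add: eq)
qed

end

section \<open>Forests and finite trees\<close>

lemma length_child: "y \<in> children k x \<Longrightarrow> length y = Suc (length x)"
  by (auto simp: children_def)

lemma children_append: "children k (x @ w) = (@) x ` children k w"
  by (auto simp: children_def)

text \<open>The configuration \<open>\<zeta>\<close>, translated to the subtree at
  \<open>x\<close>, inside the environment \<open>\<eta>\<close>.\<close>

definition graft :: "vertex \<Rightarrow> config \<Rightarrow> config \<Rightarrow> config" where
  "graft x \<eta> \<zeta> = (\<lambda>y. if y \<in> range ((@) x) then \<zeta> (drop (length x) y) else \<eta> y)"

lemma graft_upd: "(graft x \<eta> \<zeta>)(x @ w := b) = graft x \<eta> (\<zeta>(w := b))"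
  by (auto simp: graft_def fun_eq_iff)

lemma graft_append [simp]: "graft x \<eta> \<zeta> (x @ w) = \<zeta> w"
  by (simp add: graft_def)

lemma graft_self: "graft x \<eta> (\<lambda>w. \<eta> (x @ w)) = \<eta>"
  by (auto simp: graft_def fun_eq_iff)

lemma constr_append: "constr k ((@) x ` A) (x @ w) \<eta> = constr k A w (\<lambda>v. \<eta> (x @ v))"
  by (auto simp: constr_def children_append)

lemma tree_append: "x @ w \<in> tree k \<longleftrightarrow> x \<in> tree k \<and> w \<in> tree k"
  by (auto simp: tree_def)

context ofa
begin

lemma av_graft:
  assumes "finite A"
  shows "av ((@) x ` A) f (graft x \<eta> \<zeta>) = av A (\<lambda>\<zeta>. f (graft x \<eta> \<zeta>)) \<zeta>"
  using assms
proof (induction A arbitrary: \<zeta> rule: finite_induct)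
  case (insert w A)
  have "x @ w \<notin> (@) x ` A" using insert by auto
  then show ?case
    unfolding image_insert av_insert[OF insert.hyps] av_insert[OF finite_imageI[OF insert.hyps(1)] \<open>x @ w \<notin> (@) x ` A\<close>]
    by (simp only: sav_eq graft_upd insert.IH)
qed simp

lemma poincare_translate:
  assumes A: "finite A" and pi: "poincare A T"
  shows "poincare ((@) x ` A) T"
  unfolding poincare_def
proof (intro allI)
  fix f :: "config \<Rightarrow> real" and \<eta>
  define F where "F = (\<lambda>\<zeta>. f (graft x \<eta> \<zeta>))"
  define \<zeta> where "\<zeta> = (\<lambda>w. \<eta> (x @ w))"
  have e: "energy ((@) x ` A) f (graft x \<eta> \<xi>) = energy A F \<xi>" for \<xi>
    unfolding energy_def F_def site_var_def grad_def
    by (subst sum.reindex) (auto simp: inj_on_def constr_append graft_upd intro!: sum.cong)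
  have a: "av ((@) x ` A) h \<eta> = av A (\<lambda>\<zeta>. h (graft x \<eta> \<zeta>)) \<zeta>" for h
    using av_graft[OF A, of x h \<eta> \<zeta>] by (simp add: \<zeta>_def graft_self)
  show "av ((@) x ` A) (\<lambda>\<xi>. (f \<xi>)\<^sup>2) \<eta> - (av ((@) x ` A) f \<eta>)\<^sup>2 \<le> T * av ((@) x ` A) (energy ((@) x ` A) f) \<eta>"
    unfolding a e using poincareD[OF pi, of F \<zeta>] by (simp add: F_def)
qed

lemma poincare_empty: "poincare {} T"
  by (simp add: poincare_def energy_def)

text \<open>Remove the vertices in the order of increasing depth. What lies below the removed
  vertex is part of a translate of the ball of depth \<open>n\<close>.\<close>

lemma poincare_forest:
  assumes pi: "poincare (tball n) T" and T: "0 \<le> T"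
    and V: "finite V" "V \<subseteq> tree k" "\<And>x. x \<in> V \<Longrightarrow> d \<le> length x \<and> length x \<le> d + n"
  shows "poincare V T"
  using V
proof (induction V rule: finite_psubset_induct)
  case (psubset V)
  show ?case
  proof (cases "V = {}")
    case True
    then show ?thesis by (simp add: poincare_empty)
  next
    case False
    then obtain x where x: "x \<in> V" and min: "\<And>y. y \<in> V \<Longrightarrow> length x \<le> length y"
      using ex_has_least_nat[of "\<lambda>x. x \<in> V" _ length] by blast
    define U where "U = V \<inter> range ((@) x)"
    have "U \<subseteq> (@) x ` tball n"
    proof
      fix y assume "y \<in> U"
      then obtain w where w: "y = x @ w" "y \<in> V" by (auto simp: U_def)
      then have "w \<in> tree k" "length w \<le> n"
        using psubset.prems(1) psubset.prems(2)[of y] psubset.prems(2)[of x] x by (auto simp: tree_append)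
      then show "y \<in> (@) x ` tball n" using w by (auto simp: tree_ball_def)
    qed
    then have "poincare U T"
      by (rule poincare_subset[OF finite_imageI[OF finite_tree_ball] _
            poincare_translate[OF finite_tree_ball pi] T])
    moreover have xU: "x \<in> U"
      unfolding U_def using x by (metis IntI append_Nil2 rangeI)
    moreover have "finite U" using psubset.hyps by (simp add: U_def)
    ultimately have rp: "root_poincare U x T"
      by (intro poincare_imp_root_poincare)
    show ?thesis
    proof (rule poincare_remove_top[OF psubset.hyps(1) x, where U = U])
      show "x \<notin> children k y" if "y \<in> V" for y
        using min[OF that] by (auto dest: length_child)
      show "children k y \<inter> V \<subseteq> U" if "y \<in> U" for y
        using that by (auto simp: U_def children_def)
      show "poincare (V - {x}) T"
        using x psubset.prems by (intro psubset.IH) auto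
      show "U \<subseteq> V" by (simp add: U_def)
    qed (rule xU rp T)+
  qed
qed

text \<open>Each of the configurations averaged over has weight at least \<open>min p (1 - p)
  ^ card A\<close>.\<close>

lemma av_ge_point:
  assumes "finite A" "\<And>\<xi>. 0 \<le> F \<xi>" "\<And>x. x \<notin> A \<Longrightarrow> \<xi> x = \<eta> x"
  shows "min p (1 - p) ^ card A * F \<xi> \<le> av A F \<eta>"
  using assms
proof (induction A arbitrary: \<eta> rule: finite_induct)
  case empty
  then have "\<xi> = \<eta>" by auto
  then show ?case by simp
next
  case (insert x A)
  let ?d = "min p (1 - p)"
  have nn: "0 \<le> av A F \<zeta>" for \<zeta> using insert by (intro av_nonneg) auto
  have "?d * av A F (\<eta>(x := \<xi> x)) \<le> sav x (av A F) \<eta>"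
  proof (cases "\<xi> x")
    case True
    then show ?thesis
      unfolding sav_eq using nn p0 p1 by (intro add_increasing2 mult_nonneg_nonneg) (auto intro: mult_right_mono)
  next
    case False
    then show ?thesis
      unfolding sav_eq using nn p0 p1 by (intro add_increasing mult_nonneg_nonneg) (auto intro: mult_right_mono)
  qed
  moreover have "?d ^ card A * F \<xi> \<le> av A F (\<eta>(x := \<xi> x))"
    using insert.prems by (intro insert.IH) auto
  then have "?d * (?d ^ card A * F \<xi>) \<le> ?d * av A F (\<eta>(x := \<xi> x))"
    using p0 p1 by (intro mult_left_mono) auto
  ultimately show ?case
    using insert.hyps by (simp add: av_insert mult.assoc)
qed

text \<open>Compare \<open>f\<close> with its average \<open>m\<close> over the vertices other
  than \<open>x\<close>. The difference is controlled by the inequality on these vertices. As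
  \<open>m\<close> does not depend on them, its square can be multiplied by the constraint at
  \<open>x\<close>, whose mean is bounded below by a positive constant, and then compared with
  the constrained variance of \<open>f\<close> at \<open>x\<close>. The constant grows
  exponentially with the volume; it shows that relaxation times are finite for every
  \<open>p\<close>.\<close>

lemma root_poincare_crude:
  assumes V: "finite V" "x \<in> V" "\<And>y. y \<in> V \<Longrightarrow> x \<notin> children k y"
    and pi: "poincare (V - {x}) T" and T: "0 \<le> T"
  shows "\<exists>T'\<ge>0. root_poincare V x T'"
proof -
  define W where "W = V - {x}"
  have W: "finite W" "W \<subseteq> V" "x \<notin> W" using V by (auto simp: W_def)
  define a where "a = min p (1 - p) ^ card W"
  have a: "0 < a" using p0 p1 by (simp add: a_def)
  define c where "c = constr k V x"
  have c01: "0 \<le> c \<xi>" "c \<xi> \<le> 1" for \<xi> by (auto simp: c_def constr_nonneg constr_le_1)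
  have ca: "a \<le> av W c \<eta>" for \<eta>
  proof -
    define \<xi> where "\<xi> = (\<lambda>y. if y \<in> W then False else \<eta> y)"
    have "c \<xi> = 1" using not_child_self[of x] by (auto simp: c_def constr_def \<xi>_def W_def)
    then show ?thesis
      using av_ge_point[OF W(1), where F = c and \<xi> = \<xi> and \<eta> = \<eta>] c01 by (simp add: a_def \<xi>_def)
  qed
  have cW: "constr k W y = constr k V y" if "y \<in> V" for y
    using V(3)[OF that] by (intro constr_closed[symmetric] W) (auto simp: W_def)
  have cx: "c (\<eta>(x := b)) = c \<eta>" for \<eta> b
    unfolding c_def using not_child_self by (intro depends_on_upd[OF depends_on_constr]) auto
  have "av V (\<lambda>\<xi>. (f \<xi>)\<^sup>2) \<eta> \<le> (T + (2 / a) * (1 + T)) * av V (energy V f) \<eta>"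
    if f: "sav x f = (\<lambda>_. 0)" for f \<eta>
  proof -
    define D where "D = av V (energy V f) \<eta>"
    define m where "m = av W f"
    have m: "m \<xi> = m \<eta>" if "\<And>y. y \<notin> W \<Longrightarrow> \<xi> y = \<eta> y" for \<xi> \<eta>
      unfolding m_def using that by (intro av_agree W)
    have avW: "av V (av W h) = av V h" for h by (intro av_idem V W)
    have var_le: "av V (\<lambda>\<xi>. (f \<xi> - m \<xi>)\<^sup>2) \<eta> \<le> T * D"
    proof -
      have "av W (\<lambda>\<xi>. (f \<xi> - m \<xi>)\<^sup>2) \<xi> = av W (\<lambda>\<xi>. (f \<xi>)\<^sup>2) \<xi> - (m \<xi>)\<^sup>2" for \<xi>
      proof -
        have "av W (\<lambda>\<zeta>. (f \<zeta> - m \<zeta>)\<^sup>2) \<xi> = av W (\<lambda>\<zeta>. (f \<zeta>)\<^sup>2 - ((2 * m \<xi>) * f \<zeta> - (m \<xi>)\<^sup>2)) \<xi>"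
        proof (rule av_cong[OF W(1)])
          fix \<zeta> assume "\<And>y. y \<notin> W \<Longrightarrow> \<zeta> y = \<xi> y"
          then have "m \<zeta> = m \<xi>" by (rule m)
          then show "(f \<zeta> - m \<zeta>)\<^sup>2 = (f \<zeta>)\<^sup>2 - ((2 * m \<xi>) * f \<zeta> - (m \<xi>)\<^sup>2)"
            by (simp add: power2_eq_square algebra_simps)
        qed
        also have "\<dots> = av W (\<lambda>\<xi>. (f \<xi>)\<^sup>2) \<xi> - (m \<xi>)\<^sup>2"
          by (simp add: av_diff av_cmult av_const W power2_eq_square m_def[symmetric])
        finally show ?thesis .
      qed
      also have "av W (\<lambda>\<xi>. (f \<xi>)\<^sup>2) \<xi> - (m \<xi>)\<^sup>2 \<le> T * av W (energy V f) \<xi>" for \<xi>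
      proof -
        have "energy W f \<zeta> \<le> energy V f \<zeta>" for \<zeta>
        proof -
          have "energy W f \<zeta> = (\<Sum>y\<in>W. constr k V y \<zeta> * site_var y f \<zeta>)"
            unfolding energy_def using cW W by (intro sum.cong) auto
          also have "\<dots> \<le> energy V f \<zeta>"
            unfolding energy_def
            by (intro sum_mono2 V W mult_nonneg_nonneg constr_nonneg site_var_nonneg)
          finally show ?thesis .
        qed
        then have "T * av W (energy W f) \<xi> \<le> T * av W (energy V f) \<xi>"
          by (intro mult_left_mono T av_mono W)
        then show ?thesis using poincareD[OF pi[folded W_def], of f \<xi>] by (simp add: m_def)
      qed
      finally have "av V (av W (\<lambda>\<xi>. (f \<xi> - m \<xi>)\<^sup>2)) \<eta> \<le> av V (\<lambda>\<xi>. T * av W (energy V f) \<xi>) \<eta>"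
        by (intro av_mono V)
      then show ?thesis by (simp add: avW av_cmult V D_def)
    qed
    have c_le: "av V (\<lambda>\<xi>. c \<xi> * (f \<xi>)\<^sup>2) \<eta> \<le> D"
    proof -
      have "sav x (\<lambda>\<xi>. c \<xi> * (f \<xi>)\<^sup>2) \<xi> = c \<xi> * site_var x f \<xi>" for \<xi>
        using sav_pull[of c \<xi> x "\<lambda>\<xi>. (f \<xi>)\<^sup>2"] by (simp add: cx sav_square f)
      also have "c \<xi> * site_var x f \<xi> \<le> energy V f \<xi>" for \<xi>
        unfolding energy_def c_def
        using V by (intro member_le_sum[where f = "\<lambda>y. constr k V y \<xi> * site_var y f \<xi>"])
           (auto intro!: mult_nonneg_nonneg constr_nonneg site_var_nonneg)
      finally have "av V (sav x (\<lambda>\<xi>. c \<xi> * (f \<xi>)\<^sup>2)) \<eta> \<le> D"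
        unfolding D_def by (intro av_mono V)
      then show ?thesis
        using av_idem[of V "{x}"] V by (simp add: av_single)
    qed
    have "a * av V (\<lambda>\<xi>. (m \<xi>)\<^sup>2) \<eta> = av V (\<lambda>\<xi>. a * (m \<xi>)\<^sup>2) \<eta>"
      by (simp add: av_cmult V)
    also have "\<dots> \<le> av V (av W (\<lambda>\<xi>. c \<xi> * (m \<xi>)\<^sup>2)) \<eta>"
    proof (rule av_mono[OF V(1)])
      fix \<xi>
      have "av W (\<lambda>\<xi>. (m \<xi>)\<^sup>2 * c \<xi>) \<xi> = (m \<xi>)\<^sup>2 * av W c \<xi>"
        by (rule av_pull[OF W(1)]) (rule arg_cong[where f = "\<lambda>x. x\<^sup>2"], rule m)
      then show "a * (m \<xi>)\<^sup>2 \<le> av W (\<lambda>\<xi>. c \<xi> * (m \<xi>)\<^sup>2) \<xi>"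
        using ca[of \<xi>] by (simp add: mult.commute mult_right_mono)
    qed
    also have "\<dots> = av V (\<lambda>\<xi>. c \<xi> * (m \<xi>)\<^sup>2) \<eta>" by (simp add: avW)
    also have "\<dots> \<le> av V (\<lambda>\<xi>. 2 * (c \<xi> * (f \<xi>)\<^sup>2) + 2 * (f \<xi> - m \<xi>)\<^sup>2) \<eta>"
    proof (rule av_mono[OF V(1)])
      fix \<xi>
      have "(m \<xi>)\<^sup>2 \<le> 2 * (f \<xi>)\<^sup>2 + 2 * (f \<xi> - m \<xi>)\<^sup>2"
        using zero_le_power2[of "2 * f \<xi> - m \<xi>"] by (simp add: power2_eq_square algebra_simps)
      then have "c \<xi> * (m \<xi>)\<^sup>2 \<le> c \<xi> * (2 * (f \<xi>)\<^sup>2 + 2 * (f \<xi> - m \<xi>)\<^sup>2)"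
        by (intro mult_left_mono c01)
      also have "\<dots> \<le> 2 * (c \<xi> * (f \<xi>)\<^sup>2) + 2 * (f \<xi> - m \<xi>)\<^sup>2"
        using mult_right_mono[OF c01(2)[of \<xi>], of "2 * (f \<xi> - m \<xi>)\<^sup>2"] by (simp add: algebra_simps)
      finally show "c \<xi> * (m \<xi>)\<^sup>2 \<le> 2 * (c \<xi> * (f \<xi>)\<^sup>2) + 2 * (f \<xi> - m \<xi>)\<^sup>2" .
    qed
    also have "\<dots> \<le> 2 * D + 2 * (T * D)"
      using var_le c_le by (simp add: av_add av_cmult V)
    finally have m2: "av V (\<lambda>\<xi>. (m \<xi>)\<^sup>2) \<eta> \<le> (2 / a) * (1 + T) * D"
      using a by (simp add: field_simps)
    have "av V (\<lambda>\<xi>. (f \<xi> - m \<xi>)\<^sup>2) \<eta> = av V (\<lambda>\<xi>. (f \<xi>)\<^sup>2) \<eta> - av V (\<lambda>\<xi>. (m \<xi>)\<^sup>2) \<eta>"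
    proof -
      have "av W (\<lambda>\<zeta>. m \<zeta> * f \<zeta>) \<xi> = m \<xi> * av W f \<xi>" for \<xi>
        by (rule av_pull[OF W(1)]) (rule m)
      then have "av W (\<lambda>\<zeta>. m \<zeta> * f \<zeta>) = (\<lambda>\<xi>. (m \<xi>)\<^sup>2)"
        by (simp add: m_def[symmetric] power2_eq_square fun_eq_iff)
      then have "av V (\<lambda>\<zeta>. m \<zeta> * f \<zeta>) \<eta> = av V (\<lambda>\<xi>. (m \<xi>)\<^sup>2) \<eta>"
        using avW[of "\<lambda>\<zeta>. m \<zeta> * f \<zeta>"] by simp
      moreover have "(\<lambda>\<xi>. (f \<xi> - m \<xi>)\<^sup>2) = (\<lambda>\<xi>. (f \<xi>)\<^sup>2 + ((m \<xi>)\<^sup>2 - 2 * (m \<xi> * f \<xi>)))"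
        by (auto simp: power2_eq_square algebra_simps)
      ultimately show ?thesis by (simp add: av_add av_diff av_cmult V)
    qed
    then show ?thesis using var_le m2 by (simp add: D_def algebra_simps)
  qed
  then have "root_poincare V x (T + (2 / a) * (1 + T))"
    unfolding root_poincare_def by blast
  moreover have "0 \<le> T + (2 / a) * (1 + T)" using a T by simp
  ultimately show ?thesis by blast
qed

lemma Nil_in_tree_ball: "[] \<in> tball n"
  by (simp add: tree_ball_def tree_def)

lemma Nil_not_child: "[] \<notin> children k y"
  by (auto simp: children_def)

lemma poincare_tree_ball_extend:
  assumes "poincare (tball n) T" "root_poincare (tball (Suc n)) [] T" "0 \<le> T"
  shows "poincare (tball (Suc n)) T"
proof (rule poincare_remove_top[where U = "tball (Suc n)" and x = "[]"])
  show "poincare (tball (Suc n) - {[]}) T"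
    using finite_tree_ball
    by (intro poincare_forest[OF assms(1,3), of _ 1]) (auto simp: tree_ball_def Suc_le_eq)
qed (use assms finite_tree_ball Nil_in_tree_ball Nil_not_child in auto)

lemma poincare_tree_ball_ex: "\<exists>T\<ge>0. poincare (tball n) T"
proof (induction n)
  case 0
  have b: "tball 0 = {[]}" by (auto simp: tree_ball_def tree_def)
  obtain T where T: "0 \<le> T" "root_poincare {[]} [] T"
    using root_poincare_crude[of "{[]}" "[]" 0, OF _ _ Nil_not_child] by (auto simp: poincare_empty)
  have "poincare {[]} T"
    by (rule poincare_remove_top[where U = "{[]}" and x = "[]"])
       (simp_all add: poincare_empty Nil_not_child T)
  then show ?case using T b by auto
next
  case (Suc n)
  then obtain T where T: "0 \<le> T" "poincare (tball n) T" by blast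
  have "poincare (tball (Suc n) - {[]}) T"
    using finite_tree_ball
    by (intro poincare_forest[OF T(2,1), of _ 1]) (auto simp: tree_ball_def Suc_le_eq)
  then obtain T' where T': "0 \<le> T'" "root_poincare (tball (Suc n)) [] T'"
    using root_poincare_crude[OF finite_tree_ball Nil_in_tree_ball Nil_not_child _ T(1)] by blast
  have "poincare (tball (Suc n)) (max T T')"
    using T T' by (intro poincare_tree_ball_extend)
      (auto intro: poincare_weaken root_poincare_weaken finite_tree_ball)
  then show ?case using T by (intro exI[of _ "max T T'"]) auto
qed

end

section \<open>Spectral gap and eigenfunction\<close>

lemma configs_iff: "\<xi> \<in> configs V \<longleftrightarrow> (\<forall>x. x \<notin> V \<longrightarrow> \<not> \<xi> x)"
  by (auto simp: configs_def PiE_dflt_def)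

context ofa
begin

abbreviation (input) "vacant \<equiv> (\<lambda>_. False) :: config"

definition dirichlet :: "vertex set \<Rightarrow> (config \<Rightarrow> real) \<Rightarrow> (config \<Rightarrow> real) \<Rightarrow> config \<Rightarrow> real" where
  "dirichlet V g f \<xi> = (\<Sum>y\<in>V. constr k V y \<xi> * (p * (1 - p) * (grad y g \<xi> * grad y f \<xi>)))"

lemma dirichlet_self: "dirichlet V f f = energy V f"
  by (simp add: dirichlet_def energy_def site_var_def power2_eq_square fun_eq_iff)

lemma dirichlet_commute: "dirichlet V f g = dirichlet V g f"
  by (simp add: dirichlet_def fun_eq_iff mult.commute mult.left_commute)

lemma av_sav: "finite V \<Longrightarrow> x \<in> V \<Longrightarrow> av V (sav x f) = av V f"
  using av_idem[of V "{x}" f] by (simp add: av_single)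

text \<open>Reversibility. The constraint at \<open>y\<close> does not depend on the spin at
  \<open>y\<close>, so averaging over that spin first turns the summand of \<open>y\<close>
  into a covariance.\<close>

lemma av_generator:
  assumes V: "finite V"
  shows "av V (\<lambda>\<xi>. g \<xi> * gen V f \<xi>) \<eta> = - av V (dirichlet V g f) \<eta>"
proof -
  have "av V (\<lambda>\<xi>. g \<xi> * (constr k V y \<xi> * (sav y f \<xi> - f \<xi>))) \<eta>
      = av V (\<lambda>\<xi>. - (constr k V y \<xi> * (p * (1 - p) * (grad y g \<xi> * grad y f \<xi>)))) \<eta>" if y: "y \<in> V" for y
  proof -
    have c: "constr k V y (\<xi>(y := b)) = constr k V y \<xi>" for \<xi> b
      using not_child_self by (intro depends_on_upd[OF depends_on_constr]) auto
    have "sav y (\<lambda>\<xi>. g \<xi> * (constr k V y \<xi> * (sav y f \<xi> - f \<xi>)))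
        = sav y (\<lambda>\<xi>. - (constr k V y \<xi> * (p * (1 - p) * (grad y g \<xi> * grad y f \<xi>))))"
      by (rule ext) (simp add: sav_eq c grad_def algebra_simps)
    from arg_cong[OF this, of "\<lambda>h. av V h \<eta>"] show ?thesis by (simp only: av_sav[OF V y])
  qed
  then have "(\<Sum>y\<in>V. av V (\<lambda>\<xi>. g \<xi> * (constr k V y \<xi> * (sav y f \<xi> - f \<xi>))) \<eta>)
     = (\<Sum>y\<in>V. av V (\<lambda>\<xi>. - (constr k V y \<xi> * (p * (1 - p) * (grad y g \<xi> * grad y f \<xi>)))) \<eta>)"
    by (rule sum.cong[OF refl])
  moreover have "(\<lambda>\<xi>. g \<xi> * gen V f \<xi>) = (\<lambda>\<xi>. \<Sum>y\<in>V. g \<xi> * (constr k V y \<xi> * (sav y f \<xi> - f \<xi>)))"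
    by (simp add: generator_def sum_distrib_left)
  moreover have "(\<Sum>y\<in>V. av V (\<lambda>\<xi>. - (constr k V y \<xi> * (p * (1 - p) * (grad y g \<xi> * grad y f \<xi>)))) \<eta>)
      = - av V (dirichlet V g f) \<eta>"
    using av_cmult[OF V, of "-1" "dirichlet V g f"]
      av_sum[OF V, of "\<lambda>y \<xi>. - (constr k V y \<xi> * (p * (1 - p) * (grad y g \<xi> * grad y f \<xi>)))" V]
    by (simp add: dirichlet_def[abs_def] sum_negf fun_eq_iff)
  ultimately show ?thesis by (simp add: av_sum V)
qed

lemma expectation_dirichlet:
  assumes "finite V"
  shows "measure_pmf.expectation (mu p V) (\<lambda>\<eta>. f \<eta> * - gen V f \<eta>) = av V (energy V f) vacant"
  using av_generator[OF assms, of f f vacant] av_cmult[OF assms, of "-1" "\<lambda>\<xi>. f \<xi> * gen V f \<xi>"]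
  by (simp add: expectation_mu assms dirichlet_self fun_eq_iff)

lemma av_variance:
  assumes "finite V"
  shows "av V (\<lambda>\<xi>. (f \<xi> - av V f \<eta>)\<^sup>2) \<eta> = av V (\<lambda>\<xi>. (f \<xi>)\<^sup>2) \<eta> - (av V f \<eta>)\<^sup>2"
proof -
  have "(\<lambda>\<xi>. (f \<xi> - av V f \<eta>)\<^sup>2) = (\<lambda>\<xi>. (f \<xi>)\<^sup>2 - ((2 * av V f \<eta>) * f \<xi> - (av V f \<eta>)\<^sup>2))"
    by (auto simp: power2_eq_square algebra_simps)
  then show ?thesis by (simp add: av_diff av_cmult av_const assms power2_eq_square)
qed

lemma variance_mu:
  assumes "finite V"
  shows "measure_pmf.variance (mu p V) f = av V (\<lambda>\<xi>. (f \<xi>)\<^sup>2) vacant - (av V f vacant)\<^sup>2"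
  by (simp add: expectation_mu assms av_variance)

lemma av_square_0:
  assumes "finite V" "av V (\<lambda>\<xi>. (f \<xi>)\<^sup>2) vacant = 0" "\<xi> \<in> configs V"
  shows "f \<xi> = 0"
proof -
  have "min p (1 - p) ^ card V * (f \<xi>)\<^sup>2 \<le> 0"
    using av_ge_point[of V "\<lambda>\<xi>. (f \<xi>)\<^sup>2" \<xi> vacant] assms by (simp add: configs_iff)
  moreover have "0 < min p (1 - p) ^ card V" using p0 p1 by simp
  ultimately show ?thesis by (simp add: mult_le_0_iff not_le)
qed

lemma av_energy_nonneg: "finite V \<Longrightarrow> 0 \<le> av V (energy A f) \<eta>"
  by (intro av_nonneg energy_nonneg)

lemma av_cong_configs: "finite V \<Longrightarrow> (\<And>\<xi>. \<xi> \<in> configs V \<Longrightarrow> f \<xi> = g \<xi>) \<Longrightarrow> av V f vacant = av V g vacant"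
  by (rule av_cong) (auto simp: configs_iff)

lemma energy_cong_configs:
  "\<xi> \<in> configs V \<Longrightarrow> (\<And>\<xi>. \<xi> \<in> configs V \<Longrightarrow> f \<xi> = g \<xi>) \<Longrightarrow> energy V f \<xi> = energy V g \<xi>"
  by (auto simp: energy_def site_var_def grad_def configs_upd intro!: sum.cong)

lemma energy_affine: "energy V (\<lambda>\<xi>. (f \<xi> - a) / s) = (\<lambda>\<xi>. energy V f \<xi> / s\<^sup>2)"
proof -
  have "grad y (\<lambda>\<xi>. (f \<xi> - a) / s) \<xi> = grad y f \<xi> / s" for y \<xi>
    by (simp add: grad_def diff_divide_distrib[symmetric])
  then show ?thesis
    by (simp add: energy_def site_var_def fun_eq_iff power_divide sum_divide_distrib)
qed

lemma continuous_on_av: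
  fixes \<Phi> :: "'b::topological_space \<Rightarrow> config \<Rightarrow> real"
  assumes "finite A" "\<And>\<eta>. continuous_on S (\<lambda>f. \<Phi> f \<eta>)"
  shows "continuous_on S (\<lambda>f. av A (\<Phi> f) \<eta>)"
  using assms
  by (induction A arbitrary: \<eta> rule: finite_induct)
     (auto simp: av_insert sav_eq intro!: continuous_intros)

lemma continuous_on_eval: "continuous_on S (\<lambda>f::config \<Rightarrow> real. f \<eta>)"
  by (rule continuous_on_product_coordinates[THEN continuous_on_subset]) auto

text \<open>On the compact set of normalised functions on the finitely many configurations the
  Dirichlet form attains its minimum, and the infimum defining the gap is that minimum.\<close>

lemma gap_minimizer:
  assumes V: "finite V" "V \<noteq> {}"
  obtains f where "av V f vacant = 0" "av V (\<lambda>\<xi>. (f \<xi>)\<^sup>2) vacant = 1"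
    "av V (energy V f) vacant = spectral_gap k p V"
    "\<And>g. spectral_gap k p V * (av V (\<lambda>\<xi>. (g \<xi>)\<^sup>2) vacant - (av V g vacant)\<^sup>2) \<le> av V (energy V g) vacant"
proof -
  \<comment> \<open>a bound for the values of a normalised function, by
    \<open>av_ge_point\<close>\<close>
  define b where "b = 1 / min p (1 - p) ^ card V + 1"
  define Box where "Box = PiE UNIV (\<lambda>\<eta>. if \<eta> \<in> configs V then {- b..b} else {0::real})"
  define K where "K = Box \<inter> ({f. av V f vacant = 0} \<inter> {f. av V (\<lambda>\<xi>. (f \<xi>)\<^sup>2) vacant = 1})"
  define D where "D = (\<lambda>f. av V (energy V f) vacant)"
  define Var where "Var = (\<lambda>f. av V (\<lambda>\<xi>. (f \<xi>)\<^sup>2) vacant - (av V f vacant)\<^sup>2)"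
  have "compactin euclidean Box"
    unfolding euclidean_product_topology[symmetric] Box_def
    by (subst compactin_PiE) auto
  then have "compact Box" by simp
  moreover have "closed ({f. av V f vacant = 0} \<inter> {f. av V (\<lambda>\<xi>. (f \<xi>)\<^sup>2) vacant = 1})"
    by (intro closed_Int closed_Collect_eq continuous_on_const continuous_on_av V continuous_intros continuous_on_eval)
  ultimately have K: "compact K" unfolding K_def by (intro compact_Int_closed)
  have normalize: "\<exists>h\<in>K. D h = D g / Var g" if g: "0 < Var g" for g
  proof -
    define s where "s = sqrt (Var g)"
    define h0 where "h0 = (\<lambda>\<xi>. (g \<xi> - av V g vacant) / s)"
    define h where "h = (\<lambda>\<xi>. if \<xi> \<in> configs V then h0 \<xi> else 0)"
    have s: "s\<^sup>2 = Var g" "s > 0" using g by (auto simp: s_def)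
    have h0: "av V h0 vacant = 0"
      unfolding h0_def using av_cmult[OF V(1), of "1 / s" "\<lambda>\<xi>. g \<xi> - av V g vacant"]
      by (simp add: av_diff av_const V fun_eq_iff)
    have h1: "av V (\<lambda>\<xi>. (h0 \<xi>)\<^sup>2) vacant = 1"
      unfolding h0_def power_divide using av_cmult[OF V(1), of "1 / s\<^sup>2" "\<lambda>\<xi>. (g \<xi> - av V g vacant)\<^sup>2"] g
      by (simp add: av_variance V fun_eq_iff s) (simp add: Var_def)
    have hh: "av V h vacant = 0" "av V (\<lambda>\<xi>. (h \<xi>)\<^sup>2) vacant = 1"
      unfolding h0[symmetric] h1[symmetric] by (auto intro!: av_cong_configs V simp: h_def)
    have "D h = D h0"
      unfolding D_def by (intro av_cong_configs V energy_cong_configs) (auto simp: h_def)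
    also have "\<dots> = D g / Var g"
      unfolding D_def h0_def energy_affine using av_cmult[OF V(1), of "1 / s\<^sup>2" "energy V g"]
      by (simp add: fun_eq_iff s)
    finally have "D h = D g / Var g" .
    moreover have "h \<in> Box"
    proof -
      have "\<bar>h \<xi>\<bar> \<le> b" if "\<xi> \<in> configs V" for \<xi>
      proof -
        have "min p (1 - p) ^ card V * (h \<xi>)\<^sup>2 \<le> 1"
          using av_ge_point[of V "\<lambda>\<xi>. (h \<xi>)\<^sup>2" \<xi> vacant] that V hh by (simp add: configs_iff)
        then have 1: "(h \<xi>)\<^sup>2 \<le> 1 / min p (1 - p) ^ card V"
          using p0 p1 by (simp add: field_simps)
        also have "\<dots> \<le> (1 / min p (1 - p) ^ card V + 1)\<^sup>2"
          using p0 p1 by (intro order_trans[OF _ self_le_power]) auto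
        finally have "\<bar>h \<xi>\<bar>\<^sup>2 \<le> b\<^sup>2" by (simp add: b_def)
        moreover have "0 \<le> b" using p0 p1 by (simp add: b_def)
        ultimately show ?thesis by (rule power2_le_imp_le)
      qed
      then have "h \<xi> \<in> (if \<xi> \<in> configs V then {- b..b} else {0})" for \<xi>
        by (cases "\<xi> \<in> configs V") (simp add: abs_le_iff minus_le_iff, simp add: h_def)
      then show ?thesis unfolding Box_def by (intro PiE_I) auto
    qed
    ultimately show ?thesis using hh by (auto simp: K_def)
  qed
  have nonconst: "0 < Var g" if "\<not> g constant_on configs V" for g
  proof (rule ccontr)
    assume "\<not> 0 < Var g"
    then have "av V (\<lambda>\<xi>. (g \<xi> - av V g vacant)\<^sup>2) vacant = 0"
      using av_nonneg[OF V(1), of "\<lambda>\<xi>. (g \<xi> - av V g vacant)\<^sup>2" vacant] by (simp add: Var_def av_variance V)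
    then have "g \<xi> - av V g vacant = 0" if "\<xi> \<in> configs V" for \<xi>
      using av_square_0[OF V(1), of "\<lambda>\<xi>. g \<xi> - av V g vacant"] that by simp
    then show False using that by (auto simp: constant_on_def)
  qed
  have nc: "\<not> f constant_on configs V" if "0 < Var f" for f
  proof
    assume "f constant_on configs V"
    then obtain c where "\<And>\<xi>. \<xi> \<in> configs V \<Longrightarrow> f \<xi> = c" by (auto simp: constant_on_def)
    then have "av V f vacant = av V (\<lambda>_. c) vacant" "av V (\<lambda>\<xi>. (f \<xi>)\<^sup>2) vacant = av V (\<lambda>_. c\<^sup>2) vacant"
      by (auto intro!: av_cong_configs V)
    then show False using that by (simp add: Var_def av_const V)
  qed
  obtain x where x: "x \<in> V" using V by blast
  have "\<not> (\<lambda>\<eta>. of_bool (\<eta> x) :: real) constant_on configs V"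
  proof
    assume "(\<lambda>\<eta>. of_bool (\<eta> x) :: real) constant_on configs V"
    moreover have "vacant \<in> configs V" "vacant(x := True) \<in> configs V" using x by (auto simp: configs_iff)
    ultimately have "of_bool (vacant x) = (of_bool ((vacant(x := True)) x) :: real)"
      unfolding constant_on_def by metis
    then show False by simp
  qed
  from normalize[OF nonconst[OF this]] have "K \<noteq> {}" by blast
  moreover have "continuous_on K D"
    unfolding D_def energy_def site_var_def grad_def
    by (intro continuous_on_av V continuous_intros continuous_on_eval)
  ultimately obtain f where f: "f \<in> K" "\<And>g. g \<in> K \<Longrightarrow> D f \<le> D g"
    using continuous_attains_inf[OF K] by blast
  have Vf: "Var f = 1" using f(1) by (simp add: K_def Var_def)
  have min: "D f \<le> D g / Var g" if "0 < Var g" for g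
    using normalize[OF that] f(2) by fastforce
  have "(INF f \<in> {f. \<not> f constant_on configs V}. D f / Var f) = D f"
  proof (rule cInf_eq_minimum)
    show "D f \<in> (\<lambda>f. D f / Var f) ` {f. \<not> f constant_on configs V}"
      using nc[of f] Vf by (intro image_eqI[of _ _ f]) auto
  next
    fix x assume "x \<in> (\<lambda>f. D f / Var f) ` {f. \<not> f constant_on configs V}"
    then show "D f \<le> x" using min nonconst by blast
  qed
  then have gap: "spectral_gap k p V = D f"
    unfolding spectral_gap_def expectation_dirichlet[OF V(1)] variance_mu[OF V(1)] D_def Var_def .
  show ?thesis
  proof (rule that[of f])
    show "av V f vacant = 0" "av V (\<lambda>\<xi>. (f \<xi>)\<^sup>2) vacant = 1" using f(1) by (auto simp: K_def)
    show "av V (energy V f) vacant = spectral_gap k p V" by (simp add: gap D_def)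
    fix g
    have "D f * Var g \<le> D g"
    proof (cases "0 < Var g")
      case True
      then show ?thesis using min[OF True] by (simp add: field_simps)
    next
      case False
      then have "Var g = 0"
        using av_nonneg[OF V(1), of "\<lambda>\<xi>. (g \<xi> - av V g vacant)\<^sup>2" vacant] by (simp add: Var_def av_variance V)
      then show ?thesis using av_energy_nonneg[OF V(1), of V g vacant] by (simp add: D_def)
    qed
    then show "spectral_gap k p V * (av V (\<lambda>\<xi>. (g \<xi>)\<^sup>2) vacant - (av V g vacant)\<^sup>2) \<le> av V (energy V g) vacant"
      by (simp add: gap D_def Var_def)
  qed
qed

lemma av_to_F0:
  assumes "finite V" "depends_on h V" shows "av V h \<eta> = av V h vacant"
proof -
  have "depends_on (av V h) {}" using assms by (intro depends_on_av) simp_all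
  then show ?thesis by (rule depends_onD) simp
qed

text \<open>It is enough to look at the empty boundary configuration, since the boundary
  values can be absorbed into \<open>f\<close>.\<close>

lemma poincareI:
  assumes V: "finite V"
    and le: "\<And>f. av V (\<lambda>\<xi>. (f \<xi>)\<^sup>2) vacant - (av V f vacant)\<^sup>2 \<le> T * av V (energy V f) vacant"
  shows "poincare V T"
  unfolding poincare_def
proof (intro allI)
  fix f \<eta>
  obtain f' where f': "depends_on f' V" and eq: "av V f' \<eta> = av V f \<eta>"
    "av V (\<lambda>\<xi>. (f' \<xi>)\<^sup>2) \<eta> = av V (\<lambda>\<xi>. (f \<xi>)\<^sup>2) \<eta>" "av V (energy V f') \<eta> = av V (energy V f) \<eta>"
    by (rule localize[OF V])
  have "av V f' \<eta> = av V f' vacant" "av V (energy V f') \<eta> = av V (energy V f') vacant"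
    "av V (\<lambda>\<xi>. (f' \<xi>)\<^sup>2) \<eta> = av V (\<lambda>\<xi>. (f' \<xi>)\<^sup>2) vacant"
    by (intro av_to_F0 V f' depends_on_energy depends_on_comp[where F = "\<lambda>x. x\<^sup>2"] order_refl)+
  then show "av V (\<lambda>\<xi>. (f \<xi>)\<^sup>2) \<eta> - (av V f \<eta>)\<^sup>2 \<le> T * av V (energy V f) \<eta>"
    using le[of f'] by (simp add: eq)
qed

lemma gap_pos:
  assumes V: "finite V" "V \<noteq> {}" and pi: "poincare V T"
  shows "0 < spectral_gap k p V"
proof -
  obtain f where f: "av V f vacant = 0" "av V (\<lambda>\<xi>. (f \<xi>)\<^sup>2) vacant = 1"
    "av V (energy V f) vacant = spectral_gap k p V"
    using gap_minimizer[OF V] by metis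
  have "1 \<le> T * spectral_gap k p V" using poincareD[OF pi, of f vacant] f by simp
  moreover have "0 \<le> spectral_gap k p V" using av_energy_nonneg[OF V(1), of V f vacant] f by simp
  ultimately show ?thesis by (cases "spectral_gap k p V = 0") auto
qed

lemma poincare_T_rel:
  assumes V: "finite V" "V \<noteq> {}" and pi: "poincare V T"
  shows "poincare V (T_rel k p V)"
proof (rule poincareI[OF V(1)])
  fix g
  have "spectral_gap k p V * (av V (\<lambda>\<xi>. (g \<xi>)\<^sup>2) vacant - (av V g vacant)\<^sup>2) \<le> av V (energy V g) vacant"
    using gap_minimizer[OF V] by metis
  then show "av V (\<lambda>\<xi>. (g \<xi>)\<^sup>2) vacant - (av V g vacant)\<^sup>2 \<le> T_rel k p V * av V (energy V g) vacant"
    using gap_pos[OF assms] by (simp add: T_rel_def field_simps)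
qed

lemma T_rel_le:
  assumes V: "finite V" "V \<noteq> {}" and pi: "poincare V T"
  shows "T_rel k p V \<le> T"
proof -
  obtain f where f: "av V f vacant = 0" "av V (\<lambda>\<xi>. (f \<xi>)\<^sup>2) vacant = 1"
    "av V (energy V f) vacant = spectral_gap k p V"
    using gap_minimizer[OF V] by metis
  have "1 \<le> T * spectral_gap k p V" using poincareD[OF pi, of f vacant] f by simp
  then show ?thesis using gap_pos[OF assms] by (simp add: T_rel_def field_simps)
qed

lemma generator_cong_configs:
  "\<xi> \<in> configs V \<Longrightarrow> (\<And>\<xi>. \<xi> \<in> configs V \<Longrightarrow> f \<xi> = g \<xi>) \<Longrightarrow> gen V f \<xi> = gen V g \<xi>"
  by (auto simp: generator_def sav_eq configs_upd intro!: sum.cong)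

lemma depends_on_generator:
  assumes f: "depends_on f V"
  shows "depends_on (gen V f) V"
  unfolding generator_def
  by (intro depends_on_sum depends_on_comp2[where F = "(*)"] depends_on_comp2[where F = "(-)"] f
      depends_on_mono[OF depends_on_constr] depends_on_sav depends_on_mono[OF f]) auto

text \<open>The first variation of a quadratic form vanishes at a minimum.\<close>

lemma quadratic_nonneg_linear_0:
  fixes b c :: real
  assumes "\<And>s. 0 \<le> 2 * s * b + s\<^sup>2 * c" shows "b = 0"
proof (rule ccontr)
  assume b: "b \<noteq> 0"
  \<comment> \<open>nearly the minimiser of the quadratic, safe also for \<open>c \<le>
    0\<close>\<close>
  define s where "s = - b / (\<bar>c\<bar> + 1)"
  have "s\<^sup>2 * c \<le> s\<^sup>2 * (\<bar>c\<bar> + 1)" by (intro mult_left_mono) auto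
  also have "\<dots> = b\<^sup>2 / (\<bar>c\<bar> + 1)" by (simp add: s_def power2_eq_square)
  finally have "2 * s * b + s\<^sup>2 * c \<le> - (b\<^sup>2 / (\<bar>c\<bar> + 1))" by (simp add: s_def power2_eq_square)
  moreover have "0 < b\<^sup>2 / (\<bar>c\<bar> + 1)" using b by simp
  ultimately show False using assms[of s] by linarith
qed

text \<open>The first variation at a minimiser gives the eigenvalue equation on the
  configurations of \<open>V\<close>. Precomposing with the restriction to \<open>V\<close>
  makes it hold for all configurations.\<close>

lemma gap_eigenfunction:
  assumes V: "finite V" "V \<noteq> {}"
  obtains f where "depends_on f V" "\<And>\<xi>. gen V f \<xi> = - spectral_gap k p V * f \<xi>" "\<exists>\<xi>. f \<xi> \<noteq> 0"
proof -
  define l where "l = spectral_gap k p V"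
  obtain f where f: "av V f vacant = 0" "av V (\<lambda>\<xi>. (f \<xi>)\<^sup>2) vacant = 1"
    "av V (energy V f) vacant = l"
    and min: "\<And>g. l * (av V (\<lambda>\<xi>. (g \<xi>)\<^sup>2) vacant - (av V g vacant)\<^sup>2) \<le> av V (energy V g) vacant"
    unfolding l_def using gap_minimizer[OF V] by blast
  have orth: "av V (dirichlet V f g) vacant = l * av V (\<lambda>\<xi>. f \<xi> * g \<xi>) vacant" for g
  proof -
    have "0 \<le> 2 * s * (av V (dirichlet V f g) vacant - l * av V (\<lambda>\<xi>. f \<xi> * g \<xi>) vacant)
        + s\<^sup>2 * (av V (energy V g) vacant - l * (av V (\<lambda>\<xi>. (g \<xi>)\<^sup>2) vacant - (av V g vacant)\<^sup>2))" for s
    proof -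
      define h where "h = (\<lambda>\<xi>. f \<xi> + s * g \<xi>)"
      have e: "energy V h = (\<lambda>\<xi>. energy V f \<xi> + (2 * s * dirichlet V f g \<xi> + s\<^sup>2 * energy V g \<xi>))"
      proof
        fix \<xi>
        have "constr k V y \<xi> * site_var y h \<xi> = constr k V y \<xi> * site_var y f \<xi>
          + (2 * s * (constr k V y \<xi> * (p * (1 - p) * (grad y f \<xi> * grad y g \<xi>))) + s\<^sup>2 * (constr k V y \<xi> * site_var y g \<xi>))" for y
          by (simp add: site_var_def h_def grad_def power2_eq_square algebra_simps)
        then show "energy V h \<xi> = energy V f \<xi> + (2 * s * dirichlet V f g \<xi> + s\<^sup>2 * energy V g \<xi>)"
          by (simp add: energy_def dirichlet_def sum.distrib sum_distrib_left)
      qed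
      have m: "av V h vacant = s * av V g vacant"
        by (simp add: h_def av_add av_cmult V f)
      have "(\<lambda>\<xi>. (h \<xi>)\<^sup>2) = (\<lambda>\<xi>. (f \<xi>)\<^sup>2 + (2 * s * (f \<xi> * g \<xi>) + s\<^sup>2 * (g \<xi>)\<^sup>2))"
        by (auto simp: h_def power2_eq_square algebra_simps)
      then have q: "av V (\<lambda>\<xi>. (h \<xi>)\<^sup>2) vacant = 1 + (2 * s * av V (\<lambda>\<xi>. f \<xi> * g \<xi>) vacant + s\<^sup>2 * av V (\<lambda>\<xi>. (g \<xi>)\<^sup>2) vacant)"
        by (simp add: av_add av_cmult V f)
      show ?thesis
        using min[of h] unfolding q m e by (simp add: av_add av_cmult V f power_mult_distrib algebra_simps)
    qed
    then have "av V (dirichlet V f g) vacant - l * av V (\<lambda>\<xi>. f \<xi> * g \<xi>) vacant = 0"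
      by (rule quadratic_nonneg_linear_0)
    then show ?thesis by simp
  qed
  \<comment> \<open>the residual of the eigenvalue equation, used as its own test function\<close>
  define r where "r = (\<lambda>\<xi>. gen V f \<xi> + l * f \<xi>)"
  have "av V (\<lambda>\<xi>. r \<xi> * gen V f \<xi> + l * (f \<xi> * r \<xi>)) vacant = 0"
    using av_generator[OF V(1), of r f vacant] orth[of r]
    by (simp add: av_add av_cmult V dirichlet_commute[of V r f])
  moreover have "(\<lambda>\<xi>. r \<xi> * gen V f \<xi> + l * (f \<xi> * r \<xi>)) = (\<lambda>\<xi>. (r \<xi>)\<^sup>2)"
    by (auto simp: r_def power2_eq_square algebra_simps)
  ultimately have r0: "r \<xi> = 0" if "\<xi> \<in> configs V" for \<xi>
    using av_square_0[OF V(1), of r \<xi>] that by simp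
  define R :: "config \<Rightarrow> config" where "R \<xi> = (\<lambda>y. y \<in> V \<and> \<xi> y)" for \<xi>
  define f' where "f' = (\<lambda>\<xi>. f (R \<xi>))"
  have f': "depends_on f' V"
    unfolding f'_def R_def by (intro depends_onI arg_cong[where f = f]) auto
  have R: "R \<xi> \<in> configs V" for \<xi> by (simp add: R_def configs_iff)
  have Rc: "R \<xi> = \<xi>" if "\<xi> \<in> configs V" for \<xi> using that by (auto simp: R_def configs_iff fun_eq_iff)
  have "gen V f' \<xi> = - l * f' \<xi>" for \<xi>
  proof -
    have "gen V f' \<xi> = gen V f' (R \<xi>)"
      using depends_on_generator[OF f'] by (rule depends_onD) (simp add: R_def)
    also have "\<dots> = gen V f (R \<xi>)"
      by (rule generator_cong_configs[OF R]) (simp add: f'_def Rc)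
    also have "\<dots> = - l * f' \<xi>" using r0[OF R, of \<xi>] unfolding r_def f'_def by linarith
    finally show ?thesis .
  qed
  moreover have "\<exists>\<xi>. f' \<xi> \<noteq> 0"
  proof (rule ccontr)
    assume "\<nexists>\<xi>. f' \<xi> \<noteq> 0"
    then have "f \<xi> = 0" if "\<xi> \<in> configs V" for \<xi>
      using Rc[OF that] unfolding f'_def by metis
    then have "av V (\<lambda>\<xi>. (f \<xi>)\<^sup>2) vacant = av V (\<lambda>_. 0) vacant" by (intro av_cong_configs V) simp
    then show False using f by (simp add: av_const V)
  qed
  ultimately show ?thesis using that f' by (simp add: l_def)
qed

text \<open>Test function: the occupation variable of a single vertex.\<close>

lemma poincare_ge_1:
  assumes V: "finite V" "x \<in> V" and pi: "poincare V T"
  shows "1 \<le> T"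
proof -
  define f :: "config \<Rightarrow> real" where "f = (\<lambda>\<xi>. of_bool (\<xi> x))"
  have f: "depends_on f {x}" unfolding f_def by (rule depends_onI) simp
  have f2: "(\<lambda>\<xi>. (f \<xi>)\<^sup>2) = f" by (auto simp: f_def)
  have av: "av V f vacant = p"
  proof -
    have "sav x f = (\<lambda>_. p)" by (simp add: sav_eq f_def fun_eq_iff)
    then show ?thesis using V by (simp add: av_remove av_const)
  qed
  have "energy V f \<xi> \<le> p * (1 - p)" for \<xi>
  proof -
    have "energy V f \<xi> = constr k V x \<xi> * site_var x f \<xi>"
      unfolding energy_def using site_var_0[OF f] by (subst sum.remove[OF V]) (auto intro!: sum.neutral)
    also have "\<dots> \<le> 1 * site_var x f \<xi>" by (intro mult_right_mono constr_le_1 site_var_nonneg)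
    finally show ?thesis by (simp add: site_var_def grad_def f_def)
  qed
  then have "av V (energy V f) vacant \<le> p * (1 - p)"
    using av_mono[OF V(1), of vacant "energy V f" "\<lambda>_. p * (1 - p)"] by (simp add: av_const V)
  moreover have "0 \<le> av V (energy V f) vacant" by (intro av_nonneg V energy_nonneg)
  moreover have "p * (1 - p) \<le> T * av V (energy V f) vacant"
    using poincareD[OF pi, of f vacant] unfolding f2 av by (simp add: power2_eq_square algebra_simps)
  moreover have "0 < p * (1 - p)" using p0 p1 by simp
  ultimately have "0 < T" "p * (1 - p) \<le> T * (p * (1 - p))"
    by (smt (verit) mult_nonpos_nonneg, smt (verit) mult_nonpos_nonneg mult_left_mono)
  moreover have "T * (p * (1 - p)) < 1 * (p * (1 - p))" if "T < 1"
    using that \<open>0 < p * (1 - p)\<close> by (rule mult_strict_right_mono)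
  ultimately show ?thesis by linarith
qed

end

section \<open>Exploring occupied paths from below\<close>

text \<open>Some path of occupied vertices starts at \<open>y\<close>, included, and goes down
  \<open>h\<close> levels. For \<open>length y + h = l\<close> this says that \<open>y\<close>
  is joined to level \<open>l\<close>.\<close>

primrec occ_path :: "nat \<Rightarrow> nat \<Rightarrow> vertex \<Rightarrow> config \<Rightarrow> bool" where
  "occ_path k 0 y \<eta> = \<eta> y"
| "occ_path k (Suc h) y \<eta> = (\<eta> y \<and> (\<exists>i<k. occ_path k h (y @ [i]) \<eta>))"

text \<open>The vertices left uninspected by the exploration from level \<open>l\<close>
  upwards, which inspects a vertex above level \<open>l\<close> only if one of its children is
  joined to level \<open>l\<close>. By \<open>unrevealed_stop\<close> this set is determined
  by the configuration outside it, and by \<open>unrevealed_child\<close> its inspected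
  children are empty.\<close>

definition unrevealed :: "nat \<Rightarrow> nat \<Rightarrow> config \<Rightarrow> vertex set" where
  "unrevealed k l \<eta> = {y \<in> tree k. length y < l \<and> \<not> (\<exists>i<k. occ_path k (l - Suc (length y)) (y @ [i]) \<eta>)}"

text \<open>The number of paths of \<open>j\<close> occupied vertices going down from
  \<open>x\<close>, where \<open>x\<close> itself is not counted and may be empty.\<close>

primrec open_paths :: "nat \<Rightarrow> nat \<Rightarrow> vertex \<Rightarrow> config \<Rightarrow> real" where
  "open_paths k 0 x \<eta> = 1"
| "open_paths k (Suc j) x \<eta> = (\<Sum>i<k. of_bool (\<eta> (x @ [i])) * open_paths k j (x @ [i]) \<eta>)"

text \<open>The number of those paths that end in an inspected vertex.\<close>

primrec rev_paths :: "nat \<Rightarrow> nat \<Rightarrow> nat \<Rightarrow> vertex \<Rightarrow> config \<Rightarrow> real" where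
  "rev_paths k l 0 x \<eta> = of_bool (x \<notin> unrevealed k l \<eta>)"
| "rev_paths k l (Suc j) x \<eta> = (\<Sum>i<k. of_bool (\<eta> (x @ [i])) * rev_paths k l j (x @ [i]) \<eta>)"

text \<open>The probability of \<open>occ_path\<close> (see \<open>av_occ_path\<close>), that
  is, of survival for \<open>h\<close> generations in a branching process.\<close>

primrec reach_prob :: "nat \<Rightarrow> real \<Rightarrow> nat \<Rightarrow> real" where
  "reach_prob k p 0 = p"
| "reach_prob k p (Suc h) = p * (1 - (1 - reach_prob k p h) ^ k)"

lemma tree_snoc: "x \<in> tree k \<Longrightarrow> i < k \<Longrightarrow> x @ [i] \<in> tree k"
  by (auto simp: tree_def)

text \<open>The value at an uninspected vertex does not decide whether the vertex is joined to
  level \<open>l\<close>, because none of its children is.\<close>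

lemma occ_path_stop:
  assumes "\<And>x. x \<notin> unrevealed k l \<eta> \<Longrightarrow> \<xi> x = \<eta> x" "length y + h = l" "y \<in> tree k"
  shows "occ_path k h y \<xi> = occ_path k h y \<eta>"
  using assms(2,3)
proof (induction h arbitrary: y)
  case 0
  then have "y \<notin> unrevealed k l \<eta>" by (simp add: unrevealed_def)
  then show ?case using assms(1) by simp
next
  case (Suc h)
  have IH: "occ_path k h (y @ [i]) \<xi> = occ_path k h (y @ [i]) \<eta>" if "i < k" for i
    using Suc that by (intro Suc.IH) (auto simp: tree_snoc)
  show ?case
  proof (cases "\<exists>i<k. occ_path k h (y @ [i]) \<eta>")
    case True
    moreover have "l - Suc (length y) = h" using Suc.prems by simp
    ultimately have "y \<notin> unrevealed k l \<eta>" by (simp add: unrevealed_def)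
    then have "\<xi> y = \<eta> y" by (rule assms(1))
    then show ?thesis using IH by auto
  next
    case False
    then show ?thesis using IH by auto
  qed
qed

lemma unrevealed_stop:
  assumes "\<And>x. x \<notin> unrevealed k l \<eta> \<Longrightarrow> \<xi> x = \<eta> x"
  shows "unrevealed k l \<xi> = unrevealed k l \<eta>"
proof -
  have "occ_path k (l - Suc (length y)) (y @ [i]) \<xi> = occ_path k (l - Suc (length y)) (y @ [i]) \<eta>"
    if "y \<in> tree k" "length y < l" "i < k" for y i
    using that by (intro occ_path_stop[OF assms]) (auto simp: tree_snoc)
  then show ?thesis by (auto simp: unrevealed_def)
qed

lemma unrevealed_child:
  assumes "y \<in> unrevealed k l \<eta>" "i < k" "y @ [i] \<notin> unrevealed k l \<eta>"
  shows "\<not> \<eta> (y @ [i])"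
proof -
  have y: "y \<in> tree k" "length y < l" "\<not> occ_path k (l - Suc (length y)) (y @ [i]) \<eta>"
    using assms by (auto simp: unrevealed_def)
  show ?thesis
  proof (cases "l - Suc (length y)")
    case 0
    then show ?thesis using y by simp
  next
    case (Suc h)
    then have "length (y @ [i]) < l" "l - Suc (length (y @ [i])) = h" by auto
    then have "\<exists>j<k. occ_path k h ((y @ [i]) @ [j]) \<eta>"
      using assms(3) tree_snoc[OF y(1) assms(2)] unfolding unrevealed_def by auto
    then show ?thesis using y(3) Suc by simp
  qed
qed

lemma rev_paths_nonneg: "0 \<le> rev_paths k l j x \<eta>"
  by (induction j arbitrary: x) (auto intro!: sum_nonneg)

lemma rev_paths_le_open_paths: "rev_paths k l j x \<eta> \<le> open_paths k j x \<eta>"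
  by (induction j arbitrary: x) (auto intro!: sum_mono mult_left_mono)

text \<open>From an uninspected vertex an occupied path cannot enter the inspected region,
  whose first vertices are empty.\<close>

lemma rev_paths_unrevealed:
  assumes "x \<in> unrevealed k l \<eta>" "length x + j < l"
  shows "rev_paths k l j x \<eta> = 0"
  using assms
proof (induction j arbitrary: x)
  case (Suc j)
  have "of_bool (\<eta> (x @ [i])) * rev_paths k l j (x @ [i]) \<eta> = 0" if "i < k" for i
    using Suc.IH[of "x @ [i]"] unrevealed_child[OF Suc.prems(1) that] Suc.prems by auto
  then show ?case by simp
qed simp

lemma rev_paths_stop:
  assumes "\<And>x. x \<notin> unrevealed k l \<eta> \<Longrightarrow> \<xi> x = \<eta> x" "length x + j < l"
  shows "rev_paths k l j x \<xi> = rev_paths k l j x \<eta>"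
  using assms(2)
proof (induction j arbitrary: x)
  case 0
  then show ?case by (simp add: unrevealed_stop[OF assms(1)])
next
  case (Suc j)
  have "of_bool (\<xi> (x @ [i])) * rev_paths k l j (x @ [i]) \<xi> = of_bool (\<eta> (x @ [i])) * rev_paths k l j (x @ [i]) \<eta>" for i
  proof (cases "x @ [i] \<in> unrevealed k l \<eta>")
    case True
    then have "rev_paths k l j (x @ [i]) \<eta> = 0" "rev_paths k l j (x @ [i]) \<xi> = 0"
      using Suc.prems by (auto intro!: rev_paths_unrevealed simp: unrevealed_stop[OF assms(1)])
    then show ?thesis by simp
  next
    case False
    then show ?thesis using Suc.IH[of "x @ [i]"] Suc.prems assms(1)[OF False] by simp
  qed
  then show ?case by simp
qed

lemma rev_paths_ge_1:
  assumes "x \<in> tree k" "x \<notin> unrevealed k l \<eta>" "length x + j < l"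
  shows "1 \<le> rev_paths k l j x \<eta>"
  using assms
proof (induction j arbitrary: x)
  case (Suc j)
  define h where "h = l - Suc (Suc (length x))"
  have h: "l - Suc (length x) = Suc h" using Suc.prems by (simp add: h_def)
  obtain i where i: "i < k" "occ_path k (Suc h) (x @ [i]) \<eta>"
    using Suc.prems h unfolding unrevealed_def by auto
  have "x @ [i] \<notin> unrevealed k l \<eta>" using i by (auto simp: unrevealed_def h_def)
  then have "1 \<le> rev_paths k l j (x @ [i]) \<eta>"
    using Suc.prems i by (intro Suc.IH) (auto simp: tree_snoc)
  also have "\<dots> = of_bool (\<eta> (x @ [i])) * rev_paths k l j (x @ [i]) \<eta>" using i by simp
  also have "\<dots> \<le> rev_paths k l (Suc j) x \<eta>"
    unfolding rev_paths.simps using i rev_paths_nonneg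
    by (intro member_le_sum[of i "{..<k}" "\<lambda>i. of_bool (\<eta> (x @ [i])) * rev_paths k l j (x @ [i]) \<eta>"]) auto
  finally show ?case .
qed simp

lemma depends_on_occ_path: "depends_on (occ_path k h y) ((@) y ` tree_ball k h)"
proof (induction h arbitrary: y)
  case 0
  show ?case by (rule depends_onI) (auto simp: tree_ball_def tree_def)
next
  case (Suc h)
  show ?case
  proof (rule depends_onI)
    fix \<eta> \<xi> :: config assume eq: "\<And>x. x \<in> (@) y ` tree_ball k (Suc h) \<Longrightarrow> \<eta> x = \<xi> x"
    have "y @ [] \<in> (@) y ` tree_ball k (Suc h)" by (rule imageI) (simp add: tree_ball_def tree_def)
    then have "\<eta> y = \<xi> y" using eq by simp
    moreover have "occ_path k h (y @ [i]) \<eta> = occ_path k h (y @ [i]) \<xi>" if "i < k" for i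
    proof (rule depends_onD[OF Suc.IH])
      fix x assume "x \<in> (@) (y @ [i]) ` tree_ball k h"
      then obtain w where "x = y @ (i # w)" "w \<in> tree_ball k h" by auto
      then show "\<eta> x = \<xi> x" using that by (intro eq) (auto simp: tree_ball_def tree_def)
    qed
    ultimately show "occ_path k (Suc h) y \<eta> = occ_path k (Suc h) y \<xi>" by auto
  qed
qed

lemma depends_on_open_paths: "depends_on (open_paths k j x) {x @ w |w. w \<noteq> []}"
proof (induction j arbitrary: x)
  case (Suc j)
  show ?case
    unfolding open_paths.simps
  proof (intro depends_on_sum depends_on_comp2[where F = "(*)"])
    fix i
    show "depends_on (\<lambda>\<eta>. of_bool (\<eta> (x @ [i])) :: real) {x @ w |w. w \<noteq> []}"
      by (rule depends_on_coord) auto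
    show "depends_on (open_paths k j (x @ [i])) {x @ w |w. w \<noteq> []}"
      by (rule depends_on_mono[OF Suc.IH]) auto
  qed
qed (simp add: depends_on_def)

lemma open_paths_nonneg: "0 \<le> open_paths k j x \<eta>"
  using rev_paths_nonneg rev_paths_le_open_paths order_trans by blast

lemma finite_unrevealed: "finite (unrevealed k l \<eta>)"
  by (rule finite_subset[OF _ finite_tree_ball[of k l]]) (auto simp: unrevealed_def tree_ball_def)

context ofa
begin

lemma reach_prob_bounds: "0 \<le> reach_prob k p j" "reach_prob k p j \<le> 1"
proof -
  have "0 \<le> reach_prob k p j \<and> reach_prob k p j \<le> 1"
  proof (induction j)
    case (Suc j)
    then have "0 \<le> 1 - (1 - reach_prob k p j) ^ k" "1 - (1 - reach_prob k p j) ^ k \<le> 1"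
      by (auto intro: power_le_one)
    then show ?case using p0 p1 by (auto intro: mult_le_one)
  qed (use p0 p1 in auto)
  then show "0 \<le> reach_prob k p j" "reach_prob k p j \<le> 1" by auto
qed

lemma child_reach_prob_bounds: "0 \<le> 1 - (1 - reach_prob k p j) ^ k"
  using reach_prob_bounds[of j] by (auto intro: power_le_one)

lemma av_coord: "finite A \<Longrightarrow> x \<in> A \<Longrightarrow> av A (\<lambda>\<eta>. of_bool (\<eta> x)) \<eta> = p"
proof -
  assume A: "finite A" "x \<in> A"
  have "sav x (\<lambda>\<eta>. of_bool (\<eta> x)) = (\<lambda>_. p)" by (simp add: sav_eq fun_eq_iff)
  then show ?thesis using A by (simp add: av_remove av_const)
qed

lemma av_child_occ_path:
  assumes A: "finite A" and r: "\<And>i. i < k \<Longrightarrow> av A (\<lambda>\<eta>. of_bool (occ_path k h (y @ [i]) \<eta>)) \<eta> = r"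
  shows "av A (\<lambda>\<eta>. of_bool (\<exists>i<k. occ_path k h (y @ [i]) \<eta>)) \<eta> = 1 - (1 - r) ^ k"
proof -
  have "(\<lambda>\<eta>. of_bool (\<exists>i<k. occ_path k h (y @ [i]) \<eta>) :: real)
     = (\<lambda>\<eta>. 1 - (\<Prod>i<k. 1 - of_bool (occ_path k h (y @ [i]) \<eta>)))"
  proof
    fix \<eta>
    show "(of_bool (\<exists>i<k. occ_path k h (y @ [i]) \<eta>) :: real) = 1 - (\<Prod>i<k. 1 - of_bool (occ_path k h (y @ [i]) \<eta>))"
    proof (cases "\<exists>i<k. occ_path k h (y @ [i]) \<eta>")
      case True
      then have "(\<Prod>i<k. 1 - of_bool (occ_path k h (y @ [i]) \<eta>) :: real) = 0"
        by (auto intro!: prod_zero)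
      then show ?thesis using True by simp
    qed auto
  qed
  moreover have "av A (\<lambda>\<eta>. \<Prod>i<k. 1 - of_bool (occ_path k h (y @ [i]) \<eta>)) \<eta>
     = (\<Prod>i<k. av A (\<lambda>\<eta>. 1 - of_bool (occ_path k h (y @ [i]) \<eta>)) \<eta>)"
    by (rule av_prod[OF A, where D = "\<lambda>i. (@) (y @ [i]) ` tball h"])
       (simp, rule depends_on_comp[OF depends_on_occ_path, where F = "\<lambda>b. 1 - of_bool b"], auto)
  moreover have "\<dots> = (\<Prod>i<k. 1 - r)"
    using r by (intro prod.cong) (auto simp: av_diff av_const A)
  ultimately show ?thesis by (simp add: av_diff av_const A)
qed

lemma av_occ_path:
  assumes A: "finite A" and "(@) y ` tball h \<subseteq> A"
  shows "av A (\<lambda>\<eta>. of_bool (occ_path k h y \<eta>)) \<eta> = reach_prob k p h"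
  using assms(2)
proof (induction h arbitrary: y)
  case 0
  have "y @ [] \<in> (@) y ` tball 0" by (rule imageI) (simp add: tree_ball_def tree_def)
  then have "y \<in> A" using 0 by auto
  then show ?case by (simp add: av_coord A)
next
  case (Suc h)
  have "y @ [] \<in> (@) y ` tball (Suc h)" by (rule imageI) (simp add: tree_ball_def tree_def)
  then have y: "y \<in> A" using Suc.prems by auto
  have IH: "av A (\<lambda>\<eta>. of_bool (occ_path k h (y @ [i]) \<eta>)) \<eta> = reach_prob k p h" if "i < k" for i
  proof (rule Suc.IH, rule subsetI)
    fix x assume "x \<in> (@) (y @ [i]) ` tball h"
    then obtain w where "x = y @ (i # w)" "w \<in> tball h" by auto
    then have "x \<in> (@) y ` tball (Suc h)" using that by (auto simp: tree_ball_def tree_def)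
    then show "x \<in> A" using Suc.prems by auto
  qed
  have "av A (\<lambda>\<eta>. of_bool (\<eta> y) * of_bool (\<exists>i<k. occ_path k h (y @ [i]) \<eta>)) \<eta>
     = av A (\<lambda>\<eta>. of_bool (\<eta> y)) \<eta> * av A (\<lambda>\<eta>. of_bool (\<exists>i<k. occ_path k h (y @ [i]) \<eta>)) \<eta>"
  proof (rule av_indep[OF A])
    show "depends_on (\<lambda>\<eta>. of_bool (\<eta> y) :: real) {y}" by (rule depends_on_coord) simp
    show "depends_on (\<lambda>\<eta>. of_bool (\<exists>i<k. occ_path k h (y @ [i]) \<eta>) :: real) (\<Union>i<k. (@) (y @ [i]) ` tball h)"
    proof (rule depends_onI)
      fix \<eta> \<xi> :: config
      assume "\<And>x. x \<in> (\<Union>i<k. (@) (y @ [i]) ` tball h) \<Longrightarrow> \<eta> x = \<xi> x"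
      then have "occ_path k h (y @ [i]) \<eta> = occ_path k h (y @ [i]) \<xi>" if "i < k" for i
        using that by (intro depends_onD[OF depends_on_occ_path]) auto
      then show "(of_bool (\<exists>i<k. occ_path k h (y @ [i]) \<eta>) :: real) = of_bool (\<exists>i<k. occ_path k h (y @ [i]) \<xi>)" by auto
    qed
  qed auto
  also have "\<dots> = reach_prob k p (Suc h)"
    by (simp add: av_coord A y av_child_occ_path[OF A IH])
  finally show ?case by (simp add: of_bool_conj)
qed

lemma av_edge:
  assumes A: "finite A" and f: "depends_on f D" "c \<notin> D"
  shows "av A (\<lambda>\<xi>. of_bool (\<xi> c) * f \<xi>) \<eta> = (if c \<in> A then p else of_bool (\<eta> c)) * av A f \<eta>"
proof (cases "c \<in> A")
  case True
  have "depends_on (\<lambda>\<xi>. of_bool (\<xi> c) :: real) {c}" by (rule depends_on_coord) simp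
  then show ?thesis
    using av_indep[OF A _ f(1), of "\<lambda>\<xi>. of_bool (\<xi> c)" "{c}" \<eta>] f(2) by (simp add: av_coord A True)
next
  case False
  then show ?thesis
    using av_pull[OF A, of \<eta> "\<lambda>\<xi>. of_bool (\<xi> c)" f] by auto
qed

lemma av_open_paths_Suc:
  assumes "finite A"
  shows "av A (open_paths k (Suc j) x) \<eta>
    = (\<Sum>i<k. (if x @ [i] \<in> A then p else of_bool (\<eta> (x @ [i]))) * av A (open_paths k j (x @ [i])) \<eta>)"
proof -
  have "open_paths k (Suc j) x = (\<lambda>\<eta>. \<Sum>i<k. of_bool (\<eta> (x @ [i])) * open_paths k j (x @ [i]) \<eta>)"
    by (rule ext) simp
  moreover have "av A (\<lambda>\<eta>. of_bool (\<eta> (x @ [i])) * open_paths k j (x @ [i]) \<eta>) \<eta>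
     = (if x @ [i] \<in> A then p else of_bool (\<eta> (x @ [i]))) * av A (open_paths k j (x @ [i])) \<eta>" for i
    by (rule av_edge[OF assms depends_on_open_paths]) auto
  ultimately show ?thesis by (simp only: av_sum[OF assms])
qed

text \<open>A vertex has at most \<open>k p \<le> 1\<close> occupied children on average.\<close>

lemma av_open_paths_unrevealed:
  assumes kp: "real k * p \<le> 1" and "x \<in> unrevealed k l \<eta>" "length x + j < l"
  shows "av (unrevealed k l \<eta>) (open_paths k j x) \<eta> \<le> 1"
  using assms(2,3)
proof (induction j arbitrary: x)
  case 0
  have "open_paths k 0 x = (\<lambda>_. 1)" by (rule ext) simp
  then show ?case by (simp add: av_const finite_unrevealed)
next
  case (Suc j)
  have "(if x @ [i] \<in> unrevealed k l \<eta> then p else of_bool (\<eta> (x @ [i]))) * av (unrevealed k l \<eta>) (open_paths k j (x @ [i])) \<eta> \<le> p"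
    if "i < k" for i
  proof (cases "x @ [i] \<in> unrevealed k l \<eta>")
    case True
    then show ?thesis using Suc.IH[OF True] Suc.prems p0 by (simp add: mult_left_le)
  next
    case False
    then show ?thesis using unrevealed_child[OF Suc.prems(1) that False] p0 by simp
  qed
  then have "av (unrevealed k l \<eta>) (open_paths k (Suc j) x) \<eta> \<le> (\<Sum>i<k. p)"
    unfolding av_open_paths_Suc[OF finite_unrevealed] by (intro sum_mono) auto
  also have "(\<Sum>i<k. p) \<le> 1" using kp by simp
  finally show ?case .
qed

text \<open>Given the inspected vertices, an occupied path from \<open>x\<close> follows the
  inspected cluster for a while and then branches off into the uninspected region, where on
  average it has at most one continuation. The cluster meets each of the \<open>j + 1\<close>
  levels in at most \<open>rev_paths k l j x \<eta>\<close> vertices. In the induction,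
  \<open>k p \<le> 1 \<le> rev_paths k l (Suc j) x \<eta>\<close> absorbs the branches that
  leave the cluster at \<open>x\<close>.\<close>

lemma av_open_paths_rev:
  assumes kp: "real k * p \<le> 1" and "x \<in> tree k" "x \<notin> unrevealed k l \<eta>" "length x + j < l"
  shows "av (unrevealed k l \<eta>) (open_paths k j x) \<eta> \<le> real (Suc j) * rev_paths k l j x \<eta>"
  using assms(2-)
proof (induction j arbitrary: x)
  case 0
  have "open_paths k 0 x = (\<lambda>_. 1)" by (rule ext) simp
  then show ?case using 0 by (simp add: av_const finite_unrevealed)
next
  case (Suc j)
  have "(if x @ [i] \<in> unrevealed k l \<eta> then p else of_bool (\<eta> (x @ [i]))) * av (unrevealed k l \<eta>) (open_paths k j (x @ [i])) \<eta>
     \<le> p + real (Suc j) * (of_bool (\<eta> (x @ [i])) * rev_paths k l j (x @ [i]) \<eta>)" if i: "i < k" for i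
  proof (cases "x @ [i] \<in> unrevealed k l \<eta>")
    case True
    then have "p * av (unrevealed k l \<eta>) (open_paths k j (x @ [i])) \<eta> \<le> p"
      using av_open_paths_unrevealed[OF kp True, of j] Suc.prems p0 by (simp add: mult_left_le)
    then show ?thesis using True rev_paths_nonneg[of k l j "x @ [i]" \<eta>] by (simp add: add_increasing2)
  next
    case False
    then have "av (unrevealed k l \<eta>) (open_paths k j (x @ [i])) \<eta> \<le> real (Suc j) * rev_paths k l j (x @ [i]) \<eta>"
      using Suc.prems i by (intro Suc.IH) (auto simp: tree_snoc)
    then show ?thesis using False p0 by (simp add: add_increasing)
  qed
  then have "av (unrevealed k l \<eta>) (open_paths k (Suc j) x) \<eta>
     \<le> (\<Sum>i<k. p + real (Suc j) * (of_bool (\<eta> (x @ [i])) * rev_paths k l j (x @ [i]) \<eta>))"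
    unfolding av_open_paths_Suc[OF finite_unrevealed] by (intro sum_mono) auto
  also have "\<dots> = real k * p + real (Suc j) * rev_paths k l (Suc j) x \<eta>"
    by (simp only: sum.distrib rev_paths.simps sum_distrib_left) simp
  also have "\<dots> \<le> 1 * rev_paths k l (Suc j) x \<eta> + real (Suc j) * rev_paths k l (Suc j) x \<eta>"
    using kp rev_paths_ge_1[OF Suc.prems] by (intro add_mono) auto
  also have "\<dots> = real (Suc (Suc j)) * rev_paths k l (Suc j) x \<eta>"
    by (simp only: of_nat_Suc[of "Suc j"] distrib_right)
  finally show ?case .
qed

text \<open>Whether the end of a path at level \<open>m - 1\<close> is inspected depends only
  on the levels from \<open>m\<close> on, and it has the same probability for each path.\<close>

lemma av_rev_paths:
  assumes W: "W = {y \<in> tball L. m \<le> length y}" and ml: "1 \<le> m" "m \<le> l" "l \<le> L"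
    and "x \<in> tree k" "length x + j = m - 1"
  shows "av W (rev_paths k l j x) \<eta> = (1 - (1 - reach_prob k p (l - m)) ^ k) * open_paths k j x \<eta>"
  using assms(5,6)
proof (induction j arbitrary: x)
  have fin: "finite W" unfolding W using finite_tree_ball by simp
  case 0
  then have x: "length x < l" "l - Suc (length x) = l - m" using ml by auto
  have "rev_paths k l 0 x = (\<lambda>\<eta>. of_bool (\<exists>i<k. occ_path k (l - m) (x @ [i]) \<eta>))"
    using 0 x by (auto simp: unrevealed_def fun_eq_iff)
  moreover have "av W (\<lambda>\<eta>. of_bool (occ_path k (l - m) (x @ [i]) \<eta>)) \<eta> = reach_prob k p (l - m)" if "i < k" for i
    using 0 ml that by (intro av_occ_path fin) (auto simp: W tree_ball_def tree_def)
  ultimately show ?case by (simp add: av_child_occ_path[OF fin])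
next
  have fin: "finite W" unfolding W using finite_tree_ball by simp
  case (Suc j)
  have "rev_paths k l (Suc j) x = (\<lambda>\<eta>. \<Sum>i<k. of_bool (\<eta> (x @ [i])) * rev_paths k l j (x @ [i]) \<eta>)"
    by (rule ext) simp
  moreover have "av W (\<lambda>\<eta>. of_bool (\<eta> (x @ [i])) * rev_paths k l j (x @ [i]) \<eta>) \<eta>
     = (1 - (1 - reach_prob k p (l - m)) ^ k) * (of_bool (\<eta> (x @ [i])) * open_paths k j (x @ [i]) \<eta>)" if "i < k" for i
  proof -
    have "x @ [i] \<notin> W" using Suc.prems ml by (auto simp: W)
    then have "av W (\<lambda>\<eta>. of_bool (\<eta> (x @ [i])) * rev_paths k l j (x @ [i]) \<eta>) \<eta>
       = of_bool (\<eta> (x @ [i])) * av W (rev_paths k l j (x @ [i])) \<eta>"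
      using av_pull[OF fin, of \<eta> "\<lambda>\<xi>. of_bool (\<xi> (x @ [i]))" "rev_paths k l j (x @ [i])"] by auto
    also have "av W (rev_paths k l j (x @ [i])) \<eta> = (1 - (1 - reach_prob k p (l - m)) ^ k) * open_paths k j (x @ [i]) \<eta>"
      using Suc.prems that by (intro Suc.IH) (auto simp: tree_snoc)
    finally show ?thesis by simp
  qed
  ultimately show ?case by (simp only: av_sum[OF fin] sum_distrib_left open_paths.simps) (simp add: sum_distrib_left)
qed

text \<open>Decompose according to the value \<open>A\<close> of \<open>S\<close>. Resampling
  the vertices in \<open>A\<close> does not affect the event \<open>S = A\<close>.\<close>

lemma av_stopping_set:
  assumes B: "finite B" "\<And>\<eta>. S \<eta> \<subseteq> B" and S: "\<And>\<eta> \<xi>. (\<And>x. x \<notin> S \<eta> \<Longrightarrow> \<xi> x = \<eta> x) \<Longrightarrow> S \<xi> = S \<eta>"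
  shows "av B (\<lambda>\<eta>. av (S \<eta>) G \<eta>) \<eta> = av B G \<eta>"
proof -
  have part: "F \<xi> = (\<Sum>A\<in>Pow B. of_bool (S \<xi> = A) * F \<xi>)" for F :: "config \<Rightarrow> real" and \<xi>
  proof -
    have "(\<Sum>A\<in>Pow B. of_bool (S \<xi> = A) * F \<xi>) = (\<Sum>A\<in>Pow B. if S \<xi> = A then F \<xi> else 0)"
      by (intro sum.cong) auto
    also have "\<dots> = F \<xi>" using B by simp
    finally show ?thesis by simp
  qed
  have "of_bool (S \<zeta> = A) * av (S \<zeta>) G \<zeta> = av A (\<lambda>\<xi>. of_bool (S \<xi> = A) * G \<xi>) \<zeta>" if A: "A \<in> Pow B" for A \<zeta>
  proof -
    have finA: "finite A" using A B(1) by (auto intro: finite_subset)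
    have "(of_bool (S \<xi> = A) :: real) = of_bool (S \<zeta> = A)" if "\<And>x. x \<notin> A \<Longrightarrow> \<xi> x = \<zeta> x" for \<xi>
    proof -
      have "S \<xi> = A \<longleftrightarrow> S \<zeta> = A" using S[of \<xi> \<zeta>] S[of \<zeta> \<xi>] that by metis
      then show ?thesis by simp
    qed
    then have "av A (\<lambda>\<xi>. of_bool (S \<xi> = A) * G \<xi>) \<zeta> = of_bool (S \<zeta> = A) * av A G \<zeta>"
      by (rule av_pull[OF finA])
    then show ?thesis by auto
  qed
  then have "(\<lambda>\<eta>. av (S \<eta>) G \<eta>) = (\<lambda>\<zeta>. \<Sum>A\<in>Pow B. av A (\<lambda>\<xi>. of_bool (S \<xi> = A) * G \<xi>) \<zeta>)"
    by (subst part[of "\<lambda>\<eta>. av (S \<eta>) G \<eta>"]) (auto simp: fun_eq_iff intro!: sum.cong)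
  then have "av B (\<lambda>\<eta>. av (S \<eta>) G \<eta>) \<eta> = (\<Sum>A\<in>Pow B. av B (av A (\<lambda>\<xi>. of_bool (S \<xi> = A) * G \<xi>)) \<eta>)"
    by (simp add: av_sum B)
  also have "\<dots> = (\<Sum>A\<in>Pow B. av B (\<lambda>\<xi>. of_bool (S \<xi> = A) * G \<xi>) \<eta>)"
    by (intro sum.cong refl) (simp add: av_idem B)
  also have "\<dots> = av B (\<lambda>\<xi>. \<Sum>A\<in>Pow B. of_bool (S \<xi> = A) * G \<xi>) \<eta>"
    by (simp only: av_sum[OF B(1)])
  also have "(\<lambda>\<xi>. \<Sum>A\<in>Pow B. of_bool (S \<xi> = A) * G \<xi>) = G"
    using part[of G] by (simp add: fun_eq_iff)
  finally show ?thesis .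
qed

text \<open>Where the root is uninspected, averaging annihilates \<open>h\<close>. Elsewhere
  use the Cauchy-Schwarz inequality weighted by the number \<open>Z\<close> of occupied paths
  from the root to level \<open>m - 1\<close>. The conditional mean of \<open>Z\<close> is at
  most \<open>m\<close> times the number \<open>N\<close> of paths with inspected end, and the
  average of \<open>N\<close> over the levels from \<open>m\<close> on is a small multiple of
  \<open>Z\<close>, which cancels the weight. The weight takes care of functions
  \<open>h\<close> concentrated on configurations with many paths, for which the root is
  likely to be inspected.\<close>

lemma revealed_contraction:
  assumes kp: "real k * p \<le> 1" and ml: "1 \<le> m" "m \<le> l" "l \<le> L"
    and h: "depends_on h (- {y \<in> tball L. m \<le> length y})" "sav [] h = (\<lambda>_. 0)"
  shows "av (tball L) (\<lambda>\<eta>. (av (unrevealed k l \<eta>) h \<eta>)\<^sup>2) \<eta>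
    \<le> real m * (1 - (1 - reach_prob k p (l - m)) ^ k) * av (tball L) (\<lambda>\<eta>. (h \<eta>)\<^sup>2) \<eta>"
proof -
  define B where "B = tball L"
  define W where "W = {y \<in> tball L. m \<le> length y}"
  define S where "S = unrevealed k l"
  define Z where "Z = open_paths k (m - 1) []"
  define N where "N = rev_paths k l (m - 1) []"
  define u where "u = 1 - (1 - reach_prob k p (l - m)) ^ k"
  have B: "finite B" and W: "finite W" "W \<subseteq> B"
    using finite_tree_ball by (auto simp: B_def W_def)
  have S: "finite (S \<eta>)" "S \<eta> \<subseteq> B" for \<eta>
    using ml by (simp add: S_def finite_unrevealed) (use ml in \<open>auto simp: S_def unrevealed_def B_def tree_ball_def\<close>)
  have Nil: "[] \<in> tree k" by (simp add: tree_def)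
  have ml': "length ([] :: vertex) + (m - 1) < l" using ml by auto
  have NZ: "0 \<le> N \<xi>" "N \<xi> \<le> Z \<xi>" for \<xi>
    by (simp_all add: N_def Z_def rev_paths_nonneg rev_paths_le_open_paths)
  have pw: "(av (S \<eta>) h \<eta>)\<^sup>2 \<le> av (S \<eta>) (\<lambda>\<xi>. real m * N \<xi> * ((h \<xi>)\<^sup>2 / Z \<xi>)) \<eta>" for \<eta>
  proof (cases "[] \<in> S \<eta>")
    case True
    then have "av (S \<eta>) h \<eta> = 0" using h(2) S(1) by (simp add: av_remove av_const)
    moreover have "0 \<le> av (S \<eta>) (\<lambda>\<xi>. real m * N \<xi> * ((h \<xi>)\<^sup>2 / Z \<xi>)) \<eta>"
      using NZ by (intro av_nonneg S mult_nonneg_nonneg divide_nonneg_nonneg) (auto intro: order_trans)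
    ultimately show ?thesis by simp
  next
    case False
    have Z1: "1 \<le> Z \<xi>" if "\<And>x. x \<notin> S \<eta> \<Longrightarrow> \<xi> x = \<eta> x" for \<xi>
    proof -
      have "[] \<notin> unrevealed k l \<xi>" using False that unrevealed_stop[of k l \<eta> \<xi>] by (simp add: S_def)
      then have "1 \<le> N \<xi>" unfolding N_def by (rule rev_paths_ge_1[OF Nil _ ml'])
      then show ?thesis using NZ(2)[of \<xi>] by linarith
    qed
    have "av (S \<eta>) h \<eta> = av (S \<eta>) (\<lambda>\<xi>. h \<xi> / sqrt (Z \<xi>) * sqrt (Z \<xi>)) \<eta>"
    proof (rule av_cong[OF S(1)])
      fix \<xi> assume "\<And>x. x \<notin> S \<eta> \<Longrightarrow> \<xi> x = \<eta> x"
      then show "h \<xi> = h \<xi> / sqrt (Z \<xi>) * sqrt (Z \<xi>)" using Z1[of \<xi>] by simp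
    qed
    then have "(av (S \<eta>) h \<eta>)\<^sup>2
        \<le> av (S \<eta>) (\<lambda>\<xi>. (h \<xi> / sqrt (Z \<xi>))\<^sup>2) \<eta> * av (S \<eta>) (\<lambda>\<xi>. (sqrt (Z \<xi>))\<^sup>2) \<eta>"
      using av_CS[OF S(1)[of \<eta>], of "\<lambda>\<xi>. h \<xi> / sqrt (Z \<xi>)" "\<lambda>\<xi>. sqrt (Z \<xi>)" \<eta>] by simp
    also have "(\<lambda>\<xi>. (sqrt (Z \<xi>))\<^sup>2) = Z"
      using open_paths_nonneg by (auto simp: Z_def)
    also have "(\<lambda>\<xi>. (h \<xi> / sqrt (Z \<xi>))\<^sup>2) = (\<lambda>\<xi>. (h \<xi>)\<^sup>2 / Z \<xi>)"
      using open_paths_nonneg by (auto simp: Z_def power_divide)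
    also have "av (S \<eta>) (\<lambda>\<xi>. (h \<xi>)\<^sup>2 / Z \<xi>) \<eta> * av (S \<eta>) Z \<eta>
        \<le> av (S \<eta>) (\<lambda>\<xi>. (h \<xi>)\<^sup>2 / Z \<xi>) \<eta> * (real m * N \<eta>)"
      using av_open_paths_rev[OF kp Nil _ ml', of \<eta>] False ml open_paths_nonneg
      by (intro mult_left_mono av_nonneg S) (auto simp: S_def Z_def N_def)
    also have "\<dots> = av (S \<eta>) (\<lambda>\<xi>. real m * N \<xi> * ((h \<xi>)\<^sup>2 / Z \<xi>)) \<eta>"
    proof -
      have "av (S \<eta>) (\<lambda>\<xi>. real m * N \<xi> * ((h \<xi>)\<^sup>2 / Z \<xi>)) \<eta>
          = real m * N \<eta> * av (S \<eta>) (\<lambda>\<xi>. (h \<xi>)\<^sup>2 / Z \<xi>) \<eta>"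
      proof (rule av_pull[OF S(1)])
        fix \<xi> assume "\<And>x. x \<notin> S \<eta> \<Longrightarrow> \<xi> x = \<eta> x"
        then have "N \<xi> = N \<eta>" unfolding N_def S_def by (rule rev_paths_stop[OF _ ml'])
        then show "real m * N \<xi> = real m * N \<eta>" by simp
      qed
      then show ?thesis by simp
    qed
    finally show ?thesis .
  qed
  have "av B (\<lambda>\<eta>. (av (S \<eta>) h \<eta>)\<^sup>2) \<eta>
      \<le> av B (\<lambda>\<eta>. av (S \<eta>) (\<lambda>\<xi>. real m * N \<xi> * ((h \<xi>)\<^sup>2 / Z \<xi>)) \<eta>) \<eta>"
    by (intro av_mono B pw)
  also have "\<dots> = av B (\<lambda>\<xi>. real m * N \<xi> * ((h \<xi>)\<^sup>2 / Z \<xi>)) \<eta>"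
    unfolding S_def using S(2)[unfolded S_def] by (intro av_stopping_set B unrevealed_stop)
  also have "\<dots> = av B (av W (\<lambda>\<xi>. (real m * ((h \<xi>)\<^sup>2 / Z \<xi>)) * N \<xi>)) \<eta>"
    by (simp add: av_idem B W mult_ac)
  also have "\<dots> \<le> av B (\<lambda>\<xi>. real m * u * (h \<xi>)\<^sup>2) \<eta>"
  proof (rule av_mono[OF B])
    fix \<xi>
    have u: "0 \<le> u" unfolding u_def by (rule child_reach_prob_bounds)
    have dZ: "depends_on Z (- W)"
    proof -
      have "depends_on (open_paths k j x) {y. length y \<le> length x + j}" for j x
      proof (induction j arbitrary: x)
        case (Suc j)
        show ?case
          unfolding open_paths.simps
        proof (intro depends_on_sum depends_on_comp2[where F = "(*)"])
          fix i
          show "depends_on (\<lambda>\<eta>. of_bool (\<eta> (x @ [i])) :: real) {y. length y \<le> length x + Suc j}"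
            by (rule depends_on_coord) auto
          show "depends_on (open_paths k j (x @ [i])) {y. length y \<le> length x + Suc j}"
            by (rule depends_on_mono[OF Suc.IH]) auto
        qed
      qed (simp add: depends_on_def)
      then show ?thesis
        unfolding Z_def by (rule depends_on_mono) (use ml in \<open>auto simp: W_def\<close>)
    qed
    have "av W (\<lambda>\<xi>. (real m * ((h \<xi>)\<^sup>2 / Z \<xi>)) * N \<xi>) \<xi> = (real m * ((h \<xi>)\<^sup>2 / Z \<xi>)) * av W N \<xi>"
      by (rule av_pull_dep[OF W(1), where D = "- W"])
         (rule depends_on_comp2[OF h(1)[folded W_def] dZ, where F = "\<lambda>a b. real m * (a\<^sup>2 / b)"], simp)
    also have "av W N \<xi> = u * Z \<xi>"
      unfolding N_def Z_def u_def using ml by (intro av_rev_paths[OF W_def _ _ _ Nil]) auto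
    also have "real m * ((h \<xi>)\<^sup>2 / Z \<xi>) * (u * Z \<xi>) \<le> real m * u * (h \<xi>)\<^sup>2"
      using u by (cases "Z \<xi> = 0") auto
    finally show "av W (\<lambda>\<xi>. (real m * ((h \<xi>)\<^sup>2 / Z \<xi>)) * N \<xi>) \<xi> \<le> real m * u * (h \<xi>)\<^sup>2" .
  qed
  also have "\<dots> = real m * u * av B (\<lambda>\<xi>. (h \<xi>)\<^sup>2) \<eta>" by (simp add: av_cmult B)
  finally show ?thesis by (simp add: B_def S_def u_def)
qed

text \<open>Both \<open>Q1\<close> and \<open>Q2\<close> are orthogonal projections. By
  \<open>revealed_contraction\<close> the scalar product of \<open>Q1 f\<close> and \<open>Q2
  f\<close> is at most \<open>sqrt \<theta>\<close> times the product of their norms, so their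
  squared norms add up to at most \<open>1 + sqrt \<theta>\<close> times that of
  \<open>f\<close>. The squared norms of \<open>f - Q1 f\<close> and \<open>f - Q2 f\<close>
  are averages of conditional variances, over the forest of the levels from \<open>m\<close>
  on and over the uninspected vertices.\<close>

lemma two_block:
  assumes kp: "real k * p \<le> 1" and ml: "1 \<le> m" "m \<le> l" "l \<le> L"
    and piW: "poincare (tball (L - m)) T" and piS: "poincare (tball (l - 1)) T" and T: "0 \<le> T"
    and \<theta>: "real m * (1 - (1 - reach_prob k p (l - m)) ^ k) \<le> \<theta>"
    and f: "sav [] f = (\<lambda>_. 0)"
  defines "B \<equiv> tball L"
  shows "(1 - sqrt \<theta>) * av B (\<lambda>\<xi>. (f \<xi>)\<^sup>2) \<eta>
    \<le> T * (av B (\<lambda>\<xi>. \<Sum>y | y \<in> B \<and> m \<le> length y. constr k B y \<xi> * site_var y f \<xi>) \<eta>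
         + av B (\<lambda>\<xi>. \<Sum>y | y \<in> B \<and> length y < l. constr k B y \<xi> * site_var y f \<xi>) \<eta>)"
proof -
  define W where "W = {y \<in> tball L. m \<le> length y}"
  define S where "S = unrevealed k l"
  define Q1 where "Q1 = av W f"
  define Q2 where "Q2 = (\<lambda>\<eta>. av (S \<eta>) f \<eta>)"
  have B: "finite B" and W: "finite W" "W \<subseteq> B"
    using finite_tree_ball by (auto simp: B_def W_def)
  have S: "finite (S \<eta>)" "S \<eta> \<subseteq> B" for \<eta>
    using ml by (simp add: S_def finite_unrevealed) (use ml in \<open>auto simp: S_def unrevealed_def B_def tree_ball_def\<close>)
  have Sstop: "S \<xi> = S \<eta>" if "\<And>x. x \<notin> S \<eta> \<Longrightarrow> \<xi> x = \<eta> x" for \<eta> \<xi>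
    using that unfolding S_def by (rule unrevealed_stop)
  have avS: "av B (\<lambda>\<eta>. av (S \<eta>) G \<eta>) \<eta> = av B G \<eta>" for G
    by (rule av_stopping_set[OF B S(2) Sstop])
  have Q2_pull: "av B (\<lambda>\<xi>. g \<xi> * Q2 \<xi>) \<eta> = av B (\<lambda>\<xi>. av (S \<xi>) g \<xi> * Q2 \<xi>) \<eta>" for g
  proof -
    have "av (S \<xi>) (\<lambda>\<zeta>. Q2 \<zeta> * g \<zeta>) \<xi> = Q2 \<xi> * av (S \<xi>) g \<xi>" for \<xi>
    proof (rule av_pull[OF S(1)])
      fix \<zeta> assume z: "\<And>x. x \<notin> S \<xi> \<Longrightarrow> \<zeta> x = \<xi> x"
      have "S \<zeta> = S \<xi>" by (rule Sstop[OF z])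
      then show "Q2 \<zeta> = Q2 \<xi>" unfolding Q2_def using av_agree[OF S(1) z] by simp
    qed
    then have "av B (\<lambda>\<xi>. av (S \<xi>) (\<lambda>\<zeta>. Q2 \<zeta> * g \<zeta>) \<xi>) \<eta> = av B (\<lambda>\<xi>. Q2 \<xi> * av (S \<xi>) g \<xi>) \<eta>" by simp
    then show ?thesis by (simp add: avS mult.commute)
  qed
  have Q1_pull: "av B (\<lambda>\<xi>. f \<xi> * Q1 \<xi>) \<eta> = av B (\<lambda>\<xi>. (Q1 \<xi>)\<^sup>2) \<eta>"
  proof -
    have "av W (\<lambda>\<zeta>. Q1 \<zeta> * f \<zeta>) \<xi> = Q1 \<xi> * av W f \<xi>" for \<xi>
      by (rule av_pull[OF W(1)]) (unfold Q1_def, rule av_agree[OF W(1)])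
    then have "av W (\<lambda>\<zeta>. Q1 \<zeta> * f \<zeta>) = (\<lambda>\<xi>. Q1 \<xi> * Q1 \<xi>)"
      by (simp add: fun_eq_iff Q1_def)
    then have "av B (av W (\<lambda>\<zeta>. Q1 \<zeta> * f \<zeta>)) \<eta> = av B (\<lambda>\<xi>. Q1 \<xi> * Q1 \<xi>) \<eta>" by simp
    then have "av B (\<lambda>\<zeta>. Q1 \<zeta> * f \<zeta>) \<eta> = av B (\<lambda>\<xi>. Q1 \<xi> * Q1 \<xi>) \<eta>"
      by (simp only: av_idem[OF B W(2)])
    then show ?thesis by (simp only: mult.commute[of "f _"] power2_eq_square)
  qed
  define F where "F = av B (\<lambda>\<xi>. (f \<xi>)\<^sup>2) \<eta>"
  define X1 where "X1 = av B (\<lambda>\<xi>. (Q1 \<xi>)\<^sup>2) \<eta>"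
  define X2 where "X2 = av B (\<lambda>\<xi>. (Q2 \<xi>)\<^sup>2) \<eta>"
  define C where "C = av B (\<lambda>\<xi>. Q1 \<xi> * Q2 \<xi>) \<eta>"
  have nn: "0 \<le> F" "0 \<le> X1" "0 \<le> X2" unfolding F_def X1_def X2_def by (intro av_nonneg B; simp)+
  have fQ2: "av B (\<lambda>\<xi>. f \<xi> * Q2 \<xi>) \<eta> = X2"
    using Q2_pull[of f] by (simp add: X2_def Q2_def power2_eq_square)
  have u0: "0 \<le> \<theta>"
    using child_reach_prob_bounds(1) by (intro order_trans[OF mult_nonneg_nonneg \<theta>]) auto
  have C: "C\<^sup>2 \<le> \<theta> * X1 * X2"
  proof -
    have "depends_on Q1 (- W)"
      unfolding Q1_def
    proof (intro depends_on_av W depends_onI)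
      fix \<eta> \<xi> :: config assume "\<And>x. x \<in> - W \<union> W \<Longrightarrow> \<eta> x = \<xi> x"
      then have "\<eta> = \<xi>" by (auto simp: fun_eq_iff)
      then show "f \<eta> = f \<xi>" by simp
    qed
    moreover have "sav [] Q1 = (\<lambda>_. 0)"
    proof -
      have "[] \<notin> W" using ml by (simp add: W_def)
      then have "sav [] Q1 = av W (sav [] f)"
        unfolding Q1_def using av_insert[OF W(1), of "[]" f] av_insert2[OF W(1), of "[]" f] by simp
      then show ?thesis by (simp add: f av_const W)
    qed
    ultimately have contr: "av B (\<lambda>\<eta>. (av (S \<eta>) Q1 \<eta>)\<^sup>2) \<eta>
        \<le> real m * (1 - (1 - reach_prob k p (l - m)) ^ k) * X1"
      unfolding B_def S_def X1_def W_def by (intro revealed_contraction kp ml)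
    have "C\<^sup>2 = (av B (\<lambda>\<xi>. av (S \<xi>) Q1 \<xi> * Q2 \<xi>) \<eta>)\<^sup>2"
      unfolding C_def by (rule arg_cong[where f = "\<lambda>x. x\<^sup>2", OF Q2_pull])
    also have "\<dots> \<le> av B (\<lambda>\<eta>. (av (S \<eta>) Q1 \<eta>)\<^sup>2) \<eta> * X2"
      unfolding X2_def by (rule av_CS[OF B])
    also have "\<dots> \<le> \<theta> * X1 * X2"
      using contr mult_right_mono[OF \<theta> nn(2)] nn by (intro mult_right_mono) auto
    finally show ?thesis .
  qed
  have "C \<le> sqrt \<theta> * ((X1 + X2) / 2)"
  proof -
    have "C \<le> sqrt (\<theta> * (X1 * X2))" using C by (intro real_le_rsqrt) (simp add: mult.assoc)
    also have "\<dots> = sqrt \<theta> * sqrt (X1 * X2)" by (rule real_sqrt_mult)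
    also have "\<dots> \<le> sqrt \<theta> * ((X1 + X2) / 2)"
      using u0 nn by (intro mult_left_mono arith_geo_mean_sqrt) auto
    finally show ?thesis .
  qed
  then have C': "X1 + X2 + 2 * C \<le> (1 + sqrt \<theta>) * (X1 + X2)" by (simp add: algebra_simps)
  have X: "X1 + X2 \<le> (1 + sqrt \<theta>) * F"
  proof (cases "X1 + X2 = 0")
    case False
    have "X1 + X2 = av B (\<lambda>\<xi>. f \<xi> * (Q1 \<xi> + Q2 \<xi>)) \<eta>"
      using Q1_pull fQ2 by (simp add: distrib_left av_add B X1_def)
    then have "(X1 + X2)\<^sup>2 \<le> F * av B (\<lambda>\<xi>. (Q1 \<xi> + Q2 \<xi>)\<^sup>2) \<eta>"
      unfolding F_def using av_CS[OF B, of f "\<lambda>\<xi>. Q1 \<xi> + Q2 \<xi>" \<eta>] by simp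
    also have "av B (\<lambda>\<xi>. (Q1 \<xi> + Q2 \<xi>)\<^sup>2) \<eta> = X1 + X2 + 2 * C"
    proof -
      have "(\<lambda>\<xi>. (Q1 \<xi> + Q2 \<xi>)\<^sup>2) = (\<lambda>\<xi>. (Q1 \<xi>)\<^sup>2 + ((Q2 \<xi>)\<^sup>2 + 2 * (Q1 \<xi> * Q2 \<xi>)))"
        by (auto simp: power2_eq_square algebra_simps)
      then show ?thesis by (simp add: av_add av_cmult B X1_def X2_def C_def)
    qed
    also have "F * (X1 + X2 + 2 * C) \<le> F * ((1 + sqrt \<theta>) * (X1 + X2))"
      by (intro mult_left_mono C' nn)
    finally have "(X1 + X2) * (X1 + X2) \<le> (X1 + X2) * ((1 + sqrt \<theta>) * F)"
      by (simp add: power2_eq_square mult_ac)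
    moreover have "0 < X1 + X2" using False nn by linarith
    ultimately show ?thesis by (metis mult_le_cancel_left_pos)
  qed (use nn u0 in auto)
  have EW: "F - X1 \<le> T * av B (\<lambda>\<xi>. \<Sum>y | y \<in> B \<and> m \<le> length y. constr k B y \<xi> * site_var y f \<xi>) \<eta>"
  proof -
    have "W \<subseteq> tree k" by (auto simp: W_def tree_ball_def)
    then have "poincare W T"
      using ml by (intro poincare_forest[OF piW T W(1), of m]) (auto simp: W_def tree_ball_def)
    then have "av W (\<lambda>\<xi>. (f \<xi>)\<^sup>2) \<xi> - (Q1 \<xi>)\<^sup>2 \<le> T * av W (energy W f) \<xi>" for \<xi>
      unfolding Q1_def by (rule poincareD)
    then have "av B (\<lambda>\<xi>. av W (\<lambda>\<xi>. (f \<xi>)\<^sup>2) \<xi> - (Q1 \<xi>)\<^sup>2) \<eta> \<le> av B (\<lambda>\<xi>. T * av W (energy W f) \<xi>) \<eta>"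
      by (intro av_mono B)
    then have "F - X1 \<le> T * av B (energy W f) \<eta>"
      by (simp add: av_diff av_cmult av_idem B W F_def X1_def)
    moreover have "energy W f = (\<lambda>\<xi>. \<Sum>y | y \<in> B \<and> m \<le> length y. constr k B y \<xi> * site_var y f \<xi>)"
    proof
      fix \<xi>
      have "constr k B y = constr k W y" if "y \<in> W" for y
        using that W(2) by (intro constr_closed) (auto simp: W_def B_def dest: length_child)
      then show "energy W f \<xi> = (\<Sum>y | y \<in> B \<and> m \<le> length y. constr k B y \<xi> * site_var y f \<xi>)"
        unfolding energy_def by (intro sum.cong) (auto simp: W_def B_def)
    qed
    ultimately show ?thesis by simp
  qed
  have ES: "F - X2 \<le> T * av B (\<lambda>\<xi>. \<Sum>y | y \<in> B \<and> length y < l. constr k B y \<xi> * site_var y f \<xi>) \<eta>"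
  proof -
    define G where "G = (\<lambda>\<xi>. \<Sum>y | y \<in> B \<and> length y < l. constr k B y \<xi> * site_var y f \<xi>)"
    have "av (S \<xi>) (\<lambda>\<xi>. (f \<xi>)\<^sup>2) \<xi> - (Q2 \<xi>)\<^sup>2 \<le> T * av (S \<xi>) G \<xi>" for \<xi>
    proof -
      have "S \<xi> \<subseteq> tball (l - 1)" using ml by (auto simp: S_def unrevealed_def tree_ball_def)
      then have "poincare (S \<xi>) T" by (rule poincare_subset[OF finite_tree_ball _ piS T])
      then have "av (S \<xi>) (\<lambda>\<xi>. (f \<xi>)\<^sup>2) \<xi> - (Q2 \<xi>)\<^sup>2 \<le> T * av (S \<xi>) (energy (S \<xi>) f) \<xi>"
        unfolding Q2_def by (rule poincareD)
      also have "\<dots> \<le> T * av (S \<xi>) G \<xi>"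
      proof (intro mult_left_mono T av_mono S)
        fix \<zeta> assume z: "\<And>x. x \<notin> S \<xi> \<Longrightarrow> \<zeta> x = \<xi> x"
        have "constr k (S \<xi>) y \<zeta> \<le> constr k B y \<zeta>" if y: "y \<in> S \<xi>" for y
        proof -
          have "\<not> \<zeta> c" if "c \<in> children k y" "c \<notin> S \<xi>" for c
            using unrevealed_child[OF y[unfolded S_def]] that z[OF that(2)] by (auto simp: children_def S_def)
          then show ?thesis by (auto simp: constr_def)
        qed
        then have "energy (S \<xi>) f \<zeta> \<le> (\<Sum>y\<in>S \<xi>. constr k B y \<zeta> * site_var y f \<zeta>)"
          unfolding energy_def by (intro sum_mono mult_right_mono site_var_nonneg)
        also have "\<dots> \<le> G \<zeta>"
          unfolding G_def using B S(2)[of \<xi>]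
          by (intro sum_mono2 mult_nonneg_nonneg constr_nonneg site_var_nonneg) (auto simp: S_def unrevealed_def)
        finally show "energy (S \<xi>) f \<zeta> \<le> G \<zeta>" .
      qed
      finally show ?thesis .
    qed
    then have "av B (\<lambda>\<xi>. av (S \<xi>) (\<lambda>\<xi>. (f \<xi>)\<^sup>2) \<xi> - (Q2 \<xi>)\<^sup>2) \<eta> \<le> av B (\<lambda>\<xi>. T * av (S \<xi>) G \<xi>) \<eta>"
      by (intro av_mono B)
    then show ?thesis
      by (simp add: av_diff av_cmult avS B F_def X2_def G_def)
  qed
  have "(1 - sqrt \<theta>) * F \<le> (F - X1) + (F - X2)" using X by (simp add: algebra_simps)
  also have "\<dots> \<le> T * (av B (\<lambda>\<xi>. \<Sum>y | y \<in> B \<and> m \<le> length y. constr k B y \<xi> * site_var y f \<xi>) \<eta>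
         + av B (\<lambda>\<xi>. \<Sum>y | y \<in> B \<and> length y < l. constr k B y \<xi> * site_var y f \<xi>) \<eta>)"
    using EW ES by (simp add: distrib_left)
  finally show ?thesis by (simp add: F_def)
qed

end

section \<open>Relaxation times at and below criticality\<close>

context ofa
begin

lemma child_reach_prob_le: "1 - (1 - reach_prob k p h) ^ k \<le> real k * reach_prob k p h"
proof -
  have "1 + real k * (- reach_prob k p h) \<le> (1 + - reach_prob k p h) ^ k"
    using reach_prob_bounds[of h] by (intro Bernoulli_inequality) auto
  then show ?thesis by simp
qed

lemma reach_prob_Suc_le: "reach_prob k p (Suc h) \<le> real k * p * reach_prob k p h"
  using mult_left_mono[OF child_reach_prob_le[of h], of p] p0 by (simp add: mult_ac)

lemma reach_prob_geometric: "reach_prob k p h \<le> (real k * p) ^ h * p"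
proof (induction h)
  case (Suc h)
  have "reach_prob k p (Suc h) \<le> real k * p * reach_prob k p h" by (rule reach_prob_Suc_le)
  also have "\<dots> \<le> real k * p * ((real k * p) ^ h * p)"
    using Suc p0 by (intro mult_left_mono) auto
  finally show ?case by simp
qed simp

lemma power_lower_quadratic:
  fixes u :: real
  assumes "0 \<le> u" "u \<le> 1" "2 \<le> n"
  shows "1 - real n * u + u\<^sup>2 \<le> (1 - u) ^ n"
  using assms(3)
proof (induction n rule: dec_induct)
  case base
  then show ?case by (simp add: power2_eq_square algebra_simps)
next
  case (step n)
  have "u * u\<^sup>2 \<le> real n * u\<^sup>2" using assms step by (intro mult_right_mono) auto
  then have "1 - real (Suc n) * u + u\<^sup>2 \<le> (1 - real n * u + u\<^sup>2) * (1 - u)"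
    by (simp add: power2_eq_square algebra_simps)
  also have "\<dots> \<le> (1 - u) ^ n * (1 - u)"
    using step assms by (intro mult_right_mono) auto
  finally show ?case by (simp add: mult.commute)
qed

text \<open>For \<open>k p = 1\<close> the survival probability \<open>u\<close> is multiplied
  in each generation by at most \<open>1 - u / k\<close>, so that its inverse grows at least
  linearly.\<close>

lemma reach_prob_critical:
  assumes "real k * p = 1"
  shows "reach_prob k p h \<le> real k / real (Suc h)"
proof -
  have step: "reach_prob k p (Suc h) \<le> reach_prob k p h * (1 - reach_prob k p h / real k)" for h
  proof -
    let ?u = "reach_prob k p h"
    have "1 - (1 - ?u) ^ k \<le> real k * ?u - ?u\<^sup>2"
      using power_lower_quadratic[of ?u k] reach_prob_bounds[of h] k2 by simp
    then have "p * (1 - (1 - ?u) ^ k) \<le> p * (real k * ?u - ?u\<^sup>2)"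
      using p0 by (intro mult_left_mono) auto
    also have "\<dots> = (real k * p) * ?u - (real k * p) * ?u\<^sup>2 / real k"
      using k2 by (simp add: algebra_simps)
    also have "\<dots> = ?u * (1 - ?u / real k)"
      unfolding assms by (simp add: power2_eq_square right_diff_distrib)
    finally show ?thesis by (simp only: reach_prob.simps)
  qed
  show ?thesis
  proof (induction h)
    case 0
    then show ?case using p1 k2 by simp
  next
    case (Suc h)
    let ?u = "reach_prob k p h"
    show ?case
    proof (cases "h = 0")
      case True
      have "reach_prob k p (Suc 0) \<le> p" using reach_prob_geometric[of 1] by (simp add: assms)
      also have "p \<le> real k / 2" using p1 k2 by simp
      finally show ?thesis using True by simp
    next
      case False
      define x where "x = real k / real (Suc h)"
      have x: "x \<le> real k / 2" unfolding x_def using False by (intro divide_left_mono) auto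
      have "?u \<le> x" using Suc by (simp add: x_def)
      then have "0 \<le> (x - ?u) * (real k - (x + ?u))" using x by (intro mult_nonneg_nonneg) auto
      then have "?u * (real k - ?u) \<le> x * (real k - x)" by (simp add: algebra_simps)
      then have "?u * (real k - ?u) / real k \<le> x * (real k - x) / real k"
        by (rule divide_right_mono) simp
      moreover have "y * (1 - y / real k) = y * (real k - y) / real k" for y
        using k2 by (simp add: field_simps)
      ultimately have "?u * (1 - ?u / real k) \<le> x * (1 - x / real k)" by simp
      also have "\<dots> = real k * (real h / (real (Suc h))\<^sup>2)"
      proof -
        have "x / real k = 1 / real (Suc h)" using k2 by (simp add: x_def)
        then have "1 - x / real k = real h / real (Suc h)" by (simp add: field_simps)
        then show ?thesis unfolding x_def by (simp add: power2_eq_square)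
      qed
      also have "\<dots> \<le> real k * (1 / real (Suc (Suc h)))"
      proof (intro mult_left_mono)
        have "real h * real (Suc (Suc h)) \<le> (real (Suc h))\<^sup>2"
          by (simp add: power2_eq_square algebra_simps)
        then have "real h \<le> (real (Suc h))\<^sup>2 / real (Suc (Suc h))"
          by (subst pos_le_divide_eq) auto
        then show "real h / (real (Suc h))\<^sup>2 \<le> 1 / real (Suc (Suc h))"
          by (intro mult_imp_div_pos_le) auto
      qed simp
      finally show ?thesis using step[of h] by simp
    qed
  qed
qed

lemma tree_ball_mono: "n \<le> n' \<Longrightarrow> tball n \<subseteq> tball n'"
  by (auto simp: tree_ball_def)

lemma poincare_tree_ball_mono:
  "poincare (tball n') T \<Longrightarrow> n \<le> n' \<Longrightarrow> 0 \<le> T \<Longrightarrow> poincare (tball n) T"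
  by (rule poincare_subset[OF finite_tree_ball tree_ball_mono])

lemma poincare_tree_ball_grow:
  assumes M: "poincare (tball M) T'" and T': "0 \<le> T'" and "M \<le> M'"
    and rp: "\<And>L. M < L \<Longrightarrow> L \<le> M' \<Longrightarrow> root_poincare (tball L) [] T'"
  shows "poincare (tball M') T'"
  using assms(3) rp
proof (induction M' rule: dec_induct)
  case base
  show ?case by (rule M)
next
  case (step n)
  then show ?case
    by (intro poincare_tree_ball_extend T') auto
qed

text \<open>Blocks with an overlap of \<open>4 k\<^sup>2 m\<close> levels: then
  \<open>\<theta> = 1 / 4\<close> is admissible in \<open>two_block\<close>, and the energy is
  counted at most twice.\<close>

lemma critical_step:
  assumes crit: "real k * p = 1" and L: "4 * k\<^sup>2 + 2 \<le> L"
    and M: "M = L - L div (4 * k\<^sup>2 + 2)" "poincare (tball M) T" and T: "0 \<le> T"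
  shows "root_poincare (tball L) [] (4 * T)"
  unfolding root_poincare_def
proof (intro allI impI)
  fix f \<eta> assume f: "sav [] f = (\<lambda>_. 0)"
  define m where "m = L div (4 * k\<^sup>2 + 2)"
  have "(4 * k\<^sup>2 + 2) * m \<le> L" unfolding m_def by (rule times_div_less_eq_dividend)
  then have mL: "4 * k\<^sup>2 * m + 2 * m \<le> L" by (simp add: add_mult_distrib)
  have m1: "1 \<le> m" using L by (simp add: m_def div_greater_zero_iff Suc_le_eq)
  \<comment> \<open>the largest choice for which the uninspected forest has depth at most
    \<open>M = L - m\<close>, the depth of the trees below level \<open>m\<close>\<close>
  define l where "l = L - m + 1"
  have ml: "m \<le> l" "l \<le> L" "L - m = M" "l - 1 = M" using m1 mL M by (auto simp: l_def m_def)
  have lm: "4 * k\<^sup>2 * m \<le> l - m" using mL by (simp add: l_def)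
  have "real m * (1 - (1 - reach_prob k p (l - m)) ^ k) \<le> real m * (real k * (real k / real (Suc (l - m))))"
    by (intro mult_left_mono order_trans[OF child_reach_prob_le mult_left_mono[OF reach_prob_critical[OF crit]]]) auto
  also have "\<dots> = real (k\<^sup>2 * m) / real (Suc (l - m))" by (simp add: power2_eq_square mult_ac)
  also have "\<dots> \<le> 1 / 4"
  proof -
    have "4 * real (k\<^sup>2 * m) \<le> real (Suc (l - m))"
      using lm by (metis le_SucI mult.assoc of_nat_le_iff of_nat_mult of_nat_numeral)
    then show ?thesis by (simp add: field_simps)
  qed
  finally have \<theta>: "real m * (1 - (1 - reach_prob k p (l - m)) ^ k) \<le> 1 / 4" .
  define B where "B = tball L"
  have B: "finite B" by (simp add: B_def finite_tree_ball)
  have le: "av B (\<lambda>\<xi>. \<Sum>y | y \<in> B \<and> P y. constr k B y \<xi> * site_var y f \<xi>) \<eta> \<le> av B (energy B f) \<eta>" for P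
    unfolding energy_def using B
    by (intro av_mono B sum_mono2 mult_nonneg_nonneg constr_nonneg site_var_nonneg) auto
  have s: "sqrt (1 / 4) = 1 / 2" by (simp add: real_sqrt_divide)
  have "(1 - sqrt (1 / 4)) * av B (\<lambda>\<xi>. (f \<xi>)\<^sup>2) \<eta>
    \<le> T * (av B (\<lambda>\<xi>. \<Sum>y | y \<in> B \<and> m \<le> length y. constr k B y \<xi> * site_var y f \<xi>) \<eta>
         + av B (\<lambda>\<xi>. \<Sum>y | y \<in> B \<and> length y < l. constr k B y \<xi> * site_var y f \<xi>) \<eta>)"
    unfolding B_def using crit M ml by (intro two_block m1 \<theta> f T) auto
  also have "\<dots> \<le> T * (av B (energy B f) \<eta> + av B (energy B f) \<eta>)"
    by (intro mult_left_mono T add_mono le)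
  finally show "av (tball L) (\<lambda>\<xi>. (f \<xi>)\<^sup>2) \<eta> \<le> 4 * T * av (tball L) (energy (tball L) f) \<eta>"
    unfolding s B_def by simp
qed

lemma poincare_uniform_below: "\<exists>A\<ge>0. \<forall>L\<le>n. poincare (tball L) A"
  using poincare_tree_ball_ex[of n] poincare_tree_ball_mono by blast

text \<open>By \<open>critical_step\<close> the inequality passes from depth \<open>L -
  m\<close> to depth \<open>L\<close> at the price of a factor 4, where \<open>m\<close> is
  proportional to \<open>L\<close>. The exponent \<open>\<beta>\<close> is chosen such that
  the power absorbs this factor.\<close>

lemma critical_poincare:
  assumes crit: "real k * p = 1"
  shows "\<exists>A \<beta>. 0 \<le> A \<and> (\<forall>L. poincare (tball L) (A * real (Suc L) ^ \<beta>))"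
proof -
  define q where "q = 4 * k\<^sup>2 + 2"
  have q: "2 \<le> q" by (simp add: q_def)
  obtain A where A: "0 \<le> A" "\<And>L. L \<le> q \<Longrightarrow> poincare (tball L) A"
    using poincare_uniform_below by blast
  have "(\<lambda>n. (1 - 1 / (2 * real q)) ^ n) \<longlonglongrightarrow> 0"
    using q by (intro LIMSEQ_realpow_zero) (auto simp: field_simps)
  then have "\<forall>\<^sub>F n in sequentially. (1 - 1 / (2 * real q)) ^ n < 1 / 4"
    by (rule order_tendstoD) simp
  then obtain \<beta> where \<beta>: "(1 - 1 / (2 * real q)) ^ \<beta> < 1 / 4"
    by (auto simp: eventually_sequentially)
  have "poincare (tball L) (A * real (Suc L) ^ \<beta>)" for L
  proof (induction L rule: less_induct)
    case (less L)
    show ?case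
    proof (cases "L < q")
      case True
      have "A * 1 \<le> A * real (Suc L) ^ \<beta>" using A by (intro mult_left_mono one_le_power) auto
      then show ?thesis using A(2)[of L] True by (auto intro: poincare_weaken finite_tree_ball)
    next
      case False
      define m where "m = L div q"
      have m: "1 \<le> m" using False q by (simp add: m_def div_greater_zero_iff Suc_le_eq)
      have "L < q * (m + 1)" using q by (simp add: m_def dividend_less_times_div)
      also have "q * (m + 1) \<le> q * (2 * m)" using m by (intro mult_left_mono) auto
      finally have "L + 1 \<le> 2 * q * m" by (simp add: mult_ac)
      then have "real (L + 1) \<le> real (2 * q * m)" by (simp only: of_nat_le_iff)
      then have mL: "real (Suc L) / (2 * real q) \<le> real m" using q by (simp add: field_simps)
      define M where "M = L - m"
      have "m \<le> L" by (simp add: m_def)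
      then have M: "M < L" "real (Suc M) = real (Suc L) - real m" using m by (auto simp: M_def of_nat_diff)
      have "real (Suc M) \<le> real (Suc L) * (1 - 1 / (2 * real q))"
        using mL M by (simp add: algebra_simps)
      then have "real (Suc M) ^ \<beta> \<le> (real (Suc L) * (1 - 1 / (2 * real q))) ^ \<beta>"
        by (intro power_mono) auto
      also have "\<dots> \<le> real (Suc L) ^ \<beta> * (1 / 4)"
        unfolding power_mult_distrib using \<beta> by (intro mult_left_mono) auto
      finally have dec: "4 * (A * real (Suc M) ^ \<beta>) \<le> A * real (Suc L) ^ \<beta>"
        using mult_left_mono[OF _ A(1), of "4 * real (Suc M) ^ \<beta>" "real (Suc L) ^ \<beta>"] by (simp add: mult_ac)
      have "root_poincare (tball L) [] (4 * (A * real (Suc M) ^ \<beta>))"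
        using less.IH[OF M(1)] False A(1) by (intro critical_step[OF crit]) (auto simp: q_def M_def m_def)
      then have rp: "root_poincare (tball L) [] (A * real (Suc L) ^ \<beta>)"
        using dec by (rule root_poincare_weaken[OF finite_tree_ball])
      obtain n where n: "L = Suc n" using M by (cases L) auto
      have "A * real (Suc n) ^ \<beta> \<le> A * real (Suc L) ^ \<beta>"
        using A n by (intro mult_left_mono power_mono) auto
      then have "poincare (tball n) (A * real (Suc L) ^ \<beta>)"
        using less.IH[of n] n by (auto intro: poincare_weaken finite_tree_ball)
      then show ?thesis
        using rp A(1) unfolding n by (intro poincare_tree_ball_extend) auto
    qed
  qed
  then show ?thesis using A by blast
qed

text \<open>With an overlap of \<open>w\<close> levels, \<open>sqrt \<theta> = 1 /
  w\<^sup>2\<close> is admissible in \<open>two_block\<close>, but the energy of the overlap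
  is counted twice. There is room for \<open>w\<^sup>2\<close> disjoint overlaps. The sum of
  the corresponding inequalities counts the energy \<open>w\<^sup>2 + 1\<close> times instead
  of \<open>2 w\<^sup>2\<close> times, so the constant grows by the factor \<open>(w\<^sup>2 +
  1) / (w\<^sup>2 - 1)\<close>. The constants \<open>((w - 1) / w)\<^sup>2\<close> grow by the
  slightly larger factor \<open>(w\<^sup>2 / (w\<^sup>2 - 1))\<^sup>2\<close> and stay
  bounded.\<close>

lemma subcritical_step:
  assumes sub: "real k * p < 1" and w: "16 \<le> w" "real w ^ 8 * (real k * p) ^ w \<le> 1"
    and pi: "poincare (tball (w ^ 4)) (A * ((real w - 1) / real w)\<^sup>2)" and A: "0 \<le> A"
    and L: "w ^ 4 < L" "L \<le> Suc w ^ 4"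
  shows "root_poincare (tball L) [] (A * (real w / (real w + 1))\<^sup>2)"
  unfolding root_poincare_def
proof (intro allI impI)
  fix f \<eta> assume f: "sav [] f = (\<lambda>_. 0)"
  define T where "T = A * ((real w - 1) / real w)\<^sup>2"
  have T: "0 \<le> T" using A by (simp add: T_def)
  define M where "M = w ^ 4"
  \<comment> \<open>the \<open>i\<close>-th overlap consists of the levels from \<open>m
    i\<close> to \<open>m i + w - 1\<close>; the first one starts at \<open>L - M\<close> so
    that the trees below it have depth at most \<open>M\<close>\<close>
  define m where "m = (\<lambda>i. (L - M) + i * w)"
  define B where "B = tball L"
  have B: "finite B" by (simp add: B_def finite_tree_ball)
  define F where "F = av B (\<lambda>\<xi>. (f \<xi>)\<^sup>2) \<eta>"
  define D where "D = av B (energy B f) \<eta>"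
  define e where "e = (\<lambda>y \<xi>. constr k B y \<xi> * site_var y f \<xi>)"
  have e0: "0 \<le> e y \<xi>" for y \<xi> by (simp add: e_def constr_nonneg site_var_nonneg)
  define J where "J = (\<lambda>i. {y \<in> B. m i \<le> length y \<and> length y < m i + w})"
  have w0: "0 < real w" using w by simp
  have LM: "L - M \<le> 15 * w ^ 3"
  proof -
    have "Suc w ^ 4 = w ^ 4 + (4 * w ^ 3 + 6 * w ^ 2 + 4 * w + 1)"
      by (simp add: eval_nat_numeral algebra_simps)
    moreover have "w ^ 2 \<le> w ^ 3" "w ^ 1 \<le> w ^ 3" "w ^ 0 \<le> w ^ 3"
      using w by (intro power_increasing; simp)+
    ultimately show ?thesis using L unfolding M_def by simp
  qed
  have M16: "16 * w ^ 3 \<le> M"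
  proof -
    have "M = w * w ^ 3" by (simp add: M_def eval_nat_numeral)
    then show ?thesis using w by simp
  qed
  have key: "(1 - 1 / (real w)\<^sup>2) * F \<le> T * (D + av B (\<lambda>\<xi>. \<Sum>y\<in>J i. e y \<xi>) \<eta>)" if i: "i < w\<^sup>2" for i
  proof -
    have "i * w + w \<le> w\<^sup>2 * w"
      using mult_le_mono1[of "Suc i" "w\<^sup>2" w] i by simp
    also have "\<dots> = w ^ 3" by (simp add: eval_nat_numeral)
    finally have iw: "i * w + w \<le> w ^ 3" .
    have ml: "1 \<le> m i" "m i + w \<le> M" "m i + w \<le> L" "L - m i \<le> M"
      using iw LM M16 L by (auto simp: m_def M_def)
    have "real (m i) * (1 - (1 - reach_prob k p (m i + w - m i)) ^ k) \<le> real M * (real k * p) ^ w"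
    proof (intro mult_mono)
      have "1 - (1 - reach_prob k p w) ^ k \<le> real k * ((real k * p) ^ w * p)"
        by (rule order_trans[OF child_reach_prob_le mult_left_mono[OF reach_prob_geometric]]) simp
      also have "\<dots> = (real k * p) * (real k * p) ^ w" by (simp add: mult_ac)
      also have "\<dots> \<le> 1 * (real k * p) ^ w" using sub p0 by (intro mult_right_mono) auto
      finally show "1 - (1 - reach_prob k p (m i + w - m i)) ^ k \<le> (real k * p) ^ w" by simp
    qed (use ml child_reach_prob_bounds in auto)
    also have "\<dots> \<le> (1 / (real w)\<^sup>2)\<^sup>2"
    proof -
      have "real w ^ 8 = real M * (real w)\<^sup>2 * (real w)\<^sup>2" by (simp add: M_def eval_nat_numeral)
      then show ?thesis using w w0 by (simp add: field_simps power2_eq_square)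
    qed
    finally have \<theta>: "real (m i) * (1 - (1 - reach_prob k p (m i + w - m i)) ^ k) \<le> (1 / (real w)\<^sup>2)\<^sup>2" .
    have "(1 - sqrt ((1 / (real w)\<^sup>2)\<^sup>2)) * F
      \<le> T * (av B (\<lambda>\<xi>. \<Sum>y | y \<in> B \<and> m i \<le> length y. constr k B y \<xi> * site_var y f \<xi>) \<eta>
         + av B (\<lambda>\<xi>. \<Sum>y | y \<in> B \<and> length y < m i + w. constr k B y \<xi> * site_var y f \<xi>) \<eta>)"
      unfolding F_def B_def
    proof (intro two_block \<theta> f T ml)
      show "poincare (tball (L - m i)) T" "poincare (tball (m i + w - 1)) T"
        using ml pi T unfolding T_def M_def by (auto intro!: poincare_tree_ball_mono[where n' = "w ^ 4"])
    qed (use sub in auto)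
    also have "av B (\<lambda>\<xi>. \<Sum>y | y \<in> B \<and> m i \<le> length y. constr k B y \<xi> * site_var y f \<xi>) \<eta>
         + av B (\<lambda>\<xi>. \<Sum>y | y \<in> B \<and> length y < m i + w. constr k B y \<xi> * site_var y f \<xi>) \<eta>
       = D + av B (\<lambda>\<xi>. \<Sum>y\<in>J i. e y \<xi>) \<eta>"
    proof -
      have "(\<Sum>y | y \<in> B \<and> m i \<le> length y. e y \<xi>) + (\<Sum>y | y \<in> B \<and> length y < m i + w. e y \<xi>)
          = energy B f \<xi> + (\<Sum>y\<in>J i. e y \<xi>)" for \<xi>
      proof -
        have 1: "{y \<in> B. m i \<le> length y} \<union> {y \<in> B. length y < m i + w} = B" by auto
        have 2: "{y \<in> B. m i \<le> length y} \<inter> {y \<in> B. length y < m i + w} = J i" by (auto simp: J_def)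
        show ?thesis
          using sum.union_inter[of "{y \<in> B. m i \<le> length y}" "{y \<in> B. length y < m i + w}" "\<lambda>y. e y \<xi>"] B
          unfolding 1 2 by (simp add: energy_def e_def)
      qed
      then have "av B (\<lambda>\<xi>. (\<Sum>y | y \<in> B \<and> m i \<le> length y. e y \<xi>) + (\<Sum>y | y \<in> B \<and> length y < m i + w. e y \<xi>)) \<eta>
          = av B (\<lambda>\<xi>. energy B f \<xi> + (\<Sum>y\<in>J i. e y \<xi>)) \<eta>" by simp
      then show ?thesis unfolding av_add[OF B] D_def e_def .
    qed
    finally show ?thesis by simp
  qed
  have "(\<Sum>i<w\<^sup>2. av B (\<lambda>\<xi>. \<Sum>y\<in>J i. e y \<xi>) \<eta>) = av B (\<lambda>\<xi>. \<Sum>i<w\<^sup>2. \<Sum>y\<in>J i. e y \<xi>) \<eta>"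
    by (simp add: av_sum B)
  also have "\<dots> \<le> D"
    unfolding D_def
  proof (rule av_mono[OF B])
    fix \<xi>
    have "J i \<inter> J j = {}" if "i < j" for i j
    proof -
      have "Suc i * w \<le> j * w" using that by (intro mult_le_mono1) simp
      then show ?thesis by (auto simp: J_def m_def)
    qed
    then have disj: "J i \<inter> J j = {}" if "i \<noteq> j" for i j
      using that by (metis Int_commute linorder_neqE_nat)
    have "(\<Sum>i<w\<^sup>2. \<Sum>y\<in>J i. e y \<xi>) = (\<Sum>y\<in>(\<Union>i<w\<^sup>2. J i). e y \<xi>)"
      using disj B by (intro sum.UNION_disjoint[symmetric]) (auto simp: J_def)
    also have "\<dots> \<le> (\<Sum>y\<in>B. e y \<xi>)" using e0 B by (intro sum_mono2) (auto simp: J_def)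
    finally show "(\<Sum>i<w\<^sup>2. \<Sum>y\<in>J i. e y \<xi>) \<le> energy B f \<xi>" by (simp add: energy_def e_def)
  qed
  finally have overlap: "(\<Sum>i<w\<^sup>2. av B (\<lambda>\<xi>. \<Sum>y\<in>J i. e y \<xi>) \<eta>) \<le> D" .
  have "(\<Sum>i<w\<^sup>2. (1 - 1 / (real w)\<^sup>2) * F) \<le> (\<Sum>i<w\<^sup>2. T * (D + av B (\<lambda>\<xi>. \<Sum>y\<in>J i. e y \<xi>) \<eta>))"
    using key by (intro sum_mono) auto
  also have "\<dots> = T * ((real w)\<^sup>2 * D + (\<Sum>i<w\<^sup>2. av B (\<lambda>\<xi>. \<Sum>y\<in>J i. e y \<xi>) \<eta>))"
    by (simp add: sum_distrib_left[symmetric] sum.distrib)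
  also have "\<dots> \<le> T * ((real w)\<^sup>2 * D + D)" by (intro mult_left_mono T add_mono overlap order_refl)
  finally have main: "((real w)\<^sup>2 - 1) * F \<le> T * (((real w)\<^sup>2 + 1) * D)"
    using w0 by (simp add: algebra_simps)
  have D0: "0 \<le> D" unfolding D_def by (rule av_energy_nonneg[OF B])
  have w1: "0 < (real w)\<^sup>2 - 1" using power_strict_mono[of 1 "real w" 2] w by simp
  have "F \<le> A * (real w / (real w + 1))\<^sup>2 * D"
  proof -
    have "T * ((real w)\<^sup>2 + 1) \<le> A * (real w / (real w + 1))\<^sup>2 * ((real w)\<^sup>2 - 1)"
    proof -
      define x where "x = real w"
      have x: "1 < x" using w by (simp add: x_def)
      have "((x - 1) / x)\<^sup>2 * (x\<^sup>2 + 1) \<le> (x / (x + 1))\<^sup>2 * (x\<^sup>2 - 1)"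
      proof -
        have "(x - 1)\<^sup>2 * (x\<^sup>2 + 1) * (x + 1)\<^sup>2 = (x\<^sup>2 - 1) * (x ^ 4 - 1)" by algebra
        also have "\<dots> \<le> (x\<^sup>2 - 1) * x ^ 4" using power_strict_mono[of 1 x 2] x by (intro mult_left_mono) auto
        finally have "(x - 1)\<^sup>2 * (x\<^sup>2 + 1) * (x + 1)\<^sup>2 \<le> (x\<^sup>2 - 1) * x ^ 4" .
        also have "(x\<^sup>2 - 1) * x ^ 4 = x\<^sup>2 * (x\<^sup>2 - 1) * x\<^sup>2" by algebra
        finally have "(x - 1)\<^sup>2 * (x\<^sup>2 + 1) \<le> x\<^sup>2 * (x\<^sup>2 - 1) * x\<^sup>2 / (x + 1)\<^sup>2"
          using x by (subst pos_le_divide_eq) auto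
        also have "\<dots> = x\<^sup>2 * (x\<^sup>2 - 1) / (x + 1)\<^sup>2 * x\<^sup>2" by simp
        finally have "(x - 1)\<^sup>2 * (x\<^sup>2 + 1) / x\<^sup>2 \<le> x\<^sup>2 * (x\<^sup>2 - 1) / (x + 1)\<^sup>2"
          using x by (subst pos_divide_le_eq) auto
        then show ?thesis by (simp add: power_divide)
      qed
      then have "A * (((x - 1) / x)\<^sup>2 * (x\<^sup>2 + 1)) \<le> A * ((x / (x + 1))\<^sup>2 * (x\<^sup>2 - 1))"
        by (rule mult_left_mono[OF _ A])
      then show ?thesis by (simp add: T_def x_def mult.assoc)
    qed
    then have "T * ((real w)\<^sup>2 + 1) * D \<le> A * (real w / (real w + 1))\<^sup>2 * ((real w)\<^sup>2 - 1) * D"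
      by (rule mult_right_mono[OF _ D0])
    then have "((real w)\<^sup>2 - 1) * F \<le> ((real w)\<^sup>2 - 1) * (A * (real w / (real w + 1))\<^sup>2 * D)"
      using main by (simp only: mult_ac) 
    then show ?thesis using w1 by (metis mult_le_cancel_left_pos)
  qed
  then show "av (tball L) (\<lambda>\<xi>. (f \<xi>)\<^sup>2) \<eta> \<le> A * (real w / (real w + 1))\<^sup>2 * av (tball L) (energy (tball L) f) \<eta>"
    by (simp add: F_def D_def B_def)
qed

lemma subcritical_poincare:
  assumes sub: "real k * p < 1"
  shows "\<exists>A\<ge>0. \<forall>L. poincare (tball L) A"
proof -
  have "(\<lambda>w. real w ^ 8 * (real k * p) ^ w) \<longlonglongrightarrow> 0"
  proof -
    define s where "s = root 8 (real k * p)"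
    have "0 \<le> real k * p" using p0 by simp
    then have s: "s ^ 8 = real k * p" "norm s < 1" using sub by (auto simp: s_def)
    have "real w ^ 8 * (real k * p) ^ w = (real w * s ^ w) ^ 8" for w
      unfolding s(1)[symmetric] power_mult_distrib power_mult[symmetric] by (simp only: mult.commute)
    moreover have "(\<lambda>w. (real w * s ^ w) ^ 8) \<longlonglongrightarrow> 0 ^ 8"
      by (intro tendsto_power powser_times_n_limit_0 s(2))
    ultimately show ?thesis by simp
  qed
  then have "\<forall>\<^sub>F w in sequentially. real w ^ 8 * (real k * p) ^ w < 1"
    by (rule order_tendstoD) simp
  then obtain w1 where w1: "\<And>w. w1 \<le> w \<Longrightarrow> real w ^ 8 * (real k * p) ^ w < 1"
    by (auto simp: eventually_sequentially)
  define w0 where "w0 = max w1 16"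
  have w0: "16 \<le> w" "real w ^ 8 * (real k * p) ^ w \<le> 1" if "w0 \<le> w" for w
    using that w1[of w] by (auto simp: w0_def)
  obtain T where T: "0 \<le> T" "poincare (tball (w0 ^ 4)) T" using poincare_tree_ball_ex by blast
  define c where "c = ((real w0 - 1) / real w0)\<^sup>2"
  have c: "0 < c" using w0[of w0] by (simp add: c_def)
  define A where "A = T / c"
  have A: "0 \<le> A" "T = A * c" using T c by (auto simp: A_def)
  have "poincare (tball (w ^ 4)) (A * ((real w - 1) / real w)\<^sup>2)" if "w0 \<le> w" for w
    using that
  proof (induction w rule: dec_induct)
    case base
    then show ?case using T A(2) by (simp add: c_def)
  next
    case (step w)
    have w: "16 \<le> w" "real w ^ 8 * (real k * p) ^ w \<le> 1" using w0 step by auto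
    define T' where "T' = A * (real w / (real w + 1))\<^sup>2"
    have T': "0 \<le> T'" using A by (simp add: T'_def)
    have "(real w - 1) / real w \<le> real w / (real w + 1)"
      using w by (simp add: field_simps)
    then have "A * ((real w - 1) / real w)\<^sup>2 \<le> T'"
      unfolding T'_def using A w by (intro mult_left_mono power_mono) auto
    then have "poincare (tball (w ^ 4)) T'"
      using step by (auto intro: poincare_weaken finite_tree_ball)
    then have "poincare (tball (Suc w ^ 4)) T'"
    proof (rule poincare_tree_ball_grow[OF _ T'])
      show "w ^ 4 \<le> Suc w ^ 4" by (intro power_mono) auto
      fix L assume "w ^ 4 < L" "L \<le> Suc w ^ 4"
      then show "root_poincare (tball L) [] T'"
        unfolding T'_def using step.IH by (intro subcritical_step sub w A)
    qed
    then show ?case by (simp add: T'_def add.commute)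
  qed
  note P = this
  have "poincare (tball L) A" for L
  proof -
    define w where "w = max w0 L"
    have "L \<le> w" by (simp add: w_def)
    also have "w \<le> w ^ 4" by (rule self_le_power) (use w0[of w0] in \<open>auto simp: w_def\<close>)
    finally have L: "L \<le> w ^ 4" .
    have "((real w - 1) / real w)\<^sup>2 \<le> 1\<^sup>2"
      using w0[of w0] by (intro power_mono) (auto simp: w_def)
    then have "A * ((real w - 1) / real w)\<^sup>2 \<le> A" using A by (simp add: mult_left_le)
    then have "poincare (tball (w ^ 4)) A"
      using P[of w] by (auto simp: w_def intro: poincare_weaken finite_tree_ball)
    then show ?thesis by (rule poincare_tree_ball_mono[OF _ L A(1)])
  qed
  then show ?thesis using A by blast
qed

section \<open>The cluster of the root as a test function\<close>

lemma depends_on_energy_closed: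
  assumes f: "depends_on f D" and D: "\<And>y. y \<in> D \<Longrightarrow> children k y \<inter> B \<subseteq> D" and B: "finite B"
  shows "depends_on (energy B f) D"
proof -
  have "energy B f = (\<lambda>\<xi>. \<Sum>y\<in>B \<inter> D. constr k B y \<xi> * site_var y f \<xi>)"
    unfolding energy_def using site_var_0[OF f] B by (intro ext sum.mono_neutral_right) auto
  moreover have "depends_on (\<lambda>\<xi>. \<Sum>y\<in>B \<inter> D. constr k B y \<xi> * site_var y f \<xi>) D"
  proof (intro depends_on_sum depends_on_comp2[where F = "(*)"] depends_on_site_var f)
    fix y assume "y \<in> B \<inter> D"
    then show "depends_on (constr k B y) D"
      using D[of y] by (intro depends_on_mono[OF depends_on_constr]) auto
  qed
  ultimately show ?thesis by simp
qed

text \<open>Variances of independent variables add up.\<close>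

lemma av_square_sum_indep:
  assumes A: "finite A" and I: "finite I" and G: "\<And>i. i \<in> I \<Longrightarrow> depends_on (G i) (D i)"
    and disj: "\<And>i j. i \<in> I \<Longrightarrow> j \<in> I \<Longrightarrow> i \<noteq> j \<Longrightarrow> D i \<inter> D j = {}"
    and m: "\<And>i. i \<in> I \<Longrightarrow> av A (G i) \<eta> = m"
    and v: "\<And>i. i \<in> I \<Longrightarrow> av A (\<lambda>\<xi>. (G i \<xi>)\<^sup>2) \<eta> = v + m\<^sup>2"
  shows "av A (\<lambda>\<xi>. (a + (\<Sum>i\<in>I. G i \<xi>))\<^sup>2) \<eta> = (a + real (card I) * m)\<^sup>2 + real (card I) * v"
  using I G disj m v
proof (induction I arbitrary: a rule: finite_induct)
  case empty
  then show ?case by (simp add: av_const A)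
next
  case (insert i I)
  define S where "S = (\<lambda>\<xi>. a + (\<Sum>j\<in>I. G j \<xi>))"
  have dS: "depends_on S (\<Union>j\<in>I. D j)"
    unfolding S_def
    by (rule depends_on_comp[where F = "\<lambda>x. a + x"], rule depends_on_sum, rule depends_on_mono[OF insert.prems(1)]) auto
  have "D i \<inter> D j = {}" if "j \<in> I" for j
    using insert.prems(2)[of i j] insert.hyps that by auto
  then have disj: "(\<Union>j\<in>I. D j) \<inter> D i = {}" by blast
  have avS: "av A S \<eta> = a + real (card I) * m"
    using insert.prems(3) by (simp add: S_def av_add av_const av_sum A)
  have S2: "av A (\<lambda>\<xi>. (S \<xi>)\<^sup>2) \<eta> = (a + real (card I) * m)\<^sup>2 + real (card I) * v"
    unfolding S_def using insert.prems by (intro insert.IH) auto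
  have "av A (\<lambda>\<xi>. S \<xi> * G i \<xi>) \<eta> = av A S \<eta> * av A (G i) \<eta>"
    using insert.prems(1) by (intro av_indep[OF A dS _ disj]) auto
  then have SG: "av A (\<lambda>\<xi>. S \<xi> * G i \<xi>) \<eta> = (a + real (card I) * m) * m"
    using avS insert.prems(3) by simp
  have "(\<lambda>\<xi>. (a + (\<Sum>j\<in>insert i I. G j \<xi>))\<^sup>2) = (\<lambda>\<xi>. (S \<xi>)\<^sup>2 + (2 * (S \<xi> * G i \<xi>) + (G i \<xi>)\<^sup>2))"
    using insert.hyps by (auto simp: S_def fun_eq_iff power2_eq_square algebra_simps)
  then have "av A (\<lambda>\<xi>. (a + (\<Sum>j\<in>insert i I. G j \<xi>))\<^sup>2) \<eta>
     = (a + real (card I) * m)\<^sup>2 + real (card I) * v + (2 * ((a + real (card I) * m) * m) + (v + m\<^sup>2))"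
    using insert.prems(4) by (simp add: av_add av_cmult A S2 SG)
  also have "\<dots> = (a + real (card (insert i I)) * m)\<^sup>2 + real (card (insert i I)) * v"
    using insert.hyps by (simp add: power2_eq_square algebra_simps)
  finally show ?case .
qed

text \<open>The number of vertices, at most \<open>j\<close> levels below \<open>x\<close>,
  that are joined to \<open>x\<close> by an occupied path.\<close>

primrec cluster :: "nat \<Rightarrow> vertex \<Rightarrow> config \<Rightarrow> real" where
  "cluster 0 x \<eta> = of_bool (\<eta> x)"
| "cluster (Suc j) x \<eta> = of_bool (\<eta> x) * (1 + (\<Sum>i<k. cluster j (x @ [i]) \<eta>))"

lemma subtree_Suc:
  "i < k \<Longrightarrow> (@) (x @ [i]) ` tball j \<subseteq> (@) x ` tball (Suc j)"
  "x \<in> (@) x ` tball j"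
  "x \<notin> (@) (x @ [i]) ` tball j"
proof -
  show "(@) (x @ [i]) ` tball j \<subseteq> (@) x ` tball (Suc j)" if "i < k"
  proof
    fix y assume "y \<in> (@) (x @ [i]) ` tball j"
    then obtain w where "y = x @ (i # w)" "w \<in> tball j" by auto
    then show "y \<in> (@) x ` tball (Suc j)" using that by (auto simp: tree_ball_def tree_def)
  qed
  have "x @ [] \<in> (@) x ` tball j" by (rule imageI) (rule Nil_in_tree_ball)
  then show "x \<in> (@) x ` tball j" by simp
qed auto

lemma subtree_closed:
  assumes "length c + j = n" "y \<in> (@) c ` tball j"
  shows "children k y \<inter> tball n \<subseteq> (@) c ` tball j"
proof
  fix z assume z: "z \<in> children k y \<inter> tball n"
  then obtain w i where "y = c @ w" "w \<in> tball j" "i < k" "z = c @ (w @ [i])"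
    using assms(2) by (auto simp: children_def)
  then show "z \<in> (@) c ` tball j"
    using z assms(1) by (auto simp: tree_ball_def tree_def)
qed

lemma subtree_disjoint: "i \<noteq> j \<Longrightarrow> (@) (x @ [i]) ` A \<inter> (@) (x @ [j]) ` A = {}"
  by auto

lemma depends_on_cluster: "depends_on (cluster j x) ((@) x ` tball j)"
proof (induction j arbitrary: x)
  case 0
  show ?case unfolding cluster.simps(1) by (rule depends_on_coord) (rule subtree_Suc)
next
  case (Suc j)
  have "depends_on (\<lambda>\<eta>. \<Sum>i<k. cluster j (x @ [i]) \<eta>) ((@) x ` tball (Suc j))"
    using subtree_Suc(1) by (intro depends_on_sum depends_on_mono[OF Suc.IH]) auto
  moreover have "depends_on (\<lambda>\<eta>. \<eta> x) ((@) x ` tball (Suc j))"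
    by (rule depends_onI) (use subtree_Suc(2) in auto)
  ultimately show ?case
    unfolding cluster.simps
    by (rule depends_on_comp2[where F = "\<lambda>b s. of_bool b * (1 + s)", rotated])
qed

text \<open>The cluster of \<open>x\<close> is the spin at \<open>x\<close> times 1 plus the
  independent clusters of the children. For \<open>k p = 1\<close> the variances of the child
  clusters add up to the same variance, with the square of the conditional mean \<open>j +
  2\<close> coming on top.\<close>

lemma cluster_moments:
  assumes crit: "real k * p = 1" and x: "x \<in> tree k" "length x + j \<le> n"
  shows "av (tball n) (cluster j x) \<eta> = p * real (Suc j)"
    and "av (tball n) (\<lambda>\<xi>. (cluster j x \<xi>)\<^sup>2) \<eta>
       = p * (1 - p) * (\<Sum>i\<le>j. (real (Suc i))\<^sup>2) + (p * real (Suc j))\<^sup>2"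
proof -
  define B where "B = tball n"
  have B: "finite B" by (simp add: B_def finite_tree_ball)
  have "av B (cluster j x) \<eta> = p * real (Suc j) \<and> av B (\<lambda>\<xi>. (cluster j x \<xi>)\<^sup>2) \<eta>
       = p * (1 - p) * (\<Sum>i\<le>j. (real (Suc i))\<^sup>2) + (p * real (Suc j))\<^sup>2"
    using x
  proof (induction j arbitrary: x)
    case 0
    then have xB: "x \<in> B" by (simp add: B_def tree_ball_def)
    have "cluster 0 x = (\<lambda>\<eta>. of_bool (\<eta> x))" "(\<lambda>\<xi>. (cluster 0 x \<xi>)\<^sup>2) = (\<lambda>\<eta>. of_bool (\<eta> x))"
      by (auto simp: fun_eq_iff)
    then show ?case using av_coord[OF B xB, of \<eta>] by (simp add: power2_eq_square algebra_simps)
  next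
    case (Suc j)
    then have xB: "x \<in> B" by (simp add: B_def tree_ball_def)
    define S where "S = (\<lambda>\<eta>. 1 + (\<Sum>i<k. cluster j (x @ [i]) \<eta>))"
    define v where "v = p * (1 - p) * (\<Sum>i\<le>j. (real (Suc i))\<^sup>2)"
    have IH: "av B (cluster j (x @ [i])) \<eta> = p * real (Suc j)"
      "av B (\<lambda>\<xi>. (cluster j (x @ [i]) \<xi>)\<^sup>2) \<eta> = v + (p * real (Suc j))\<^sup>2" if "i < k" for i
      using Suc.IH[of "x @ [i]"] Suc.prems that by (auto simp: tree_snoc v_def)
    have S1: "av B S \<eta> = real (j + 2)"
    proof -
      have "av B S \<eta> = 1 + (real k * p) * real (Suc j)"
        using IH(1) by (simp add: S_def av_add av_const av_sum B)
      then show ?thesis by (simp add: crit)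
    qed
    have S2: "av B (\<lambda>\<xi>. (S \<xi>)\<^sup>2) \<eta> = (real (j + 2))\<^sup>2 + real k * v"
    proof -
      have "av B (\<lambda>\<xi>. (S \<xi>)\<^sup>2) \<eta> = (1 + real (card {..<k}) * (p * real (Suc j)))\<^sup>2 + real (card {..<k}) * v"
        unfolding S_def using IH
        by (intro av_square_sum_indep[OF B, where D = "\<lambda>i. (@) (x @ [i]) ` tball j"]
            depends_on_cluster subtree_disjoint) auto
      also have "1 + real (card {..<k}) * (p * real (Suc j)) = real (j + 2)"
        using crit by (simp add: mult.assoc[symmetric])
      finally show ?thesis by simp
    qed
    have dS: "depends_on S (\<Union>i<k. (@) (x @ [i]) ` tball j)"
      unfolding S_def
      by (rule depends_on_comp[where F = "\<lambda>s. 1 + s"], rule depends_on_sum, rule depends_on_mono[OF depends_on_cluster]) auto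
    have x: "x \<notin> (\<Union>i<k. (@) (x @ [i]) ` tball j)" by auto
    have c: "cluster (Suc j) x = (\<lambda>\<eta>. of_bool (\<eta> x) * S \<eta>)" "(\<lambda>\<xi>. (cluster (Suc j) x \<xi>)\<^sup>2) = (\<lambda>\<eta>. of_bool (\<eta> x) * (S \<eta>)\<^sup>2)"
      by (auto simp: fun_eq_iff S_def)
    have "av B (cluster (Suc j) x) \<eta> = p * real (j + 2)"
      unfolding c(1) using av_edge[OF B dS x, of \<eta>] S1 xB by simp
    moreover have "av B (\<lambda>\<xi>. (cluster (Suc j) x \<xi>)\<^sup>2) \<eta> = p * ((real (j + 2))\<^sup>2 + real k * v)"
      unfolding c(2) using av_edge[OF B depends_on_comp[OF dS, where F = "\<lambda>s. s\<^sup>2"] x, of \<eta>] S2 xB by simp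
    moreover have "p * ((real (j + 2))\<^sup>2 + real k * v) = p * (real (j + 2))\<^sup>2 + (real k * p) * v"
      by (simp add: algebra_simps)
    moreover have "\<dots> = p * (1 - p) * (\<Sum>i\<le>Suc j. (real (Suc i))\<^sup>2) + (p * real (Suc (Suc j)))\<^sup>2"
      unfolding crit v_def by (simp add: power2_eq_square algebra_simps)
    moreover have "real (j + 2) = real (Suc (Suc j))" by simp
    ultimately show ?case by (simp only: simp_thms)
  qed
  then show "av (tball n) (cluster j x) \<eta> = p * real (Suc j)"
    "av (tball n) (\<lambda>\<xi>. (cluster j x \<xi>)\<^sup>2) \<eta>
       = p * (1 - p) * (\<Sum>i\<le>j. (real (Suc i))\<^sup>2) + (p * real (Suc j))\<^sup>2"
    by (auto simp: B_def)
qed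

lemma cluster_vacant: "\<not> \<eta> x \<Longrightarrow> cluster j x \<eta> = 0"
  by (cases j) auto

text \<open>The spin at \<open>x\<close> may flip only if the children are empty, and then the
  cluster changes by 1. A flip at any other vertex changes the cluster of at most one child,
  and it matters only if \<open>x\<close> is occupied.\<close>

lemma cluster_energy_Suc:
  assumes x: "length x + Suc j = n" and xB: "x \<in> tball n"
  shows "energy (tball n) (cluster (Suc j) x) \<eta>
    \<le> p * (1 - p) + (\<Sum>i<k. of_bool (\<eta> x) * energy (tball n) (cluster j (x @ [i])) \<eta>)"
proof -
  define B where "B = tball n"
  have B: "finite B" "x \<in> B" using xB by (auto simp: B_def finite_tree_ball)
  let ?F = "\<lambda>i. cluster j (x @ [i])"
  have xF: "grad x (?F i) \<xi> = 0" for i \<xi>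
    by (rule grad_0[OF depends_on_cluster]) (rule subtree_Suc)
  have "energy B (cluster (Suc j) x) \<eta> = constr k B x \<eta> * site_var x (cluster (Suc j) x) \<eta>
      + (\<Sum>y\<in>B - {x}. constr k B y \<eta> * site_var y (cluster (Suc j) x) \<eta>)"
    unfolding energy_def by (rule sum.remove[OF B])
  also have "constr k B x \<eta> * site_var x (cluster (Suc j) x) \<eta> \<le> p * (1 - p)"
  proof (cases "\<forall>y\<in>children k x \<inter> B. \<not> \<eta> y")
    case True
    have "?F i (\<eta>(x := b)) = 0" if "i < k" for i b
    proof -
      have "x @ [i] \<in> children k x" "x @ [i] \<in> B"
        using that x xB by (auto simp: children_def B_def tree_ball_def tree_def)
      then have "\<not> (\<eta>(x := b)) (x @ [i])" using True by auto
      then show ?thesis by (rule cluster_vacant)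
    qed
    then have "grad x (cluster (Suc j) x) \<eta> = 1" by (simp add: grad_def)
    then show ?thesis using p0 p1 by (simp add: site_var_def constr_def)
  next
    case False
    then have "constr k B x \<eta> = 0" by (auto simp: constr_def)
    then show ?thesis using p0 p1 by simp
  qed
  also have "(\<Sum>y\<in>B - {x}. constr k B y \<eta> * site_var y (cluster (Suc j) x) \<eta>)
      = (\<Sum>y\<in>B - {x}. \<Sum>i<k. of_bool (\<eta> x) * (constr k B y \<eta> * site_var y (?F i) \<eta>))"
  proof (rule sum.cong[OF refl])
    fix y assume y: "y \<in> B - {x}"
    have g: "grad y (cluster (Suc j) x) \<eta> = of_bool (\<eta> x) * (\<Sum>i<k. grad y (?F i) \<eta>)"
      using y by (auto simp: grad_def sum_subtractf)
    have z: "grad y (?F i) \<eta> * grad y (?F i') \<eta> = 0" if "i \<noteq> i'" for i i'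
    proof -
      have "y \<notin> (@) (x @ [i]) ` tball j \<or> y \<notin> (@) (x @ [i']) ` tball j"
        using subtree_disjoint[OF that] by blast
      then show ?thesis using grad_0[OF depends_on_cluster] by auto
    qed
    have "(\<Sum>i<k. grad y (?F i) \<eta>)\<^sup>2 = (\<Sum>i<k. \<Sum>i'<k. grad y (?F i) \<eta> * grad y (?F i') \<eta>)"
      by (simp add: power2_eq_square sum_product)
    also have "\<dots> = (\<Sum>i<k. \<Sum>i'<k. if i = i' then (grad y (?F i) \<eta>)\<^sup>2 else 0)"
      using z by (intro sum.cong refl) (auto simp: power2_eq_square)
    also have "\<dots> = (\<Sum>i<k. (grad y (?F i) \<eta>)\<^sup>2)" by simp
    finally have "(grad y (cluster (Suc j) x) \<eta>)\<^sup>2 = of_bool (\<eta> x) * (\<Sum>i<k. (grad y (?F i) \<eta>)\<^sup>2)"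
      unfolding g by (auto simp: power_mult_distrib)
    then show "constr k B y \<eta> * site_var y (cluster (Suc j) x) \<eta>
        = (\<Sum>i<k. of_bool (\<eta> x) * (constr k B y \<eta> * site_var y (?F i) \<eta>))"
      unfolding site_var_def by (simp only: sum_distrib_left mult_ac)
  qed
  also have "\<dots> \<le> (\<Sum>y\<in>B. \<Sum>i<k. of_bool (\<eta> x) * (constr k B y \<eta> * site_var y (?F i) \<eta>))"
    using B by (intro sum_mono2) (auto intro!: sum_nonneg mult_nonneg_nonneg constr_nonneg site_var_nonneg)
  also have "\<dots> = (\<Sum>i<k. of_bool (\<eta> x) * energy B (?F i) \<eta>)"
    unfolding energy_def by (subst sum.swap) (simp only: sum_distrib_left)
  finally show ?thesis unfolding B_def by (simp del: cluster.simps)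
qed

lemma cluster_energy:
  assumes crit: "real k * p = 1" and x: "x \<in> tree k" "length x + j = n"
  shows "av (tball n) (energy (tball n) (cluster j x)) \<eta> \<le> p * (1 - p) * real (Suc j)"
proof -
  define B where "B = tball n"
  have B: "finite B" by (simp add: B_def finite_tree_ball)
  have "av B (energy B (cluster j x)) \<eta> \<le> p * (1 - p) * real (Suc j)"
    using x
  proof (induction j arbitrary: x)
    case 0
    then have xB: "x \<in> B" by (simp add: B_def tree_ball_def)
    have d: "depends_on (cluster 0 x) {x}" unfolding cluster.simps(1) by (rule depends_on_coord) simp
    have "energy B (cluster 0 x) \<xi> \<le> p * (1 - p)" for \<xi>
    proof -
      have "energy B (cluster 0 x) \<xi> = constr k B x \<xi> * site_var x (cluster 0 x) \<xi>"
        unfolding energy_def using site_var_0[OF d] by (subst sum.remove[OF B xB]) (auto intro!: sum.neutral)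
      also have "\<dots> \<le> 1 * site_var x (cluster 0 x) \<xi>" by (intro mult_right_mono constr_le_1 site_var_nonneg)
      finally show ?thesis by (simp add: site_var_def grad_def)
    qed
    then have "av B (energy B (cluster 0 x)) \<eta> \<le> av B (\<lambda>_. p * (1 - p)) \<eta>"
      by (intro av_mono B)
    then show ?case by (simp del: cluster.simps add: av_const B)
  next
    case (Suc j)
    then have xB: "x \<in> B" by (simp add: B_def tree_ball_def)
    have "av B (energy B (cluster (Suc j) x)) \<eta>
       \<le> av B (\<lambda>\<xi>. p * (1 - p) + (\<Sum>i<k. of_bool (\<xi> x) * energy B (cluster j (x @ [i])) \<xi>)) \<eta>"
      unfolding B_def using Suc.prems xB by (intro av_mono finite_tree_ball cluster_energy_Suc) (auto simp: B_def)
    also have "\<dots> = p * (1 - p) + (\<Sum>i<k. av B (\<lambda>\<xi>. of_bool (\<xi> x) * energy B (cluster j (x @ [i])) \<xi>) \<eta>)"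
      by (simp only: av_add[OF B] av_const[OF B] av_sum[OF B])
    also have "\<dots> = p * (1 - p) + (\<Sum>i<k. p * av B (energy B (cluster j (x @ [i]))) \<eta>)"
    proof -
      have "av B (\<lambda>\<xi>. of_bool (\<xi> x) * energy B (cluster j (x @ [i])) \<xi>) \<eta> = p * av B (energy B (cluster j (x @ [i]))) \<eta>" for i
      proof -
        have "depends_on (energy B (cluster j (x @ [i]))) ((@) (x @ [i]) ` tball j)"
          using Suc.prems unfolding B_def
          by (intro depends_on_energy_closed[OF depends_on_cluster _ finite_tree_ball] subtree_closed) simp_all
        from av_edge[OF B this, of x \<eta>] xB show ?thesis using subtree_Suc(3)[of x i j] by simp
      qed
      then show ?thesis by simp
    qed
    also have "\<dots> \<le> p * (1 - p) + (\<Sum>i<k. p * (p * (1 - p) * real (Suc j)))"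
      using Suc.prems p0 by (intro add_left_mono sum_mono mult_left_mono Suc.IH) (auto simp: tree_snoc)
    also have "\<dots> = p * (1 - p) + (real k * p) * (p * (1 - p) * real (Suc j))" by simp
    also have "\<dots> = p * (1 - p) * real (Suc (Suc j))" unfolding crit by (simp add: algebra_simps)
    finally show ?case .
  qed
  then show ?thesis by (simp add: B_def)
qed

text \<open>The variance of the cluster of the root is of order \<open>n ^ 3\<close> while its
  energy is of order \<open>n\<close>.\<close>

lemma critical_poincare_lower:
  assumes crit: "real k * p = 1" and pi: "poincare (tball n) T"
  shows "(real (Suc n))\<^sup>2 / 3 \<le> T"
proof -
  define B where "B = tball n"
  have Nil: "[] \<in> tree k" "length ([] :: vertex) + n = n" by (auto simp: tree_def)
  have T: "0 \<le> T" using poincare_ge_1[OF finite_tree_ball Nil_in_tree_ball pi] by simp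
  have cube: "(real (Suc n)) ^ 3 / 3 \<le> (\<Sum>i\<le>n. (real (Suc i))\<^sup>2)"
  proof (induction n)
    case (Suc n)
    have "(a + 1) ^ 3 \<le> a ^ 3 + 3 * (a + 1)\<^sup>2" if "0 \<le> a" for a :: real
      using that by (simp add: eval_nat_numeral algebra_simps)
    from this[of "real (Suc n)"]
    have "(real (Suc (Suc n))) ^ 3 \<le> (real (Suc n)) ^ 3 + 3 * (real (Suc (Suc n)))\<^sup>2"
      by (simp add: add.commute)
    then have "(real (Suc (Suc n))) ^ 3 / 3 \<le> (real (Suc n)) ^ 3 / 3 + (real (Suc (Suc n)))\<^sup>2"
      by linarith
    moreover have "(\<Sum>i\<le>Suc n. (real (Suc i))\<^sup>2) = (\<Sum>i\<le>n. (real (Suc i))\<^sup>2) + (real (Suc (Suc n)))\<^sup>2"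
      by (rule sum.atMost_Suc)
    ultimately show ?case using Suc by linarith
  qed simp
  have pq: "0 < p * (1 - p)" using p0 p1 by simp
  have "p * (1 - p) * (\<Sum>i\<le>n. (real (Suc i))\<^sup>2) \<le> T * av B (energy B (cluster n [])) vacant"
    using poincareD[OF pi, of "cluster n []" vacant] Nil
    by (simp add: cluster_moments[OF crit] B_def)
  also have "\<dots> \<le> T * (p * (1 - p) * real (Suc n))"
    unfolding B_def using cluster_energy[OF crit Nil] by (intro mult_left_mono T)
  finally have "p * (1 - p) * (\<Sum>i\<le>n. (real (Suc i))\<^sup>2) \<le> p * (1 - p) * (T * real (Suc n))"
    by (simp only: mult_ac)
  then have "(\<Sum>i\<le>n. (real (Suc i))\<^sup>2) \<le> T * real (Suc n)" using pq by (metis mult_le_cancel_left_pos)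
  then have "real (Suc n) * ((real (Suc n))\<^sup>2 / 3) \<le> real (Suc n) * T"
  proof -
    have "real (Suc n) * ((real (Suc n))\<^sup>2 / 3) = (real (Suc n)) ^ 3 / 3"
      by (simp only: power3_eq_cube power2_eq_square times_divide_eq_right mult.assoc)
    also have "\<dots> \<le> T * real (Suc n)" using cube \<open>(\<Sum>i\<le>n. (real (Suc i))\<^sup>2) \<le> T * real (Suc n)\<close> by (rule order_trans)
    finally show ?thesis by (simp only: mult.commute)
  qed
  then show ?thesis by (simp only: mult_le_cancel_left_pos of_nat_0_less_iff zero_less_Suc)
qed

end

section \<open>The semigroup\<close>

text \<open>Exponential generating functions. At a fixed configuration the semigroup is the
  one of the sequence of powers of the generator, so that identities between coefficients
  become identities of the semigroup.\<close>

definition egf :: "(nat \<Rightarrow> real) \<Rightarrow> real \<Rightarrow> real" where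
  "egf a t = (\<Sum>n. t ^ n / fact n * a n)"

definition exp_bounded :: "(nat \<Rightarrow> real) \<Rightarrow> bool" where
  "exp_bounded a \<longleftrightarrow> (\<exists>M C. \<forall>n. \<bar>a n\<bar> \<le> M * C ^ n)"

lemma exp_bounded_summable_norm:
  assumes "exp_bounded a" shows "summable (\<lambda>n. norm (t ^ n / fact n * a n))"
proof -
  obtain M C where b: "\<And>n. \<bar>a n\<bar> \<le> M * C ^ n" using assms by (auto simp: exp_bounded_def)
  have "summable (\<lambda>n. M * (inverse (fact n) * (\<bar>t\<bar> * C) ^ n))"
    by (intro summable_mult summable_exp)
  then show ?thesis
  proof (rule summable_comparison_test'[where N = 0])
    fix n
    have "norm (norm (t ^ n / fact n * a n)) = \<bar>t\<bar> ^ n / fact n * \<bar>a n\<bar>"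
      by (simp add: abs_mult power_abs)
    also have "\<dots> \<le> \<bar>t\<bar> ^ n / fact n * (M * C ^ n)" by (intro mult_left_mono b) auto
    finally show "norm (norm (t ^ n / fact n * a n)) \<le> M * (inverse (fact n) * (\<bar>t\<bar> * C) ^ n)"
      by (simp add: field_simps power_mult_distrib)
  qed
qed

lemma exp_bounded_summable: "exp_bounded a \<Longrightarrow> summable (\<lambda>n. t ^ n / fact n * a n)"
  by (rule summable_norm_cancel[OF exp_bounded_summable_norm])

lemma egf_0: "egf a 0 = a 0"
  unfolding egf_def by (subst suminf_finite[of "{0}"]) auto

lemma egf_add: "exp_bounded a \<Longrightarrow> exp_bounded b \<Longrightarrow> egf (\<lambda>n. a n + b n) t = egf a t + egf b t"
  unfolding egf_def distrib_left
  by (rule suminf_add[symmetric]; rule exp_bounded_summable)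

lemma egf_cmult: "exp_bounded a \<Longrightarrow> egf (\<lambda>n. c * a n) t = c * egf a t"
  unfolding egf_def mult.left_commute[of _ c] by (rule suminf_mult) (rule exp_bounded_summable)

lemma exp_bounded_cmult: "exp_bounded a \<Longrightarrow> exp_bounded (\<lambda>n. c * a n)"
proof -
  assume "exp_bounded a"
  then obtain M C where b: "\<And>n. \<bar>a n\<bar> \<le> M * C ^ n" by (auto simp: exp_bounded_def)
  have "\<bar>c * a n\<bar> \<le> (\<bar>c\<bar> * M) * C ^ n" for n
    using mult_left_mono[OF b[of n], of "\<bar>c\<bar>"] by (simp add: abs_mult mult.assoc)
  then show ?thesis unfolding exp_bounded_def by blast
qed

lemma exp_bounded_add: "exp_bounded a \<Longrightarrow> exp_bounded b \<Longrightarrow> exp_bounded (\<lambda>n. a n + b n)"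
proof -
  assume "exp_bounded a" "exp_bounded b"
  then obtain M C M' C' where b: "\<And>n. \<bar>a n\<bar> \<le> M * C ^ n" "\<And>n. \<bar>b n\<bar> \<le> M' * C' ^ n"
    unfolding exp_bounded_def by metis
  have "\<bar>a n + b n\<bar> \<le> (\<bar>M\<bar> + \<bar>M'\<bar>) * (max \<bar>C\<bar> \<bar>C'\<bar>) ^ n" for n
  proof -
    have le: "x * y ^ n \<le> \<bar>x\<bar> * \<bar>y\<bar> ^ n" for x y :: real
      using abs_ge_self[of "x * y ^ n"] by (simp add: abs_mult power_abs)
    have "\<bar>a n\<bar> \<le> \<bar>M\<bar> * \<bar>C\<bar> ^ n" "\<bar>b n\<bar> \<le> \<bar>M'\<bar> * \<bar>C'\<bar> ^ n"
      using b[of n] le[of M C] le[of M' C'] by linarith+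
    moreover have "\<bar>M\<bar> * \<bar>C\<bar> ^ n \<le> \<bar>M\<bar> * (max \<bar>C\<bar> \<bar>C'\<bar>) ^ n" "\<bar>M'\<bar> * \<bar>C'\<bar> ^ n \<le> \<bar>M'\<bar> * (max \<bar>C\<bar> \<bar>C'\<bar>) ^ n"
      by (intro mult_left_mono power_mono; simp)+
    ultimately show ?thesis unfolding distrib_right using abs_triangle_ineq[of "a n" "b n"] by linarith
  qed
  then show ?thesis unfolding exp_bounded_def by blast
qed

lemma egf_sum:
  assumes "\<And>i. i \<in> I \<Longrightarrow> exp_bounded (a i)"
  shows "egf (\<lambda>n. \<Sum>i\<in>I. a i n) t = (\<Sum>i\<in>I. egf (a i) t)"
  unfolding egf_def sum_distrib_left
  by (rule suminf_sum) (use assms exp_bounded_summable in blast)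

lemma egf_deriv:
  assumes "exp_bounded a"
  shows "(egf a has_real_derivative egf (\<lambda>n. a (Suc n)) t) (at t)"
proof -
  have eq: "t ^ n / fact n * a m = a m / fact n * t ^ n" for t n m by simp
  have "summable (\<lambda>n. a n / fact n * y ^ n)" for y
    using exp_bounded_summable[OF assms, of y] unfolding eq .
  from termdiffs_strong_converges_everywhere[OF this, of t]
  have "((\<lambda>x. \<Sum>n. a n / fact n * x ^ n) has_real_derivative (\<Sum>n. diffs (\<lambda>n. a n / fact n) n * t ^ n)) (at t)" .
  moreover have "diffs (\<lambda>n. a n / fact n) n * t ^ n = a (Suc n) / fact n * t ^ n" for n
    by (simp add: diffs_def field_simps del: of_nat_Suc)
  ultimately show ?thesis unfolding egf_def[abs_def] eq by (simp only:)
qed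

lemma egf_mult:
  assumes a: "exp_bounded a" and b: "exp_bounded b"
  shows "egf (\<lambda>n. \<Sum>i\<le>n. real (n choose i) * (a i * b (n - i))) t = egf a t * egf b t"
proof -
  have "egf a t * egf b t = (\<Sum>n. \<Sum>i\<le>n. (t ^ i / fact i * a i) * (t ^ (n - i) / fact (n - i) * b (n - i)))"
    unfolding egf_def by (rule Cauchy_product) (intro exp_bounded_summable_norm a b)+
  also have "(\<lambda>n. \<Sum>i\<le>n. (t ^ i / fact i * a i) * (t ^ (n - i) / fact (n - i) * b (n - i)))
     = (\<lambda>n. t ^ n / fact n * (\<Sum>i\<le>n. real (n choose i) * (a i * b (n - i))))"
  proof
    fix n
    show "(\<Sum>i\<le>n. (t ^ i / fact i * a i) * (t ^ (n - i) / fact (n - i) * b (n - i)))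
        = t ^ n / fact n * (\<Sum>i\<le>n. real (n choose i) * (a i * b (n - i)))"
      unfolding sum_distrib_left
    proof (rule sum.cong[OF refl])
      fix i assume "i \<in> {..n}"
      then have i: "i \<le> n" by simp
      have "t ^ n = t ^ i * t ^ (n - i)" using i by (simp add: power_add[symmetric])
      moreover have "real (n choose i) = fact n / (fact i * fact (n - i))" using i by (rule binomial_fact)
      ultimately show "(t ^ i / fact i * a i) * (t ^ (n - i) / fact (n - i) * b (n - i))
          = t ^ n / fact n * (real (n choose i) * (a i * b (n - i)))"
        by simp
    qed
  qed
  finally show ?thesis by (simp add: egf_def)
qed

lemma egf_power: "egf (\<lambda>n. c ^ n) t = exp (t * c)"
  by (simp add: egf_def exp_def power_mult_distrib divide_inverse mult_ac)

lemma exp_bounded_power: "exp_bounded (\<lambda>n. c ^ n)"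
  unfolding exp_bounded_def by (rule exI[of _ 1], rule exI[of _ "\<bar>c\<bar>"]) (simp add: power_abs)

text \<open>The binomial formula for an operator that acts on the family \<open>w\<close> like
  a derivation on products.\<close>

lemma funpow_leibniz:
  fixes G :: "('a \<Rightarrow> real) \<Rightarrow> 'a \<Rightarrow> real"
  assumes lin: "\<And>(n::nat) c f. G (\<lambda>\<xi>. \<Sum>i\<le>n. c i * f i \<xi>) = (\<lambda>\<xi>. \<Sum>i\<le>n. c i * G (f i) \<xi>)"
    and w: "\<And>i j. G (w i j) = (\<lambda>\<xi>. w (Suc i) j \<xi> + w i (Suc j) \<xi>)"
  shows "(G ^^ n) (w 0 0) = (\<lambda>\<xi>. \<Sum>i\<le>n. real (n choose i) * w i (n - i) \<xi>)"
proof (induction n)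
  case 0
  show ?case by simp
next
  case (Suc n)
  have "(G ^^ Suc n) (w 0 0) = (\<lambda>\<xi>. \<Sum>i\<le>n. real (n choose i) * (w (Suc i) (n - i) \<xi> + w i (Suc (n - i)) \<xi>))"
    by (simp add: Suc lin w)
  also have "\<dots> = (\<lambda>\<xi>. \<Sum>i\<le>Suc n. real (Suc n choose i) * w i (Suc n - i) \<xi>)"
  proof
    fix \<xi>
    have 1: "(\<Sum>i\<le>n. real (n choose i) * w i (Suc (n - i)) \<xi>)
        = w 0 (Suc n) \<xi> + (\<Sum>i<n. real (n choose Suc i) * w (Suc i) (n - i) \<xi>)"
    proof -
      have "(\<Sum>i\<le>n. real (n choose i) * w i (Suc (n - i)) \<xi>)
          = real (n choose 0) * w 0 (Suc (n - 0)) \<xi> + (\<Sum>i<n. real (n choose Suc i) * w (Suc i) (Suc (n - Suc i)) \<xi>)"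
        by (rule sum.atMost_shift)
      moreover have "(\<Sum>i<n. real (n choose Suc i) * w (Suc i) (Suc (n - Suc i)) \<xi>)
          = (\<Sum>i<n. real (n choose Suc i) * w (Suc i) (n - i) \<xi>)"
        by (intro sum.cong refl) (simp add: Suc_diff_Suc)
      ultimately show ?thesis by simp
    qed
    have 2: "(\<Sum>i\<le>n. real (n choose Suc i) * w (Suc i) (n - i) \<xi>) = (\<Sum>i<n. real (n choose Suc i) * w (Suc i) (n - i) \<xi>)"
      by (simp add: lessThan_Suc_atMost[symmetric])
    have "(\<Sum>i\<le>Suc n. real (Suc n choose i) * w i (Suc n - i) \<xi>)
        = w 0 (Suc n) \<xi> + (\<Sum>i\<le>n. real (Suc n choose Suc i) * w (Suc i) (n - i) \<xi>)"
      by (subst sum.atMost_Suc_shift) simp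
    also have "\<dots> = w 0 (Suc n) \<xi> + ((\<Sum>i\<le>n. real (n choose i) * w (Suc i) (n - i) \<xi>)
        + (\<Sum>i\<le>n. real (n choose Suc i) * w (Suc i) (n - i) \<xi>))"
      by (simp add: distrib_right sum.distrib)
    finally show "(\<Sum>i\<le>n. real (n choose i) * (w (Suc i) (n - i) \<xi> + w i (Suc (n - i)) \<xi>))
        = (\<Sum>i\<le>Suc n. real (Suc n choose i) * w i (Suc n - i) \<xi>)"
      by (simp only: distrib_left sum.distrib 1 2)
  qed
  finally show ?case .
qed

context ofa
begin

lemma semigroup_egf: "sg V t f \<eta> = egf (\<lambda>n. (gen V ^^ n) f \<eta>) t"
  by (simp add: semigroup_def egf_def)

lemma generator_eq: "gen V f \<xi>
   = (\<Sum>y\<in>V. constr k V y \<xi> * (p * f (\<xi>(y := True)) + (1 - p) * f (\<xi>(y := False)) - f \<xi>))"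
  by (simp add: generator_def sav_eq)

lemma generator_lin:
  "gen V (\<lambda>\<xi>. \<Sum>i\<in>I. c i * f i \<xi>) = (\<lambda>\<xi>. \<Sum>i\<in>I. c i * gen V (f i) \<xi>)"
proof
  fix \<xi>
  have "gen V (\<lambda>\<xi>. \<Sum>i\<in>I. c i * f i \<xi>) \<xi>
     = (\<Sum>y\<in>V. \<Sum>i\<in>I. c i * (constr k V y \<xi> * (p * f i (\<xi>(y := True)) + (1 - p) * f i (\<xi>(y := False)) - f i \<xi>)))"
    unfolding generator_eq
    by (intro sum.cong refl) (simp add: sum_distrib_left sum_subtractf[symmetric] sum.distrib[symmetric] algebra_simps)
  also have "\<dots> = (\<Sum>i\<in>I. c i * gen V (f i) \<xi>)"
    unfolding generator_eq sum_distrib_left by (rule sum.swap)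
  finally show "gen V (\<lambda>\<xi>. \<Sum>i\<in>I. c i * f i \<xi>) \<xi> = (\<Sum>i\<in>I. c i * gen V (f i) \<xi>)" .
qed

text \<open>Changing coordinates in \<open>V\<close> leads from \<open>\<eta>\<close> to
  finitely many configurations only, and on these the generator is a bounded operator.\<close>

lemma generator_pow_bounded:
  assumes V: "finite V" shows "exp_bounded (\<lambda>n. (gen V ^^ n) f \<eta>)"
proof -
  define R where "R = {\<xi>. \<forall>x. x \<notin> V \<longrightarrow> \<xi> x = \<eta> x}"
  have "R \<subseteq> (\<lambda>S x. if x \<in> V then x \<in> S else \<eta> x) ` Pow V"
  proof
    fix \<xi> assume "\<xi> \<in> R"
    then have "\<xi> = (\<lambda>x. if x \<in> V then x \<in> {x \<in> V. \<xi> x} else \<eta> x)" by (auto simp: R_def fun_eq_iff)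
    then show "\<xi> \<in> (\<lambda>S x. if x \<in> V then x \<in> S else \<eta> x) ` Pow V" by blast
  qed
  then have R: "finite R" by (rule finite_subset) (simp add: V)
  define M where "M = Max ((\<lambda>\<xi>. \<bar>f \<xi>\<bar>) ` R)"
  define C where "C = 2 * real (card V)"
  have "\<bar>(gen V ^^ n) f \<xi>\<bar> \<le> M * C ^ n" if "\<xi> \<in> R" for n \<xi>
    using that
  proof (induction n arbitrary: \<xi>)
    case 0
    then show ?case unfolding M_def using R by (auto intro: Max_ge)
  next
    case (Suc n)
    define g where "g = (gen V ^^ n) f"
    define b where "b = M * C ^ n"
    have g: "\<bar>g \<zeta>\<bar> \<le> b" if "\<zeta> \<in> R" for \<zeta> using Suc.IH[OF that] by (simp add: g_def b_def)
    have b0: "0 \<le> b" using g[OF Suc.prems] by linarith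
    have "\<bar>constr k V y \<xi> * (p * g (\<xi>(y := True)) + (1 - p) * g (\<xi>(y := False)) - g \<xi>)\<bar> \<le> 2 * b" if y: "y \<in> V" for y
    proof -
      have "\<xi>(y := c) \<in> R" for c using Suc.prems y by (auto simp: R_def)
      then have "\<bar>g (\<xi>(y := True))\<bar> \<le> b" "\<bar>g (\<xi>(y := False))\<bar> \<le> b" by (auto intro: g)
      then have "\<bar>p * g (\<xi>(y := True))\<bar> \<le> p * b" "\<bar>(1 - p) * g (\<xi>(y := False))\<bar> \<le> (1 - p) * b"
        using p0 p1 by (auto simp: abs_mult)
      then have "\<bar>p * g (\<xi>(y := True)) + (1 - p) * g (\<xi>(y := False)) - g \<xi>\<bar> \<le> 2 * b"
        using g[OF Suc.prems] by (simp add: algebra_simps)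
      then show ?thesis using b0 by (auto simp: constr_def)
    qed
    then have "\<bar>gen V g \<xi>\<bar> \<le> (\<Sum>y\<in>V. 2 * b)"
      unfolding generator_eq by (intro order_trans[OF sum_abs] sum_mono)
    then show ?case by (simp add: g_def b_def C_def mult_ac)
  qed
  moreover have "\<eta> \<in> R" by (simp add: R_def)
  ultimately show ?thesis unfolding exp_bounded_def by blast
qed

lemma semigroup_0: "sg V 0 f = f"
  by (simp add: fun_eq_iff semigroup_egf egf_0)

lemma semigroup_sum_cmult:
  assumes V: "finite V"
  shows "sg V t (\<lambda>\<xi>. \<Sum>i\<in>I. c i * f i \<xi>) = (\<lambda>\<xi>. \<Sum>i\<in>I. c i * sg V t (f i) \<xi>)"
proof
  fix \<xi>
  have pow: "(gen V ^^ n) (\<lambda>\<xi>. \<Sum>i\<in>I. c i * f i \<xi>) = (\<lambda>\<xi>. \<Sum>i\<in>I. c i * (gen V ^^ n) (f i) \<xi>)" for n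
    by (induction n) (simp_all add: generator_lin)
  show "sg V t (\<lambda>\<xi>. \<Sum>i\<in>I. c i * f i \<xi>) \<xi> = (\<Sum>i\<in>I. c i * sg V t (f i) \<xi>)"
    unfolding semigroup_egf pow
    by (simp add: egf_sum egf_cmult exp_bounded_cmult generator_pow_bounded V)
qed

lemma semigroup_lin2:
  assumes V: "finite V"
  shows "sg V t (\<lambda>\<xi>. a * f \<xi> + b * g \<xi>) = (\<lambda>\<xi>. a * sg V t f \<xi> + b * sg V t g \<xi>)"
  using semigroup_sum_cmult[OF V, where t = t and I = "{0, 1::nat}" and c = "\<lambda>i. if i = 0 then a else b"
      and f = "\<lambda>i. if i = 0 then f else g"]
  by simp

lemma generator_pow_const: "(gen V ^^ Suc n) (\<lambda>_. c) = (\<lambda>_. 0)"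
proof (induction n)
  case 0
  have "p * c + (1 - p) * c - c = 0" by (simp add: algebra_simps)
  then show ?case by (simp add: fun_eq_iff generator_eq)
next
  case (Suc n)
  then show ?case by (simp add: fun_eq_iff generator_eq)
qed

lemma semigroup_const: "sg V t (\<lambda>_. c) = (\<lambda>_. c)"
proof
  fix \<xi>
  have "(\<lambda>n. t ^ n / fact n * (gen V ^^ n) (\<lambda>_. c) \<xi>) = (\<lambda>n. if n = 0 then c else 0)"
  proof
    fix n
    show "t ^ n / fact n * (gen V ^^ n) (\<lambda>_. c) \<xi> = (if n = 0 then c else 0)"
      by (cases n) (simp_all only: generator_pow_const, simp_all)
  qed
  then show "sg V t (\<lambda>_. c) \<xi> = c"
    unfolding semigroup_def by (simp only:) (subst suminf_finite[of "{0}"], auto)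
qed

lemma semigroup_eigen:
  assumes "\<And>\<xi>. gen V f \<xi> = l * f \<xi>"
  shows "sg V t f \<xi> = exp (l * t) * f \<xi>"
proof -
  have g: "gen V (\<lambda>\<xi>. c * f \<xi>) = (\<lambda>\<xi>. c * (l * f \<xi>))" for c
    using generator_lin[of V "\<lambda>_. c" "\<lambda>_. f" "{()}"] by (simp add: assms fun_eq_iff)
  have "(gen V ^^ n) f = (\<lambda>\<xi>. f \<xi> * l ^ n)" for n
  proof (induction n)
    case (Suc n)
    then show ?case using g[of "l ^ n"] by (simp add: mult_ac)
  qed simp
  then have "sg V t f \<xi> = f \<xi> * egf (\<lambda>n. l ^ n) t"
    unfolding semigroup_egf by (simp add: egf_cmult exp_bounded_power)
  then show ?thesis by (simp add: egf_power mult_ac)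
qed

lemma semigroup_deriv:
  assumes V: "finite V"
  shows "((\<lambda>t. sg V t f \<xi>) has_real_derivative gen V (sg V t f) \<xi>) (at t)"
proof -
  note b = generator_pow_bounded[OF V]
  have "egf (\<lambda>n. (gen V ^^ Suc n) f \<xi>) t = gen V (sg V t f) \<xi>"
  proof -
    define s where "s = (\<lambda>\<zeta> n. (gen V ^^ n) f \<zeta>)"
    have bs: "exp_bounded (s \<zeta>)" for \<zeta> unfolding s_def by (rule b)
    have e: "egf (s \<zeta>) t = sg V t f \<zeta>" for \<zeta> by (simp add: s_def semigroup_egf)
    have "(\<lambda>n. (gen V ^^ Suc n) f \<xi>) = (\<lambda>n. \<Sum>y\<in>V. constr k V y \<xi> * (p * s (\<xi>(y := True)) n + ((1 - p) * s (\<xi>(y := False)) n + (-1) * s \<xi> n)))"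
      by (simp add: generator_eq s_def algebra_simps)
    then have "egf (\<lambda>n. (gen V ^^ Suc n) f \<xi>) t
       = (\<Sum>y\<in>V. constr k V y \<xi> * (p * egf (s (\<xi>(y := True))) t + ((1 - p) * egf (s (\<xi>(y := False))) t + (-1) * egf (s \<xi>) t)))"
      by (simp only: egf_sum egf_cmult egf_add exp_bounded_cmult exp_bounded_add bs)
    also have "\<dots> = gen V (sg V t f) \<xi>"
      unfolding e generator_eq by (intro sum.cong refl) (simp add: algebra_simps)
    finally show ?thesis .
  qed
  then show ?thesis
    using egf_deriv[OF b, of f \<xi> t] unfolding semigroup_egf[abs_def] by simp
qed

lemma av_deriv:
  assumes "finite A" "\<And>\<xi>. ((\<lambda>t. F t \<xi>) has_real_derivative F' \<xi>) (at t)"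
  shows "((\<lambda>t. av A (F t) \<eta>) has_real_derivative av A F' \<eta>) (at t)"
  using assms
proof (induction A arbitrary: \<eta> rule: finite_induct)
  case (insert x A)
  show ?case unfolding av_insert[OF insert.hyps] sav_eq
    by (intro DERIV_add DERIV_cmult insert.IH insert.prems)
qed simp

lemma av_semigroup:
  assumes V: "finite V"
  shows "av V (sg V t f) \<eta> = av V f \<eta>"
proof -
  have "((\<lambda>t. av V (sg V t f) \<eta>) has_real_derivative 0) (at t)" for t
  proof -
    have "av V (gen V (sg V t f)) \<eta> = 0"
      using av_generator[OF V, of "\<lambda>_. 1" "sg V t f" \<eta>]
      by (simp add: dirichlet_def grad_def av_const V cong: sum.cong) (simp add: dirichlet_def[abs_def] grad_def av_const V)
    moreover have "((\<lambda>t. av V (sg V t f) \<eta>) has_real_derivative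
        av V (gen V (sg V t f)) \<eta>) (at t)"
      by (rule av_deriv[OF V semigroup_deriv[OF V]])
    ultimately show ?thesis by simp
  qed
  then have "av V (sg V t f) \<eta> = av V (sg V 0 f) \<eta>"
    by (intro DERIV_isconst_all) auto
  then show ?thesis by (simp add: semigroup_0)
qed

text \<open>The second moment \<open>v\<close> has derivative minus twice the energy, which is
  at most \<open>- 2 v / T\<close>.\<close>

lemma semigroup_L2_decay:
  assumes V: "finite V" and pi: "poincare V T" and T: "0 < T" and f: "av V f \<eta> = 0" and st: "s \<le> t"
  shows "av V (\<lambda>\<xi>. (sg V t f \<xi>)\<^sup>2) \<eta>
    \<le> exp (- 2 * (t - s) / T) * av V (\<lambda>\<xi>. (sg V s f \<xi>)\<^sup>2) \<eta>"
proof -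
  define v where "v = (\<lambda>t. av V (\<lambda>\<xi>. (sg V t f \<xi>)\<^sup>2) \<eta>)"
  define e where "e = (\<lambda>t. av V (energy V (sg V t f)) \<eta>)"
  have dv: "(v has_real_derivative - 2 * e t) (at t)" for t
  proof -
    have "((\<lambda>t. (sg V t f \<xi>)\<^sup>2) has_real_derivative
        2 * (sg V t f \<xi> * gen V (sg V t f) \<xi>)) (at t)" for \<xi>
      using DERIV_power[OF semigroup_deriv[OF V, of f \<xi> t], where n = 2] by (simp add: mult_ac)
    from av_deriv[OF V this]
    have "(v has_real_derivative av V (\<lambda>\<xi>. 2 * (sg V t f \<xi> * gen V (sg V t f) \<xi>)) \<eta>) (at t)"
      unfolding v_def .
    then show ?thesis by (simp add: av_cmult V av_generator dirichlet_self e_def)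
  qed
  define \<phi> where "\<phi> = (\<lambda>t. exp (2 * t / T) * v t)"
  have d\<phi>: "(\<phi> has_real_derivative exp (2 * u / T) * (2 / T * v u - 2 * e u)) (at u)" for u
    unfolding \<phi>_def using dv[of u] T
    by (auto intro!: derivative_eq_intros simp: algebra_simps)
  have neg: "exp (2 * u / T) * (2 / T * v u - 2 * e u) \<le> 0" for u
  proof -
    have "v u \<le> T * e u"
      using poincareD[OF pi, of "sg V u f" \<eta>] by (simp add: v_def e_def av_semigroup V f)
    then show ?thesis using T by (intro mult_nonneg_nonpos) (auto simp: field_simps)
  qed
  have "\<phi> t \<le> \<phi> s"
    by (rule DERIV_nonpos_imp_nonincreasing[OF st], rule exI, rule conjI, rule d\<phi>, rule neg)
  then have "exp (2 * t / T) * v t \<le> exp (2 * s / T) * v s" by (simp add: \<phi>_def)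
  then have "v t \<le> exp (2 * s / T) / exp (2 * t / T) * v s" by (simp add: field_simps)
  also have "exp (2 * s / T) / exp (2 * t / T) = exp (- 2 * (t - s) / T)"
  proof -
    have "2 * s / T - 2 * t / T = - 2 * (t - s) / T"
      unfolding diff_divide_distrib[symmetric] by (simp add: algebra_simps)
    then show ?thesis by (simp only: exp_diff[symmetric])
  qed
  finally show ?thesis by (simp add: v_def)
qed

text \<open>The operator \<open>K = L + card V\<close>, with \<open>L\<close> the generator,
  has nonnegative coefficients, and \<open>exp (t K)\<close> is \<open>exp (t card V)\<close>
  times \<open>exp (t L)\<close>.\<close>

lemma semigroup_nonneg:
  assumes V: "finite V" and t: "0 \<le> t" and f: "\<And>\<xi>. 0 \<le> f \<xi>"
  shows "0 \<le> sg V t f \<xi>"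
proof -
  define K where "K = (\<lambda>g \<xi>. gen V g \<xi> + real (card V) * g \<xi>)"
  have Keq: "K g \<xi> = (\<Sum>y\<in>V. constr k V y \<xi> * (p * g (\<xi>(y := True)) + (1 - p) * g (\<xi>(y := False))) + (1 - constr k V y \<xi>) * g \<xi>)" for g \<xi>
  proof -
    have "real (card V) * g \<xi> = (\<Sum>y\<in>V. g \<xi>)" by simp
    then show ?thesis unfolding K_def generator_eq
      by (simp only: sum.distrib[symmetric]) (intro sum.cong refl, simp add: algebra_simps)
  qed
  have Kpos: "0 \<le> (K ^^ n) f \<xi>" for n \<xi>
  proof (induction n arbitrary: \<xi>)
    case (Suc n)
    then show ?case
      using p0 p1 constr_nonneg constr_le_1
      by (auto simp: Keq intro!: sum_nonneg add_nonneg_nonneg mult_nonneg_nonneg)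
  qed (simp add: f)
  define w where "w = (\<lambda>i j \<xi>. (gen V ^^ i) f \<xi> * real (card V) ^ j)"
  have Kw: "(K ^^ n) (w 0 0) = (\<lambda>\<xi>. \<Sum>i\<le>n. real (n choose i) * w i (n - i) \<xi>)" for n
  proof (rule funpow_leibniz)
    show "K (\<lambda>\<xi>. \<Sum>i\<le>n. c i * f i \<xi>) = (\<lambda>\<xi>. \<Sum>i\<le>n. c i * K (f i) \<xi>)" for n c f
      unfolding K_def generator_lin by (simp add: fun_eq_iff sum.distrib sum_distrib_left algebra_simps)
    fix i j
    have "gen V (w i j) = (\<lambda>\<xi>. real (card V) ^ j * (gen V ^^ Suc i) f \<xi>)"
      using generator_lin[of V "\<lambda>_. real (card V) ^ j" "\<lambda>_. (gen V ^^ i) f" "{()}"]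
      by (simp add: w_def mult.commute)
    then show "K (w i j) = (\<lambda>\<xi>. w (Suc i) j \<xi> + w i (Suc j) \<xi>)"
      by (simp add: K_def fun_eq_iff w_def mult_ac)
  qed
  have "w 0 0 = f" by (simp add: w_def)
  then have Kpow: "(K ^^ n) f = (\<lambda>\<xi>. \<Sum>i\<le>n. real (n choose i) * w i (n - i) \<xi>)" for n
    using Kw[of n] by simp
  then have "egf (\<lambda>n. (K ^^ n) f \<xi>) t = egf (\<lambda>n. \<Sum>i\<le>n. real (n choose i) * ((gen V ^^ i) f \<xi> * real (card V) ^ (n - i))) t"
    by (simp add: w_def)
  also have "\<dots> = sg V t f \<xi> * exp (t * real (card V))"
    using egf_mult[OF generator_pow_bounded[OF V, of f \<xi>] exp_bounded_power, of "real (card V)" t]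
    by (simp add: egf_power semigroup_egf)
  finally have e: "sg V t f \<xi> * exp (t * real (card V)) = egf (\<lambda>n. (K ^^ n) f \<xi>) t" by simp
  have "summable (\<lambda>n. t ^ n / fact n * (K ^^ n) f \<xi>)"
  proof -
    have Kn: "(K ^^ n) f \<xi> = (\<Sum>i\<le>n. real (n choose i) * ((gen V ^^ i) f \<xi> * real (card V) ^ (n - i)))" for n
      using Kpow[of n] by (simp add: w_def)
    obtain M C where b: "\<And>n. \<bar>(gen V ^^ n) f \<xi>\<bar> \<le> M * C ^ n"
      using generator_pow_bounded[OF V, of f \<xi>] by (auto simp: exp_bounded_def)
    have "\<bar>(K ^^ n) f \<xi>\<bar> \<le> M * (C + real (card V)) ^ n" for n
    proof -
      have "\<bar>(K ^^ n) f \<xi>\<bar> \<le> (\<Sum>i\<le>n. real (n choose i) * ((M * C ^ i) * real (card V) ^ (n - i)))"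
        unfolding Kn
      proof (intro order_trans[OF sum_abs] sum_mono)
        fix i
        have "\<bar>real (n choose i) * ((gen V ^^ i) f \<xi> * real (card V) ^ (n - i))\<bar>
            = real (n choose i) * (\<bar>(gen V ^^ i) f \<xi>\<bar> * real (card V) ^ (n - i))"
          by (simp add: abs_mult)
        also have "\<dots> \<le> real (n choose i) * ((M * C ^ i) * real (card V) ^ (n - i))"
          by (intro mult_left_mono mult_right_mono b) auto
        finally show "\<bar>real (n choose i) * ((gen V ^^ i) f \<xi> * real (card V) ^ (n - i))\<bar>
            \<le> real (n choose i) * ((M * C ^ i) * real (card V) ^ (n - i))" .
      qed
      also have "\<dots> = M * (C + real (card V)) ^ n"
        by (simp add: binomial_ring sum_distrib_left mult_ac)
      finally show ?thesis .
    qed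
    then have "exp_bounded (\<lambda>n. (K ^^ n) f \<xi>)" unfolding exp_bounded_def by blast
    then show ?thesis by (rule exp_bounded_summable)
  qed
  then have "0 \<le> egf (\<lambda>n. (K ^^ n) f \<xi>) t"
    unfolding egf_def using Kpos t by (intro suminf_nonneg) auto
  then show ?thesis unfolding e[symmetric] by (simp add: zero_le_mult_iff)
qed

lemma semigroup_abs_le:
  assumes V: "finite V" and t: "0 \<le> t" and f: "\<And>\<xi>. \<bar>f \<xi>\<bar> \<le> M"
  shows "\<bar>sg V t f \<xi>\<bar> \<le> M"
proof -
  have "0 \<le> sg V t (\<lambda>\<xi>. 1 * M + c * f \<xi>) \<xi>" if "c = 1 \<or> c = -1" for c
  proof (intro semigroup_nonneg V t)
    fix \<xi>
    show "0 \<le> 1 * M + c * f \<xi>" using that f[of \<xi>] by auto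
  qed
  moreover have "sg V t (\<lambda>\<xi>. 1 * M + c * f \<xi>) \<xi> = M + c * sg V t f \<xi>" for c
    using semigroup_lin2[OF V, of t 1 "\<lambda>_. M" c f] by (simp add: semigroup_const)
  ultimately have "0 \<le> M + 1 * sg V t f \<xi>" "0 \<le> M + (-1) * sg V t f \<xi>" by metis+
  then show ?thesis by (simp add: abs_le_iff)
qed

text \<open>Such a set evolves autonomously: the constraints of its vertices do not look
  outside.\<close>

definition closed_in :: "vertex set \<Rightarrow> vertex set \<Rightarrow> bool" where
  "closed_in V D \<longleftrightarrow> (\<forall>y\<in>D. children k y \<inter> V \<subseteq> D)"

lemma depends_on_generator_closed:
  assumes D: "closed_in V D" and f: "depends_on f D"
  shows "depends_on (gen V f) D"
proof -
  have "gen V f \<xi> = (\<Sum>y\<in>V. if y \<in> D then constr k V y \<xi> * (sav y f \<xi> - f \<xi>) else 0)" for \<xi>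
    unfolding generator_def by (intro sum.cong refl) (auto simp: sav_dep[OF f])
  moreover have "depends_on (\<lambda>\<xi>. \<Sum>y\<in>V. if y \<in> D then constr k V y \<xi> * (sav y f \<xi> - f \<xi>) else 0) D"
  proof (rule depends_on_sum)
    fix y
    show "depends_on (\<lambda>\<xi>. if y \<in> D then constr k V y \<xi> * (sav y f \<xi> - f \<xi>) else 0) D"
    proof (cases "y \<in> D")
      case True
      then have "depends_on (constr k V y) D"
        using D by (intro depends_on_mono[OF depends_on_constr]) (auto simp: closed_in_def)
      moreover have "depends_on (sav y f) D"
        by (intro depends_on_sav depends_on_mono[OF f]) auto
      ultimately show ?thesis
        using True f by (auto intro!: depends_on_comp2[where F = "(*)"] depends_on_comp2[where F = "(-)"])
    qed (simp add: depends_on_const)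
  qed
  ultimately show ?thesis by (simp add: depends_on_def)
qed

lemma depends_on_generator_pow:
  "closed_in V D \<Longrightarrow> depends_on f D \<Longrightarrow> depends_on ((gen V ^^ n) f) D"
  by (induction n) (auto intro: depends_on_generator_closed)

lemma depends_on_semigroup:
  assumes "closed_in V D" "depends_on f D" shows "depends_on (sg V t f) D"
proof (rule depends_onI)
  fix \<eta> \<xi> :: config assume "\<And>x. x \<in> D \<Longrightarrow> \<eta> x = \<xi> x"
  then have "(gen V ^^ n) f \<eta> = (gen V ^^ n) f \<xi>" for n
    by (rule depends_onD[OF depends_on_generator_pow[OF assms]])
  then show "sg V t f \<eta> = sg V t f \<xi>" by (simp add: semigroup_def)
qed

lemma generator_product:
  assumes f: "depends_on f D" and g: "depends_on g D'" and disj: "D \<inter> D' = {}"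
  shows "gen V (\<lambda>\<xi>. f \<xi> * g \<xi>) \<xi> = gen V f \<xi> * g \<xi> + f \<xi> * gen V g \<xi>"
proof -
  have "constr k V y \<xi> * (sav y (\<lambda>\<xi>. f \<xi> * g \<xi>) \<xi> - f \<xi> * g \<xi>)
     = constr k V y \<xi> * (sav y f \<xi> - f \<xi>) * g \<xi> + f \<xi> * (constr k V y \<xi> * (sav y g \<xi> - g \<xi>))" for y
  proof (cases "y \<in> D")
    case True
    then have "y \<notin> D'" using disj by auto
    then show ?thesis by (simp add: sav_eq depends_on_upd[OF g] algebra_simps)
  next
    case False
    then show ?thesis by (simp add: sav_eq depends_on_upd[OF f] algebra_simps)
  qed
  then show ?thesis by (simp add: generator_def sum.distrib sum_distrib_left sum_distrib_right)
qed

text \<open>On products of functions of disjoint sets the generator acts as a derivation, so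
  the two sets evolve independently.\<close>

lemma semigroup_product:
  assumes V: "finite V" and D: "closed_in V D" "closed_in V D'" "D \<inter> D' = {}"
    and f: "depends_on f D" and g: "depends_on g D'"
  shows "sg V t (\<lambda>\<xi>. f \<xi> * g \<xi>) = (\<lambda>\<xi>. sg V t f \<xi> * sg V t g \<xi>)"
proof
  fix \<xi>
  define w where "w = (\<lambda>i j \<xi>. (gen V ^^ i) f \<xi> * (gen V ^^ j) g \<xi>)"
  have "(gen V ^^ n) (w 0 0) = (\<lambda>\<xi>. \<Sum>i\<le>n. real (n choose i) * w i (n - i) \<xi>)" for n
  proof (rule funpow_leibniz)
    fix i j
    show "gen V (w i j) = (\<lambda>\<xi>. w (Suc i) j \<xi> + w i (Suc j) \<xi>)"
      unfolding w_def
      using generator_product[OF depends_on_generator_pow[OF D(1) f] depends_on_generator_pow[OF D(2) g] D(3)]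
      by (simp add: fun_eq_iff)
  qed (rule generator_lin)
  moreover have "w 0 0 = (\<lambda>\<xi>. f \<xi> * g \<xi>)" by (simp add: w_def)
  ultimately show "sg V t (\<lambda>\<xi>. f \<xi> * g \<xi>) \<xi> = sg V t f \<xi> * sg V t g \<xi>"
    unfolding semigroup_egf w_def
    by (simp add: egf_mult[OF generator_pow_bounded[OF V] generator_pow_bounded[OF V], of f \<xi> g \<xi> t])
qed

lemma semigroup_prod:
  assumes V: "finite V" and I: "finite I"
    and D: "\<And>i. i \<in> I \<Longrightarrow> closed_in V (D i)" "\<And>i. i \<in> I \<Longrightarrow> depends_on (f i) (D i)"
    "\<And>i j. i \<in> I \<Longrightarrow> j \<in> I \<Longrightarrow> i \<noteq> j \<Longrightarrow> D i \<inter> D j = {}"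
  shows "sg V t (\<lambda>\<xi>. \<Prod>i\<in>I. f i \<xi>) = (\<lambda>\<xi>. \<Prod>i\<in>I. sg V t (f i) \<xi>)"
  using I D
proof (induction I rule: finite_induct)
  case empty
  then show ?case by (simp add: semigroup_const)
next
  case (insert i I)
  have "depends_on (\<lambda>\<xi>. \<Prod>j\<in>I. f j \<xi>) (\<Union>j\<in>I. D j)"
    by (intro depends_on_prod depends_on_mono[OF insert.prems(2)]) auto
  moreover have "closed_in V (\<Union>j\<in>I. D j)" using insert.prems(1) by (fastforce simp: closed_in_def)
  moreover have "D i \<inter> D j = {}" if "j \<in> I" for j
    using insert.prems(3)[of i j] insert.hyps that by auto
  then have "D i \<inter> (\<Union>j\<in>I. D j) = {}" by blast
  ultimately have "sg V t (\<lambda>\<xi>. f i \<xi> * (\<Prod>j\<in>I. f j \<xi>))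
      = (\<lambda>\<xi>. sg V t (f i) \<xi> * sg V t (\<lambda>\<xi>. \<Prod>j\<in>I. f j \<xi>) \<xi>)"
    using insert.prems by (intro semigroup_product[OF V]) auto
  moreover have "sg V t (\<lambda>\<xi>. \<Prod>j\<in>I. f j \<xi>) = (\<lambda>\<xi>. \<Prod>j\<in>I. sg V t (f j) \<xi>)"
    using insert.prems by (intro insert.IH) auto
  ultimately show ?case using insert.hyps by simp
qed

text \<open>No constraint in \<open>D\<close> depends on the spin at \<open>x\<close>, so
  averaging over it commutes with the generator on functions of \<open>D\<close>.\<close>

lemma semigroup_sav:
  assumes V: "finite V" and D: "closed_in V D" "\<And>y. y \<in> D \<Longrightarrow> x \<notin> children k y" and f: "depends_on f D"
  shows "sg V t (sav x f) = sav x (sg V t f)"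
proof -
  have gen: "gen V (sav x g) = sav x (gen V g)" if g: "depends_on g D" for g
  proof
    fix \<xi>
    have sg: "depends_on (sav x g) D" by (intro depends_on_sav depends_on_mono[OF g]) auto
    have sum_sav: "sav x (\<lambda>\<xi>. \<Sum>i\<in>I. F i \<xi>) \<xi> = (\<Sum>i\<in>I. sav x (F i) \<xi>)" for I and F :: "vertex \<Rightarrow> config \<Rightarrow> real"
      using av_sum[of "{x}" F I] by (simp add: av_single)
    have "constr k V y \<xi> * (sav y (sav x g) \<xi> - sav x g \<xi>) = sav x (\<lambda>\<xi>. constr k V y \<xi> * (sav y g \<xi> - g \<xi>)) \<xi>" for y
    proof (cases "y \<in> D")
      case True
      then have "constr k V y (\<xi>(x := b)) = constr k V y \<xi>" for b
        using D(2)[OF True] by (intro depends_on_upd[OF depends_on_constr]) auto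
      then have "sav x (\<lambda>\<xi>. constr k V y \<xi> * (sav y g \<xi> - g \<xi>)) \<xi> = constr k V y \<xi> * sav x (\<lambda>\<xi>. sav y g \<xi> - g \<xi>) \<xi>"
        by (rule sav_pull)
      then show ?thesis by (simp add: sav_diff sav_commute[of x y])
    next
      case False
      then have "sav y g = g" "sav y (sav x g) = sav x g"
        using sav_dep[OF g] sav_dep[OF sg] by (auto simp: fun_eq_iff)
      then show ?thesis by (simp add: sav_eq)
    qed
    then show "gen V (sav x g) \<xi> = sav x (gen V g) \<xi>"
      unfolding generator_def sum_sav by simp
  qed
  have pow: "(gen V ^^ n) (sav x f) = sav x ((gen V ^^ n) f)" for n
    by (induction n) (simp_all add: gen depends_on_generator_pow[OF D(1) f])
  show ?thesis
  proof
    fix \<xi>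
    show "sg V t (sav x f) \<xi> = sav x (sg V t f) \<xi>"
      unfolding semigroup_egf pow unfolding sav_eq semigroup_egf
      by (simp only: egf_add egf_cmult exp_bounded_cmult generator_pow_bounded V)
  qed
qed

end

section \<open>Second moment of the density and mixing from above\<close>

context ofa
begin

text \<open>The density, with respect to the Bernoulli measure on \<open>U\<close>, of the
  point mass at the restriction of \<open>\<eta>\<close> to \<open>U\<close>.\<close>

definition point_dens :: "config \<Rightarrow> vertex set \<Rightarrow> config \<Rightarrow> real" where
  "point_dens \<eta> U \<xi> = (\<Prod>y\<in>U. of_bool (\<xi> y = \<eta> y) / (if \<eta> y then p else 1 - p))"

lemma point_dens_nonneg: "0 \<le> point_dens \<eta> U \<xi>"
  unfolding point_dens_def using p0 p1 by (intro prod_nonneg) auto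

lemma depends_on_point_dens: "depends_on (point_dens \<eta> U) U"
  unfolding point_dens_def[abs_def]
  by (rule depends_on_prod)
     (rule depends_on_coord[where F = "\<lambda>b. of_bool (b = \<eta> y) / (if \<eta> y then p else 1 - p)" for y])

lemma sav_point_dens_site: "sav y (\<lambda>\<xi>. of_bool (\<xi> y = b) / (if b then p else 1 - p)) = (\<lambda>_. 1)"
  using p0 p1 by (cases b) (auto simp: sav_eq fun_eq_iff)

lemma av_point_dens:
  assumes V: "finite V" "U \<subseteq> V" shows "av V (point_dens \<eta> U) \<zeta> = 1"
proof -
  have U: "finite U" using V by (auto intro: finite_subset)
  have "av V (point_dens \<eta> U) \<zeta> = (\<Prod>y\<in>U. av V (\<lambda>\<xi>. of_bool (\<xi> y = \<eta> y) / (if \<eta> y then p else 1 - p)) \<zeta>)"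
    unfolding point_dens_def[abs_def]
    by (rule av_prod[OF V(1) U, where D = "\<lambda>y. {y}"])
       (rule depends_on_coord[where F = "\<lambda>b. of_bool (b = \<eta> y) / (if \<eta> y then p else 1 - p)" for y], auto)
  also have "\<dots> = (\<Prod>y\<in>U. 1)"
  proof (rule prod.cong[OF refl])
    fix y assume "y \<in> U"
    then have "y \<in> V" using V by auto
    then show "av V (\<lambda>\<xi>. of_bool (\<xi> y = \<eta> y) / (if \<eta> y then p else 1 - p)) \<zeta> = 1"
      unfolding av_remove[OF V(1) \<open>y \<in> V\<close>] sav_point_dens_site using V by (simp add: av_const)
  qed
  finally show ?thesis by simp
qed

lemma sav_point_dens: "finite U \<Longrightarrow> x \<in> U \<Longrightarrow> sav x (point_dens \<eta> U) = point_dens \<eta> (U - {x})"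
proof
  fix \<xi> assume U: "finite U" "x \<in> U"
  have "point_dens \<eta> U = (\<lambda>\<xi>. point_dens \<eta> (U - {x}) \<xi> * (of_bool (\<xi> x = \<eta> x) / (if \<eta> x then p else 1 - p)))"
    unfolding point_dens_def by (rule ext) (subst prod.remove[OF U], simp)
  moreover have "point_dens \<eta> (U - {x}) (\<xi>(x := b)) = point_dens \<eta> (U - {x}) \<xi>" for b
    by (rule depends_on_upd[OF depends_on_point_dens]) simp
  ultimately show "sav x (point_dens \<eta> U) \<xi> = point_dens \<eta> (U - {x}) \<xi>"
    using sav_pull[of "point_dens \<eta> (U - {x})" \<xi> x "\<lambda>\<xi>. of_bool (\<xi> x = \<eta> x) / (if \<eta> x then p else 1 - p)"]
    by (simp add: sav_point_dens_site)
qed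

lemma subtree_remove_root:
  "(@) x ` tball (Suc j) - {x} = (\<Union>i<k. (@) (x @ [i]) ` tball j)"
proof
  show "(@) x ` tball (Suc j) - {x} \<subseteq> (\<Union>i<k. (@) (x @ [i]) ` tball j)"
  proof
    fix y assume "y \<in> (@) x ` tball (Suc j) - {x}"
    then obtain w where w: "y = x @ w" "w \<in> tball (Suc j)" "w \<noteq> []" by auto
    then obtain i v where "w = i # v" by (cases w) auto
    then have "i < k" "v \<in> tball j" "y = (x @ [i]) @ v" using w by (auto simp: tree_ball_def tree_def)
    then show "y \<in> (\<Union>i<k. (@) (x @ [i]) ` tball j)" by blast
  qed
  show "(\<Union>i<k. (@) (x @ [i]) ` tball j) \<subseteq> (@) x ` tball (Suc j) - {x}"
    using subtree_Suc by blast
qed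

lemma closed_in_subtree: "length x + j = L \<Longrightarrow> closed_in (tball L) ((@) x ` tball j)"
  unfolding closed_in_def using subtree_closed by blast

text \<open>Exceeds 1 by the squared \<open>L\<^sup>2\<close> distance from equilibrium of the
  subtree at \<open>x\<close> started from \<open>\<eta>\<close>.\<close>

definition subtree_L2 :: "nat \<Rightarrow> config \<Rightarrow> vertex \<Rightarrow> nat \<Rightarrow> real \<Rightarrow> real" where
  "subtree_L2 L \<eta> x j t
    = av (tball L) (\<lambda>\<xi>. (sg (tball L) t (point_dens \<eta> ((@) x ` tball j)) \<xi>)\<^sup>2) vacant"

lemma subtree_subset: "x \<in> tree k \<Longrightarrow> length x + j \<le> L \<Longrightarrow> (@) x ` tball j \<subseteq> tball L"
  by (auto simp: tree_ball_def tree_def)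

lemma subtree_L2_decay:
  assumes pi: "poincare (tball L) T" and T: "0 < T" and st: "s \<le> t"
    and x: "x \<in> tree k" "length x + j \<le> L"
  shows "subtree_L2 L \<eta> x j t - 1 \<le> exp (- 2 * (t - s) / T) * (subtree_L2 L \<eta> x j s - 1)"
proof -
  define V where "V = tball L"
  define D where "D = point_dens \<eta> ((@) x ` tball j)"
  have V: "finite V" by (simp add: V_def finite_tree_ball)
  have D1: "av V D vacant = 1" unfolding D_def V_def by (intro av_point_dens finite_tree_ball subtree_subset x)
  have b: "subtree_L2 L \<eta> x j t - 1 = av V (\<lambda>\<xi>. (sg V t (\<lambda>\<xi>. 1 * D \<xi> + (-1) * 1) \<xi>)\<^sup>2) vacant" for t
    using av_variance[OF V, of "sg V t D" vacant] semigroup_lin2[OF V, of t 1 D "-1" "\<lambda>_. 1"]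
    by (simp add: av_semigroup V D1 subtree_L2_def V_def[symmetric] D_def[symmetric] semigroup_const)
  have "av V (\<lambda>\<xi>. 1 * D \<xi> + (-1) * 1) vacant = 0" using D1 by (simp add: av_diff av_const V)
  then show ?thesis
    unfolding b by (rule semigroup_L2_decay[OF V pi[folded V_def] T _ st])
qed

text \<open>Split the evolved density into its average over the spin at \<open>x\<close> and a
  centred rest. The average is the product of the densities of the child subtrees, which
  accounts for the first term. The rest decays exponentially from time \<open>s\<close> on. At
  time \<open>s\<close> it is dominated by the average, because a nonnegative function is at
  most \<open>1 / min p (1 - p)\<close> times its average over one spin.\<close>

lemma mixing_step:
  assumes pi: "poincare (tball L) T" and T: "0 < T" and st: "0 \<le> s" "s \<le> t"
    and x: "x \<in> tree k" "length x + j = L"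
  defines "I \<equiv> if j = 0 then {} else {..<k}"
  shows "subtree_L2 L \<eta> x j t \<le> (\<Prod>i\<in>I. subtree_L2 L \<eta> (x @ [i]) (j - 1) t)
    + (1 / (min p (1 - p))\<^sup>2) * exp (- 2 * (t - s) / T) * (\<Prod>i\<in>I. subtree_L2 L \<eta> (x @ [i]) (j - 1) s)"
proof -
  define V where "V = tball L"
  define U where "U = (@) x ` tball j"
  define c where "c = (\<lambda>i. (@) (x @ [i]) ` tball (j - 1))"
  define D where "D = point_dens \<eta> U"
  define P where "P = sg V"
  have V: "finite V" and U: "finite U" "U \<subseteq> V" "x \<in> U"
    using x by (auto simp: V_def U_def finite_tree_ball subtree_subset subtree_Suc(2))
  have xV: "x \<in> V" using U by auto
  have cl: "closed_in V U" unfolding V_def U_def by (rule closed_in_subtree[OF x(2)])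
  have xc: "x \<notin> children k y" if "y \<in> U" for y using that by (auto simp: U_def children_def)
  have clc: "closed_in V (c i)" if "i \<in> I" for i
    unfolding V_def c_def using that x by (intro closed_in_subtree) (auto simp: I_def split: if_splits)
  have disj: "c i \<inter> c i' = {}" if "i \<noteq> i'" for i i'
    unfolding c_def using that by (rule subtree_disjoint)
  have "U - {x} = (\<Union>i\<in>I. c i)"
  proof (cases j)
    case 0
    then show ?thesis by (simp add: U_def I_def tree_ball_def tree_def) auto
  next
    case (Suc j')
    then show ?thesis using subtree_remove_root[of x j'] by (simp add: U_def I_def c_def)
  qed
  then have sD: "sav x D = (\<lambda>\<xi>. \<Prod>i\<in>I. point_dens \<eta> (c i) \<xi>)"
    unfolding D_def sav_point_dens[OF U(1,3)] point_dens_def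
    by (simp only:, intro ext prod.UNION_disjoint) (auto simp: I_def c_def finite_tree_ball)
  have m: "sav x (P t D) = (\<lambda>\<xi>. \<Prod>i\<in>I. P t (point_dens \<eta> (c i)) \<xi>)" for t
  proof -
    have "sav x (P t D) = P t (sav x D)"
      unfolding P_def by (rule semigroup_sav[symmetric, OF V cl xc]) (auto simp: D_def depends_on_point_dens)
    also have "\<dots> = (\<lambda>\<xi>. \<Prod>i\<in>I. P t (point_dens \<eta> (c i)) \<xi>)"
      unfolding sD P_def
      by (rule semigroup_prod[OF V, where D = c]) (auto simp: I_def clc[unfolded I_def] depends_on_point_dens disj)
    finally show ?thesis .
  qed
  have m2: "av V (\<lambda>\<xi>. (sav x (P t D) \<xi>)\<^sup>2) vacant = (\<Prod>i\<in>I. subtree_L2 L \<eta> (x @ [i]) (j - 1) t)" for t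
  proof -
    have "av V (\<lambda>\<xi>. \<Prod>i\<in>I. (P t (point_dens \<eta> (c i)) \<xi>)\<^sup>2) vacant = (\<Prod>i\<in>I. av V (\<lambda>\<xi>. (P t (point_dens \<eta> (c i)) \<xi>)\<^sup>2) vacant)"
    proof (rule av_prod[OF V, where D = c])
      fix i assume "i \<in> I"
      then have "depends_on (P t (point_dens \<eta> (c i))) (c i)"
        unfolding P_def by (intro depends_on_semigroup clc depends_on_point_dens)
      then show "depends_on (\<lambda>\<xi>. (P t (point_dens \<eta> (c i)) \<xi>)\<^sup>2) (c i)"
        by (rule depends_on_comp[where F = "\<lambda>a. a\<^sup>2"])
    qed (auto simp: disj I_def)
    then show ?thesis unfolding m prod_power_distrib[symmetric] by (simp add: subtree_L2_def c_def P_def V_def prod_power_distrib)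
  qed
  define g where "g = (\<lambda>\<xi>. 1 * D \<xi> + (-1) * sav x D \<xi>)"
  have Pg: "P t g = (\<lambda>\<xi>. P t D \<xi> - sav x (P t D) \<xi>)" for t
    unfolding g_def P_def semigroup_lin2[OF V]
    by (subst semigroup_sav[OF V cl xc]) (auto simp: D_def depends_on_point_dens)
  have split: "av V (\<lambda>\<xi>. (P t D \<xi>)\<^sup>2) vacant = av V (\<lambda>\<xi>. (sav x (P t D) \<xi>)\<^sup>2) vacant + av V (\<lambda>\<xi>. (P t g \<xi>)\<^sup>2) vacant" for t
  proof -
    have "site_var x (P t g) \<xi> = site_var x (P t D) \<xi>" "sav x (P t g) \<xi> = 0" "site_var x (sav x (P t D)) \<xi> = 0" for \<xi>
      unfolding Pg by (simp_all add: site_var_def grad_def sav_diff)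
    then have "sav x (\<lambda>\<xi>. (P t D \<xi>)\<^sup>2) = sav x (\<lambda>\<xi>. (sav x (P t D) \<xi>)\<^sup>2 + (P t g \<xi>)\<^sup>2)"
      unfolding sav_add by (intro ext) (simp add: sav_square)
    then have "av V (\<lambda>\<xi>. (P t D \<xi>)\<^sup>2) = av V (\<lambda>\<xi>. (sav x (P t D) \<xi>)\<^sup>2 + (P t g \<xi>)\<^sup>2)"
      by (metis av_sav[OF V xV])
    then show ?thesis by (simp add: av_add V)
  qed
  have "av V g vacant = 0"
    unfolding g_def using av_sav[OF V xV, of D] by (simp add: av_diff V)
  then have "av V (\<lambda>\<xi>. (P t g \<xi>)\<^sup>2) vacant \<le> exp (- 2 * (t - s) / T) * av V (\<lambda>\<xi>. (P s g \<xi>)\<^sup>2) vacant"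
    unfolding P_def by (rule semigroup_L2_decay[OF V pi[folded V_def] T _ st(2)])
  also have "\<dots> \<le> exp (- 2 * (t - s) / T) * ((1 / (min p (1 - p))\<^sup>2) * av V (\<lambda>\<xi>. (sav x (P s D) \<xi>)\<^sup>2) vacant)"
  proof (intro mult_left_mono)
    define d where "d = min p (1 - p)"
    have d: "0 < d" "d \<le> 1" "d \<le> p" "d \<le> 1 - p" using p0 p1 by (auto simp: d_def)
    have "(P s g \<xi>)\<^sup>2 \<le> (1 / d\<^sup>2) * (sav x (P s D) \<xi>)\<^sup>2" for \<xi>
    proof -
      define a where "a = P s D \<xi>"
      define b where "b = sav x (P s D) \<xi>"
      have nn: "0 \<le> P s D \<zeta>" for \<zeta>
        unfolding P_def D_def by (intro semigroup_nonneg V st point_dens_nonneg)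
      have a: "0 \<le> a" by (simp add: a_def nn)
      have "d * a \<le> b"
      proof (cases "\<xi> x")
        case True
        then have "\<xi>(x := True) = \<xi>" by (simp add: fun_upd_idem)
        then have "p * a \<le> b"
          unfolding b_def sav_eq a_def using nn p1 by (simp add: mult_nonneg_nonneg)
        then show ?thesis using mult_right_mono[OF d(3) a] by simp
      next
        case False
        then have "\<xi>(x := False) = \<xi>" by (simp add: fun_upd_idem)
        then have "(1 - p) * a \<le> b"
          unfolding b_def sav_eq a_def using nn p0 by (simp add: mult_nonneg_nonneg)
        then show ?thesis using mult_right_mono[OF d(4) a] by simp
      qed
      then have ab: "a \<le> b / d" using d by (simp add: field_simps)
      have b: "0 \<le> b" using \<open>d * a \<le> b\<close> mult_nonneg_nonneg[of d a] a d by linarith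
      have "b \<le> b / d" using b d by (simp add: le_divide_eq mult_left_le)
      then have "\<bar>a - b\<bar> \<le> b / d" using a b ab by linarith
      then have "\<bar>a - b\<bar>\<^sup>2 \<le> (b / d)\<^sup>2" by (intro power_mono) auto
      then show ?thesis unfolding Pg a_def[symmetric] b_def[symmetric] by (simp add: power_divide)
    qed
    then have "av V (\<lambda>\<xi>. (P s g \<xi>)\<^sup>2) vacant \<le> av V (\<lambda>\<xi>. (1 / d\<^sup>2) * (sav x (P s D) \<xi>)\<^sup>2) vacant"
      by (intro av_mono V)
    then show "av V (\<lambda>\<xi>. (P s g \<xi>)\<^sup>2) vacant \<le> (1 / (min p (1 - p))\<^sup>2) * av V (\<lambda>\<xi>. (sav x (P s D) \<xi>)\<^sup>2) vacant"
      unfolding av_cmult[OF V] d_def .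
  qed simp
  finally have "av V (\<lambda>\<xi>. (P t D \<xi>)\<^sup>2) vacant \<le> (\<Prod>i\<in>I. subtree_L2 L \<eta> (x @ [i]) (j - 1) t)
    + exp (- 2 * (t - s) / T) * ((1 / (min p (1 - p))\<^sup>2) * (\<Prod>i\<in>I. subtree_L2 L \<eta> (x @ [i]) (j - 1) s))"
    unfolding split[of t] m2 by simp
  then show ?thesis unfolding subtree_L2_def by (simp add: P_def D_def U_def V_def mult_ac)
qed

lemma one_plus_power_le: "0 \<le> x \<Longrightarrow> x \<le> 1 \<Longrightarrow> (1 + x) ^ n \<le> 1 + x * (2 ^ n - 1)" for x :: real
proof (induction n)
  case (Suc n)
  have "(1 + x) ^ Suc n \<le> (1 + x) * (1 + x * (2 ^ n - 1))"
    using Suc by (simp add: mult_left_mono)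
  also have "\<dots> = 1 + x * 2 ^ n + x * (x * (2 ^ n - 1))" by (simp add: algebra_simps)
  also have "\<dots> \<le> 1 + x * 2 ^ n + x * (1 * (2 ^ n - 1))"
    using Suc by (intro add_left_mono mult_left_mono mult_right_mono) auto
  finally show ?case by (simp add: algebra_simps)
qed simp

text \<open>The decay per level that reproduces the bound \<open>17 / 16\<close> in
  \<open>subtree_L2_bound\<close>. It has to beat the number of children, through \<open>2 ^
  k\<close>, and the constant in \<open>mixing_step\<close>.\<close>

definition mix_rate :: real where
  "mix_rate = 1 / (16 * 2 ^ k * (1 + 1 / (min p (1 - p))\<^sup>2))"

lemma mix_rate: "0 < mix_rate" "mix_rate < 1"
proof -
  have "1 < 16 * 2 ^ k * (1 + 1 / (min p (1 - p))\<^sup>2)"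
  proof -
    have "0 \<le> 1 / (min p (1 - p))\<^sup>2" by simp
    moreover have "(1::real) \<le> 2 ^ k" by simp
    ultimately have "16 * 1 * 1 \<le> 16 * 2 ^ k * (1 + 1 / (min p (1 - p))\<^sup>2)"
      by (intro mult_mono) auto
    then show ?thesis by simp
  qed
  then show "0 < mix_rate" "mix_rate < 1" by (auto simp: mix_rate_def)
qed

text \<open>Induction from the leaves upwards. During each further time span the
  \<open>L\<^sup>2\<close> distances of the child subtrees shrink by the factor
  \<open>mix_rate\<close>, and so does the rest in \<open>mixing_step\<close>.\<close>

lemma subtree_L2_bound:
  assumes pi: "poincare (tball L) T" and T: "0 < T" and x: "x \<in> tree k" "length x + j = L"
  shows "subtree_L2 L \<eta> x j (real (Suc j) * (T * ln (1 / mix_rate) / 2)) \<le> 17 / 16"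
  using x
proof (induction j arbitrary: x)
  define \<tau> where "\<tau> = T * ln (1 / mix_rate) / 2"
  define C where "C = 1 / (min p (1 - p))\<^sup>2"
  have \<tau>: "0 \<le> \<tau>" using T mix_rate by (simp add: \<tau>_def)
  have C: "0 \<le> C" by (simp add: C_def)
  have decay: "exp (- 2 * \<tau> / T) = mix_rate"
    using T mix_rate by (simp add: \<tau>_def ln_div)
  have rate: "mix_rate * 2 ^ k * (1 + C) = 1 / 16"
  proof -
    have "0 < (2::real) ^ k * (1 + C)" using C by (intro mult_pos_pos) auto
    then show ?thesis unfolding mix_rate_def C_def[symmetric] by (simp add: field_simps)
  qed
  {
    case 0
    have "subtree_L2 L \<eta> x 0 \<tau> \<le> 1 + C * exp (- 2 * (\<tau> - 0) / T)"
      using mixing_step[OF pi T order_refl \<tau> 0(1,2), of \<eta>] by (simp add: C_def)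
    also have "C * exp (- 2 * (\<tau> - 0) / T) \<le> mix_rate * 2 ^ k * (1 + C)"
    proof -
      have "1 * C \<le> 2 ^ k * (1 + C)" using C by (intro mult_mono) auto
      then have "mix_rate * (1 * C) \<le> mix_rate * (2 ^ k * (1 + C))"
        using mix_rate by (intro mult_left_mono) auto
      then show ?thesis using decay by (simp add: mult_ac)
    qed
    finally show ?case using rate by (simp add: \<tau>_def)
  next
    case (Suc j)
    define s where "s = real (Suc j) * \<tau>"
    define t where "t = real (Suc (Suc j)) * \<tau>"
    have ts: "t - s = \<tau>" by (simp add: t_def s_def algebra_simps)
    have st: "0 \<le> s" "s \<le> t" using \<tau> by (auto simp: s_def t_def mult_right_mono)
    have IH: "subtree_L2 L \<eta> (x @ [i]) j s \<le> 17 / 16" if "i < k" for i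
      unfolding s_def \<tau>_def using Suc.prems that by (intro Suc.IH) (auto simp: tree_snoc)
    have dec: "subtree_L2 L \<eta> (x @ [i]) j t \<le> 1 + mix_rate / 16" if "i < k" for i
    proof -
      have "subtree_L2 L \<eta> (x @ [i]) j t - 1 \<le> exp (- 2 * (t - s) / T) * (subtree_L2 L \<eta> (x @ [i]) j s - 1)"
        using Suc.prems that by (intro subtree_L2_decay[OF pi T st(2)]) (auto simp: tree_snoc)
      also have "\<dots> \<le> mix_rate * (1 / 16)"
        unfolding ts decay using IH[OF that] mix_rate by (intro mult_left_mono) auto
      finally show ?thesis by simp
    qed
    have nn: "0 \<le> subtree_L2 L \<eta> y j r" for y r
      unfolding subtree_L2_def by (intro av_nonneg finite_tree_ball) simp
    have "subtree_L2 L \<eta> x (Suc j) t \<le> (\<Prod>i<k. subtree_L2 L \<eta> (x @ [i]) j t)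
        + C * mix_rate * (\<Prod>i<k. subtree_L2 L \<eta> (x @ [i]) j s)"
      using mixing_step[OF pi T st Suc.prems, of \<eta>] unfolding ts decay by (simp add: C_def)
    also have "\<dots> \<le> (\<Prod>i<k. 1 + mix_rate / 16) + C * mix_rate * (\<Prod>i<k. 2)"
    proof -
      have "subtree_L2 L \<eta> (x @ [i]) j s \<le> 2" if "i < k" for i using IH[OF that] by simp
      then show ?thesis
        using dec nn C mix_rate by (intro add_mono mult_left_mono prod_mono) auto
    qed
    also have "\<dots> \<le> (1 + mix_rate / 16 * (2 ^ k - 1)) + C * mix_rate * 2 ^ k"
      using one_plus_power_le[of "mix_rate / 16" k] mix_rate by simp
    also have "\<dots> \<le> 1 + mix_rate * 2 ^ k * (1 + C)"
    proof -
      have "mix_rate / 16 * (2 ^ k - 1) \<le> mix_rate * 2 ^ k"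
        using mix_rate by (intro mult_mono) auto
      then show ?thesis by (simp add: algebra_simps)
    qed
    finally show ?case unfolding rate by (simp add: t_def \<tau>_def)
  }
qed

lemma pmf_mu:
  assumes "finite V" "\<eta> \<in> configs V"
  shows "pmf (mu p V) \<eta> = (\<Prod>y\<in>V. if \<eta> y then p else 1 - p)"
proof -
  have "pmf (mu p V) \<eta> = (\<Prod>y\<in>V. pmf (bernoulli_pmf p) (\<eta> y))"
    unfolding mu_def using assms by (intro pmf_Pi') (auto simp: configs_iff)
  also have "\<dots> = (\<Prod>y\<in>V. if \<eta> y then p else 1 - p)"
    using p0 p1 by (intro prod.cong) auto
  finally show ?thesis .
qed

lemma pmf_mu_pos: "finite V \<Longrightarrow> \<eta> \<in> configs V \<Longrightarrow> 0 < pmf (mu p V) \<eta>"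
  using p0 p1 by (auto simp: pmf_mu intro!: prod_pos)

lemma point_dens_eq:
  assumes "finite V" "\<eta> \<in> configs V" "\<xi> \<in> configs V"
  shows "point_dens \<eta> V \<xi> = 1 / pmf (mu p V) \<eta> * indicator {\<eta>} \<xi>"
proof (cases "\<xi> = \<eta>")
  case True
  then show ?thesis using assms by (simp add: point_dens_def pmf_mu prod_dividef)
next
  case False
  then obtain y where "\<xi> y \<noteq> \<eta> y" by auto
  moreover then have "y \<in> V" using assms by (auto simp: configs_iff)
  ultimately have "point_dens \<eta> V \<xi> = 0"
    unfolding point_dens_def using assms(1) by (intro prod_zero) auto
  then show ?thesis using False by simp
qed

lemma generator_pow_cong_configs:
  assumes "\<And>\<xi>. \<xi> \<in> configs V \<Longrightarrow> f \<xi> = g \<xi>" "\<xi> \<in> configs V"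
  shows "(gen V ^^ n) f \<xi> = (gen V ^^ n) g \<xi>"
  using assms(2) by (induction n arbitrary: \<xi>) (auto simp: assms(1) intro: generator_cong_configs)

lemma semigroup_cong_configs:
  assumes "\<And>\<xi>. \<xi> \<in> configs V \<Longrightarrow> f \<xi> = g \<xi>" "\<xi> \<in> configs V"
  shows "sg V t f \<xi> = sg V t g \<xi>"
  using generator_pow_cong_configs[OF assms] by (simp add: semigroup_def)

lemma generator_pow_selfadjoint:
  assumes V: "finite V"
  shows "av V (\<lambda>\<xi>. f \<xi> * (gen V ^^ n) g \<xi>) \<eta> = av V (\<lambda>\<xi>. g \<xi> * (gen V ^^ n) f \<xi>) \<eta>"
proof (induction n arbitrary: f)
  case 0
  then show ?case by (simp add: mult.commute)
next
  case (Suc n)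
  have "av V (\<lambda>\<xi>. f \<xi> * (gen V ^^ Suc n) g \<xi>) \<eta>
      = av V (\<lambda>\<xi>. (gen V ^^ n) g \<xi> * gen V f \<xi>) \<eta>"
    by (simp add: av_generator V dirichlet_commute)
  also have "\<dots> = av V (\<lambda>\<xi>. gen V f \<xi> * (gen V ^^ n) g \<xi>) \<eta>"
    by (simp add: mult.commute)
  also have "\<dots> = av V (\<lambda>\<xi>. g \<xi> * (gen V ^^ n) (gen V f) \<xi>) \<eta>"
    by (rule Suc.IH)
  finally show ?case by (simp add: funpow_swap1)
qed

lemma av_indicator:
  assumes V: "finite V"
  shows "av V (\<lambda>\<xi>. indicator {\<eta>} \<xi> * g \<xi>) vacant = pmf (mu p V) \<eta> * g \<eta>"
proof -
  have "(\<lambda>\<xi>. indicator {\<eta>} \<xi> * g \<xi>) = (\<lambda>\<xi>. g \<eta> * indicator {\<eta>} \<xi>)"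
    by (auto simp: indicator_def)
  then have "av V (\<lambda>\<xi>. indicator {\<eta>} \<xi> * g \<xi>) vacant = g \<eta> * av V (indicator {\<eta>}) vacant"
    by (simp add: av_cmult V)
  also have "av V (indicator {\<eta>}) vacant = pmf (mu p V) \<eta>"
    by (simp add: expectation_mu[OF V, symmetric] measure_pmf_single)
  finally show ?thesis by simp
qed

text \<open>By reversibility the density of the law at time \<open>t\<close> is the initial
  density evolved by the semigroup.\<close>

lemma law_density_eq:
  assumes V: "finite V" and \<eta>: "\<eta> \<in> configs V" and \<sigma>: "\<sigma> \<in> configs V"
  shows "law_density k p V \<eta> t \<sigma> = sg V t (point_dens \<eta> V) \<sigma>"
proof -
  let ?L = "\<lambda>n. gen V ^^ n"
  have sym: "pmf (mu p V) \<eta> * (?L n) (indicator {\<sigma>}) \<eta> = pmf (mu p V) \<sigma> * (?L n) (indicator {\<eta>}) \<sigma>" for n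
    using generator_pow_selfadjoint[OF V, of "indicator {\<eta>}" n "indicator {\<sigma>}" vacant] by (simp add: av_indicator V)
  have pos: "0 < pmf (mu p V) \<eta>" "0 < pmf (mu p V) \<sigma>" using pmf_mu_pos V \<eta> \<sigma> by auto
  have "(?L n) (indicator {\<sigma>}) \<eta> = pmf (mu p V) \<sigma> / pmf (mu p V) \<eta> * (?L n) (indicator {\<eta>}) \<sigma>" for n
    using sym[of n] pos by (simp add: field_simps)
  then have "sg V t (indicator {\<sigma>}) \<eta>
      = pmf (mu p V) \<sigma> / pmf (mu p V) \<eta> * sg V t (indicator {\<eta>}) \<sigma>"
    unfolding semigroup_egf by (simp only: egf_cmult generator_pow_bounded V)
  then have "law_density k p V \<eta> t \<sigma> = 1 / pmf (mu p V) \<eta> * sg V t (indicator {\<eta>}) \<sigma> + 0 * sg V t (indicator {\<eta>}) \<sigma>"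
    using pos by (simp add: law_density_def law_def)
  also have "\<dots> = sg V t (\<lambda>\<xi>. 1 / pmf (mu p V) \<eta> * indicator {\<eta>} \<xi> + 0 * indicator {\<eta>} \<xi>) \<sigma>"
    by (simp only: semigroup_lin2[OF V])
  also have "\<dots> = sg V t (point_dens \<eta> V) \<sigma>"
    by (rule semigroup_cong_configs[OF _ \<sigma>]) (simp add: point_dens_eq V \<eta>)
  finally show ?thesis .
qed

text \<open>The set of times whose infimum is \<open>T_mix\<close>.\<close>

definition mixed :: "real \<Rightarrow> vertex set \<Rightarrow> real set" where
  "mixed a V = {t. 0 \<le> t \<and> (MAX \<eta> \<in> configs V.
     measure_pmf.expectation (mu p V) (\<lambda>\<sigma>. \<bar>law_density k p V \<eta> t \<sigma> - 1\<bar> powr a) powr (1 / a)) \<le> 1 / 4}"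

lemma configs_nonempty: "vacant \<in> configs V"
  by (simp add: configs_iff)

lemma mixed_1_iff:
  assumes V: "finite V"
  shows "t \<in> mixed 1 V \<longleftrightarrow> 0 \<le> t \<and> (\<forall>\<eta>\<in>configs V. av V (\<lambda>\<sigma>. \<bar>sg V t (point_dens \<eta> V) \<sigma> - 1\<bar>) vacant \<le> 1 / 4)"
proof -
  have "measure_pmf.expectation (mu p V) (\<lambda>\<sigma>. \<bar>law_density k p V \<eta> t \<sigma> - 1\<bar> powr 1) powr (1 / 1)
     = av V (\<lambda>\<sigma>. \<bar>sg V t (point_dens \<eta> V) \<sigma> - 1\<bar>) vacant" if "\<eta> \<in> configs V" for \<eta>
  proof -
    have "measure_pmf.expectation (mu p V) (\<lambda>\<sigma>. \<bar>law_density k p V \<eta> t \<sigma> - 1\<bar> powr 1)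
        = av V (\<lambda>\<sigma>. \<bar>sg V t (point_dens \<eta> V) \<sigma> - 1\<bar>) vacant"
      unfolding expectation_mu[OF V] by (rule av_cong_configs[OF V]) (simp add: law_density_eq V that)
    moreover have "0 \<le> av V (\<lambda>\<sigma>. \<bar>sg V t (point_dens \<eta> V) \<sigma> - 1\<bar>) vacant" by (intro av_nonneg V) simp
    ultimately show ?thesis by simp
  qed
  then show ?thesis
    unfolding mixed_def using finite_configs[OF V] configs_nonempty[of V]
    by (subst mem_Collect_eq, subst Max_le_iff) auto
qed

lemma mixed_2_iff:
  assumes V: "finite V"
  shows "t \<in> mixed 2 V \<longleftrightarrow> 0 \<le> t \<and> (\<forall>\<eta>\<in>configs V. av V (\<lambda>\<sigma>. (sg V t (point_dens \<eta> V) \<sigma> - 1)\<^sup>2) vacant \<le> 1 / 16)"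
proof -
  have "measure_pmf.expectation (mu p V) (\<lambda>\<sigma>. \<bar>law_density k p V \<eta> t \<sigma> - 1\<bar> powr 2) powr (1 / 2)
     = sqrt (av V (\<lambda>\<sigma>. (sg V t (point_dens \<eta> V) \<sigma> - 1)\<^sup>2) vacant)" if "\<eta> \<in> configs V" for \<eta>
  proof -
    have "measure_pmf.expectation (mu p V) (\<lambda>\<sigma>. \<bar>law_density k p V \<eta> t \<sigma> - 1\<bar> powr 2)
        = av V (\<lambda>\<sigma>. (sg V t (point_dens \<eta> V) \<sigma> - 1)\<^sup>2) vacant"
      unfolding expectation_mu[OF V] by (rule av_cong_configs[OF V]) (simp add: law_density_eq V that powr_numeral)
    moreover have "0 \<le> av V (\<lambda>\<sigma>. (sg V t (point_dens \<eta> V) \<sigma> - 1)\<^sup>2) vacant" by (intro av_nonneg V) simp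
    ultimately show ?thesis by (simp add: powr_half_sqrt)
  qed
  moreover have "sqrt x \<le> 1 / 4 \<longleftrightarrow> x \<le> 1 / 16" for x
  proof -
    have "sqrt (1 / 16) = 1 / 4" by (rule real_sqrt_unique) (auto simp: power2_eq_square)
    then show ?thesis by (metis real_sqrt_le_iff)
  qed
  ultimately show ?thesis
    unfolding mixed_def using finite_configs[OF V] configs_nonempty[of V]
    by (subst mem_Collect_eq, subst Max_le_iff) auto
qed

lemma mixed_2_subset_mixed_1:
  assumes V: "finite V" shows "mixed 2 V \<subseteq> mixed 1 V"
proof
  fix t assume t: "t \<in> mixed 2 V"
  have "av V (\<lambda>\<sigma>. \<bar>sg V t (point_dens \<eta> V) \<sigma> - 1\<bar>) vacant \<le> 1 / 4" if "\<eta> \<in> configs V" for \<eta>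
  proof -
    have "(av V (\<lambda>\<sigma>. \<bar>sg V t (point_dens \<eta> V) \<sigma> - 1\<bar>) vacant)\<^sup>2 \<le> av V (\<lambda>\<sigma>. (sg V t (point_dens \<eta> V) \<sigma> - 1)\<^sup>2) vacant"
      using av_square_le[OF V, of "\<lambda>\<sigma>. \<bar>sg V t (point_dens \<eta> V) \<sigma> - 1\<bar>" vacant] by simp
    also have "\<dots> \<le> (1 / 4)\<^sup>2" using t that by (simp add: mixed_2_iff V power2_eq_square)
    finally show ?thesis by (rule power2_le_imp_le) simp
  qed
  then show "t \<in> mixed 1 V" using t by (simp add: mixed_1_iff mixed_2_iff V)
qed

lemma mixed_2_tree_ball:
  assumes pi: "poincare (tball L) T" and T: "0 < T"
  shows "real (Suc L) * (T * ln (1 / mix_rate) / 2) \<in> mixed 2 (tball L)"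
proof -
  define t where "t = real (Suc L) * (T * ln (1 / mix_rate) / 2)"
  define V where "V = tball L"
  have V: "finite V" by (simp add: V_def finite_tree_ball)
  have "0 \<le> t" using T mix_rate by (simp add: t_def)
  moreover have "av V (\<lambda>\<sigma>. (sg V t (point_dens \<eta> V) \<sigma> - 1)\<^sup>2) vacant \<le> 1 / 16" for \<eta>
  proof -
    have "av V (\<lambda>\<sigma>. (sg V t (point_dens \<eta> V) \<sigma> - 1)\<^sup>2) vacant
        = av V (\<lambda>\<sigma>. (sg V t (point_dens \<eta> V) \<sigma>)\<^sup>2) vacant - 1"
      using av_variance[OF V, of "sg V t (point_dens \<eta> V)" vacant] by (simp add: av_semigroup V av_point_dens)
    also have "av V (\<lambda>\<sigma>. (sg V t (point_dens \<eta> V) \<sigma>)\<^sup>2) vacant = subtree_L2 L \<eta> [] L t"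
      by (simp add: subtree_L2_def V_def)
    also have "\<dots> \<le> 17 / 16"
      unfolding t_def by (rule subtree_L2_bound[OF pi T]) (auto simp: tree_def)
    finally show ?thesis by simp
  qed
  ultimately show ?thesis
    unfolding t_def[symmetric] V_def[symmetric] mixed_2_iff[OF V] by blast
qed

lemma T_mix_eq: "T_mix k p a V = Inf (mixed a V)"
  by (simp add: T_mix_def mixed_def)

lemma bdd_below_mixed: "bdd_below (mixed a V)"
  by (rule bdd_belowI[of _ 0]) (simp add: mixed_def)

end

section \<open>Independent blocks and mixing from below\<close>

context ofa
begin

lemma exp_bounded_av:
  assumes "finite A" "\<And>\<xi>. exp_bounded (a \<xi>)"
  shows "exp_bounded (\<lambda>n. av A (\<lambda>\<xi>. a \<xi> n) \<eta>)"
  using assms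
proof (induction A arbitrary: \<eta> rule: finite_induct)
  case (insert x A)
  show ?case
    unfolding av_insert[OF insert.hyps] sav_eq
    by (intro exp_bounded_add exp_bounded_cmult insert.IH insert.prems)
qed simp

lemma av_egf:
  assumes "finite A" "\<And>\<xi>. exp_bounded (a \<xi>)"
  shows "av A (\<lambda>\<xi>. egf (a \<xi>) t) \<eta> = egf (\<lambda>n. av A (\<lambda>\<xi>. a \<xi> n) \<eta>) t"
  using assms
proof (induction A arbitrary: \<eta> rule: finite_induct)
  case (insert x A)
  show ?case
    unfolding av_insert[OF insert.hyps] sav_eq
    by (simp only: insert.IH[OF insert.prems] egf_add egf_cmult exp_bounded_cmult exp_bounded_av[OF insert.hyps(1) insert.prems])
qed simp

lemma semigroup_selfadjoint:
  assumes V: "finite V"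
  shows "av V (\<lambda>\<xi>. f \<xi> * sg V t g \<xi>) \<eta> = av V (\<lambda>\<xi>. g \<xi> * sg V t f \<xi>) \<eta>"
proof -
  have "av V (\<lambda>\<xi>. f \<xi> * sg V t g \<xi>) \<eta> = egf (\<lambda>n. av V (\<lambda>\<xi>. f \<xi> * (gen V ^^ n) g \<xi>) \<eta>) t" for f g
  proof -
    have "(\<lambda>\<xi>. f \<xi> * sg V t g \<xi>) = (\<lambda>\<xi>. egf (\<lambda>n. f \<xi> * (gen V ^^ n) g \<xi>) t)"
      unfolding semigroup_egf by (simp add: egf_cmult generator_pow_bounded V)
    then show ?thesis
      using av_egf[OF V, of "\<lambda>\<xi> n. f \<xi> * (gen V ^^ n) g \<xi>" t \<eta>]
      by (simp add: exp_bounded_cmult generator_pow_bounded V)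
  qed
  then show ?thesis by (simp only: generator_pow_selfadjoint[OF V, of f])
qed

lemma av_point_dens_mult:
  assumes V: "finite V" and \<eta>: "\<eta> \<in> configs V"
  shows "av V (\<lambda>\<xi>. point_dens \<eta> V \<xi> * g \<xi>) vacant = g \<eta>"
proof -
  have "av V (\<lambda>\<xi>. point_dens \<eta> V \<xi> * g \<xi>) vacant = av V (\<lambda>\<xi>. 1 / pmf (mu p V) \<eta> * (indicator {\<eta>} \<xi> * g \<xi>)) vacant"
    by (rule av_cong_configs[OF V]) (simp add: point_dens_eq V \<eta>)
  then show ?thesis
    using pmf_mu_pos[OF V \<eta>] by (simp only: av_cmult[OF V] av_indicator[OF V]) simp
qed

text \<open>The subtree at \<open>x\<close> evolves as a translate of a smaller ball when it
  reaches down to the leaves.\<close>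

lemma generator_block:
  assumes x: "x \<in> tree k" "length x + n = L" and f: "depends_on f (tball n)"
  shows "gen (tball L) (\<lambda>\<eta>. f (\<lambda>w. \<eta> (x @ w))) \<eta>
       = gen (tball n) f (\<lambda>w. \<eta> (x @ w))"
proof -
  let ?V = "tball L" and ?U = "(@) x ` tball n"
  define g where "g = (\<lambda>\<eta>. f (\<lambda>w. \<eta> (x @ w)))"
  have g: "depends_on g ?U"
    unfolding g_def by (rule depends_onI, rule depends_onD[OF f]) auto
  have U: "?U \<subseteq> ?V" using x by (intro subtree_subset) auto
  have upd: "(\<lambda>v. (\<eta>(x @ w := b)) (x @ v)) = (\<lambda>v. \<eta> (x @ v))(w := b)" for w b
    by (auto simp: fun_eq_iff)
  have "gen ?V g \<eta> = (\<Sum>y\<in>?U. constr k ?V y \<eta> * (sav y g \<eta> - g \<eta>))"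
    unfolding generator_def using sav_dep[OF g] U finite_tree_ball
    by (intro sum.mono_neutral_right) auto
  also have "\<dots> = (\<Sum>w\<in>tball n. constr k ?V (x @ w) \<eta> * (sav (x @ w) g \<eta> - g \<eta>))"
    by (subst sum.reindex) (auto simp: inj_on_def)
  also have "\<dots> = gen (tball n) f (\<lambda>w. \<eta> (x @ w))"
    unfolding generator_def
  proof (rule sum.cong[OF refl])
    fix w assume w: "w \<in> tball n"
    have "constr k ?V (x @ w) = constr k ?U (x @ w)"
      using U w x by (intro constr_closed subtree_closed) auto
    then have "constr k ?V (x @ w) \<eta> = constr k (tball n) w (\<lambda>v. \<eta> (x @ v))"
      by (simp add: constr_append)
    then show "constr k ?V (x @ w) \<eta> * (sav (x @ w) g \<eta> - g \<eta>)
       = constr k (tball n) w (\<lambda>v. \<eta> (x @ v)) * (sav w f (\<lambda>v. \<eta> (x @ v)) - f (\<lambda>v. \<eta> (x @ v)))"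
      by (simp only: sav_eq g_def upd)
  qed
  finally show ?thesis by (simp add: g_def)
qed

lemma av_generator_0: "finite V \<Longrightarrow> av V (gen V g) \<eta> = 0"
  using av_generator[of V "\<lambda>_. 1" g \<eta>]
  by (simp add: dirichlet_def[abs_def] grad_def av_const)

text \<open>If the law is close to equilibrium, the mean \<open>m\<close> of a centred
  function \<open>F\<close> cannot be large against its fluctuations. With \<open>h\<close>
  the density and \<open>c = m / 2\<close>, \<open>m\<close> is the average of \<open>(h - 1)
  (F - c)\<close>. By the Cauchy-Schwarz inequality with weight \<open>\<bar>h -
  1\<bar>\<close>, \<open>m\<^sup>2\<close> is at most a quarter of the second moment of
  \<open>F - c\<close> under the sum of the two laws, since \<open>\<bar>h - 1\<bar> \<le> h +
  1\<close>. The choice of \<open>c\<close> places it halfway between the two means.\<close>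

lemma mixing_lower_L2:
  assumes V: "finite V" and t: "t \<in> mixed 1 V" and \<eta>: "\<eta> \<in> configs V"
    and mean: "av V F vacant = 0" and F2: "av V (\<lambda>\<xi>. (F \<xi>)\<^sup>2) vacant \<le> K"
    and PF2: "sg V t (\<lambda>\<xi>. (F \<xi>)\<^sup>2) \<eta> \<le> K + (sg V t F \<eta>)\<^sup>2"
  shows "7 * (sg V t F \<eta>)\<^sup>2 \<le> 4 * K"
proof -
  define m where "m = sg V t F \<eta>"
  define c where "c = m / 2"
  define h where "h = sg V t (point_dens \<eta> V)"
  have t0: "0 \<le> t" and mix: "av V (\<lambda>\<sigma>. \<bar>h \<sigma> - 1\<bar>) vacant \<le> 1 / 4"
    using t \<eta> by (auto simp: mixed_1_iff V h_def)
  have h0: "0 \<le> h \<sigma>" for \<sigma> unfolding h_def by (intro semigroup_nonneg V t0 point_dens_nonneg)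
  have avh: "av V (\<lambda>\<sigma>. G \<sigma> * h \<sigma>) vacant = sg V t G \<eta>" for G
    unfolding h_def semigroup_selfadjoint[OF V, of G] by (rule av_point_dens_mult[OF V \<eta>])
  have h1: "av V h vacant = 1" unfolding h_def by (simp add: av_semigroup V av_point_dens)
  have "m = av V (\<lambda>\<sigma>. (h \<sigma> - 1) * (F \<sigma> - c)) vacant"
  proof -
    have "(\<lambda>\<sigma>. (h \<sigma> - 1) * (F \<sigma> - c)) = (\<lambda>\<sigma>. F \<sigma> * h \<sigma> - (F \<sigma> + c * (h \<sigma> - 1)))"
      by (auto simp: algebra_simps)
    then show ?thesis by (simp add: av_diff av_add av_cmult av_const V avh mean h1 m_def)
  qed
  also have "(\<lambda>\<sigma>. (h \<sigma> - 1) * (F \<sigma> - c))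
      = (\<lambda>\<sigma>. (sgn (h \<sigma> - 1) * sqrt \<bar>h \<sigma> - 1\<bar>) * (sqrt \<bar>h \<sigma> - 1\<bar> * (F \<sigma> - c)))"
    by (rule ext) (simp add: sgn_mult_abs mult.assoc[symmetric] mult.assoc[of "sgn _"])
  finally have "m\<^sup>2 \<le> av V (\<lambda>\<sigma>. (sgn (h \<sigma> - 1) * sqrt \<bar>h \<sigma> - 1\<bar>)\<^sup>2) vacant * av V (\<lambda>\<sigma>. (sqrt \<bar>h \<sigma> - 1\<bar> * (F \<sigma> - c))\<^sup>2) vacant"
    using av_CS[OF V, of "\<lambda>\<sigma>. sgn (h \<sigma> - 1) * sqrt \<bar>h \<sigma> - 1\<bar>" "\<lambda>\<sigma>. sqrt \<bar>h \<sigma> - 1\<bar> * (F \<sigma> - c)" vacant] by simp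
  also have "\<dots> \<le> 1 / 4 * av V (\<lambda>\<sigma>. (F \<sigma> - c)\<^sup>2 * h \<sigma> + (F \<sigma> - c)\<^sup>2) vacant"
  proof (intro mult_mono)
    have "av V (\<lambda>\<sigma>. (sgn (h \<sigma> - 1) * sqrt \<bar>h \<sigma> - 1\<bar>)\<^sup>2) vacant \<le> av V (\<lambda>\<sigma>. \<bar>h \<sigma> - 1\<bar>) vacant"
      by (intro av_mono V) (auto simp: power_mult_distrib sgn_if)
    then show "av V (\<lambda>\<sigma>. (sgn (h \<sigma> - 1) * sqrt \<bar>h \<sigma> - 1\<bar>)\<^sup>2) vacant \<le> 1 / 4" using mix by linarith
    show "av V (\<lambda>\<sigma>. (sqrt \<bar>h \<sigma> - 1\<bar> * (F \<sigma> - c))\<^sup>2) vacant \<le> av V (\<lambda>\<sigma>. (F \<sigma> - c)\<^sup>2 * h \<sigma> + (F \<sigma> - c)\<^sup>2) vacant"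
    proof (intro av_mono V)
      fix \<sigma>
      have "\<bar>h \<sigma> - 1\<bar> * (F \<sigma> - c)\<^sup>2 \<le> (h \<sigma> + 1) * (F \<sigma> - c)\<^sup>2"
        using h0[of \<sigma>] by (intro mult_right_mono) auto
      then show "(sqrt \<bar>h \<sigma> - 1\<bar> * (F \<sigma> - c))\<^sup>2 \<le> (F \<sigma> - c)\<^sup>2 * h \<sigma> + (F \<sigma> - c)\<^sup>2"
        unfolding power_mult_distrib by (simp add: distrib_right mult.commute)
    qed
  qed (auto intro: av_nonneg V)
  also have "av V (\<lambda>\<sigma>. (F \<sigma> - c)\<^sup>2 * h \<sigma> + (F \<sigma> - c)\<^sup>2) vacant \<le> 2 * K + m\<^sup>2 / 2"
  proof -
    have sq: "(\<lambda>\<sigma>. (F \<sigma> - c)\<^sup>2) = (\<lambda>\<sigma>. 1 * (F \<sigma>)\<^sup>2 + 1 * ((- 2 * c) * F \<sigma> + 1 * c\<^sup>2))"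
      by (auto simp: power2_eq_square algebra_simps)
    have "sg V t (\<lambda>\<sigma>. (F \<sigma> - c)\<^sup>2) \<eta> = sg V t (\<lambda>\<sigma>. (F \<sigma>)\<^sup>2) \<eta> - 2 * c * m + c\<^sup>2"
      unfolding sq semigroup_lin2[OF V] by (simp add: m_def semigroup_const)
    moreover have "av V (\<lambda>\<sigma>. (F \<sigma> - c)\<^sup>2) vacant = av V (\<lambda>\<sigma>. (F \<sigma>)\<^sup>2) vacant + c\<^sup>2"
      unfolding sq using V by (simp only: av_add av_cmult av_const mean) simp
    ultimately have "av V (\<lambda>\<sigma>. (F \<sigma> - c)\<^sup>2 * h \<sigma> + (F \<sigma> - c)\<^sup>2) vacant
       = sg V t (\<lambda>\<sigma>. (F \<sigma>)\<^sup>2) \<eta> - 2 * c * m + c\<^sup>2 + (av V (\<lambda>\<sigma>. (F \<sigma>)\<^sup>2) vacant + c\<^sup>2)"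
      by (simp add: av_add V avh)
    also have "\<dots> \<le> (K + m\<^sup>2) - 2 * c * m + c\<^sup>2 + (K + c\<^sup>2)"
      using F2 PF2 by (simp add: m_def)
    also have "\<dots> = 2 * K + m\<^sup>2 / 2" by (simp add: c_def power2_eq_square field_simps)
    finally show ?thesis .
  qed
  finally have "m\<^sup>2 \<le> 1 / 4 * (2 * K + m\<^sup>2 / 2)" by simp
  then show ?thesis by (simp add: m_def)
qed

lemma T_rel_facts:
  "0 < spectral_gap k p (tball n)" "0 < T_rel k p (tball n)"
  "poincare (tball n) (T_rel k p (tball n))"
proof -
  obtain T where T: "poincare (tball n) T" using poincare_tree_ball_ex by blast
  have ne: "tball n \<noteq> {}" using Nil_in_tree_ball by blast
  show "0 < spectral_gap k p (tball n)" by (rule gap_pos[OF finite_tree_ball ne T])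
  then show "0 < T_rel k p (tball n)" by (simp add: T_rel_def)
  show "poincare (tball n) (T_rel k p (tball n))" by (rule poincare_T_rel[OF finite_tree_ball ne T])
qed

text \<open>The subtrees rooted at level \<open>L - n\<close> are \<open>N = k ^ (L -
  n)\<close> independent copies of the ball of depth \<open>n\<close>. The sum of the
  translates of an eigenfunction \<open>f\<close> for the gap \<open>l\<close>, started in
  each copy from a maximum of \<open>\<bar>f\<bar>\<close>, has mean \<open>N exp (- l t) f
  \<zeta>\<close>. Its fluctuations are of order \<open>sqrt N\<close>, since products over
  different copies are eigenfunctions for \<open>2 l\<close>. Hence a mixed time satisfies
  \<open>N exp (- 2 l t) \<le> 1\<close>.\<close>

lemma mixing_time_lower:
  assumes n: "n \<le> L" and t: "t \<in> mixed 1 (tball L)"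
  shows "real (L - n) * ln (real k) / 2 * T_rel k p (tball n) \<le> t"
proof -
  define V where "V = tball L"
  define d where "d = L - n"
  have V: "finite V" by (simp add: V_def finite_tree_ball)
  have t0: "0 \<le> t" using t by (simp add: mixed_def)
  define l where "l = spectral_gap k p (tball n)"
  have l: "0 < l" unfolding l_def by (rule T_rel_facts)
  have ne: "tball n \<noteq> {}" using Nil_in_tree_ball by blast
  obtain f where f: "depends_on f (tball n)" "\<And>\<xi>. gen (tball n) f \<xi> = - l * f \<xi>" "\<exists>\<xi>. f \<xi> \<noteq> 0"
    using gap_eigenfunction[OF finite_tree_ball ne] unfolding l_def by metis
  obtain \<zeta> where \<zeta>: "\<And>\<xi>. \<bar>f \<xi>\<bar> \<le> \<bar>f \<zeta>\<bar>"
  proof -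
    define R :: "config \<Rightarrow> config" where "R \<xi> = (\<lambda>y. y \<in> tball n \<and> \<xi> y)" for \<xi>
    have R: "R \<xi> \<in> configs (tball n)" "f (R \<xi>) = f \<xi>" for \<xi>
      by (simp add: R_def configs_iff, rule depends_onD[OF f(1)], simp add: R_def)
    have fin: "finite (configs (tball n))" by (intro finite_configs finite_tree_ball)
    have "Max ((\<lambda>\<xi>. \<bar>f \<xi>\<bar>) ` configs (tball n)) \<in> (\<lambda>\<xi>. \<bar>f \<xi>\<bar>) ` configs (tball n)"
      using fin configs_nonempty by (intro Max_in) auto
    then obtain \<zeta> where "\<bar>f \<zeta>\<bar> = Max ((\<lambda>\<xi>. \<bar>f \<xi>\<bar>) ` configs (tball n))" by auto
    then have "\<bar>f \<xi>\<bar> \<le> \<bar>f \<zeta>\<bar>" for \<xi>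
      using Max_ge[OF finite_imageI[OF fin, of "\<lambda>\<xi>. \<bar>f \<xi>\<bar>"] imageI[OF R(1)[of \<xi>]]] by (simp add: R(2))
    then show ?thesis by (rule that)
  qed
  define M where "M = \<bar>f \<zeta>\<bar>"
  have M: "0 < M" using f(3) \<zeta> by (auto simp: M_def)
  define X where "X = {x \<in> tree k. length x = d}"
  have Xeq: "X = {xs. set xs \<subseteq> {..<k} \<and> length xs = d}"
    by (auto simp: X_def tree_def in_lists_conv_set)
  have X: "finite X" "card X = k ^ d" unfolding Xeq by (auto simp: finite_lists_length_eq card_lists_length_eq)
  define N where "N = real (k ^ d)"
  have N: "0 < N" using k2 by (simp add: N_def)
  have Xlen: "x \<in> tree k" "length x + n = L" if "x \<in> X" for x
    using that n by (auto simp: X_def d_def)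
  define fx where "fx = (\<lambda>x \<eta>. f (\<lambda>w. \<eta> (x @ w)))"
  have fxM: "\<bar>fx x \<eta>\<bar> \<le> M" for x \<eta> by (simp add: fx_def M_def \<zeta>)
  have fxdep: "depends_on (fx x) ((@) x ` tball n)" for x
    unfolding fx_def by (rule depends_onI, rule depends_onD[OF f(1)]) auto
  have fxgen: "gen V (fx x) \<xi> = - l * fx x \<xi>" if "x \<in> X" for x \<xi>
    unfolding V_def fx_def generator_block[OF Xlen[OF that] f(1)] by (rule f(2))
  have disj: "(@) x ` tball n \<inter> (@) y ` tball n = {}" if "x \<in> X" "y \<in> X" "x \<noteq> y" for x y
    using that by (auto simp: X_def)
  have fxy: "gen V (\<lambda>\<xi>. fx x \<xi> * fx y \<xi>) \<xi> = (- 2 * l) * (fx x \<xi> * fx y \<xi>)"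
    if "x \<in> X" "y \<in> X" "x \<noteq> y" for x y \<xi>
    using generator_product[OF fxdep fxdep disj[OF that], of V \<xi>] that by (simp add: fxgen)
  define F where "F = (\<lambda>\<xi>. \<Sum>x\<in>X. 1 * fx x \<xi>)"
  have F2: "(\<lambda>\<xi>. (F \<xi>)\<^sup>2) = (\<lambda>\<xi>. \<Sum>(x, y)\<in>X \<times> X. 1 * (fx x \<xi> * fx y \<xi>))"
    by (rule ext) (simp add: F_def power2_eq_square sum_product sum.cartesian_product)
  have Fgen: "gen V F \<xi> = - l * F \<xi>" for \<xi>
    unfolding F_def generator_lin by (simp add: fxgen sum_distrib_left)
  \<comment> \<open>the configuration that looks like \<open>\<zeta>\<close> in every block\<close>
  define \<eta> :: config where "\<eta> = (\<lambda>y. y \<in> V \<and> d \<le> length y \<and> \<zeta> (drop d y))"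
  have \<eta>: "\<eta> \<in> configs V" by (simp add: \<eta>_def configs_iff)
  have fx\<eta>: "fx x \<eta> = f \<zeta>" if "x \<in> X" for x
    unfolding fx_def
  proof (rule depends_onD[OF f(1)])
    fix w assume "w \<in> tball n"
    then have "x @ w \<in> V" using Xlen[OF that] by (auto simp: V_def tree_ball_def tree_append)
    then show "\<eta> (x @ w) = \<zeta> w" using that by (simp add: \<eta>_def X_def)
  qed
  define E where "E = exp (- l * t)"
  have PF: "sg V t F \<eta> = N * E * f \<zeta>"
    unfolding semigroup_eigen[OF Fgen] E_def using X by (simp add: F_def fx\<eta> N_def)
  have av0: "av V g vacant = 0" if "\<And>\<xi>. gen V g \<xi> = c * g \<xi>" "c \<noteq> 0" for g c
  proof -
    have "gen V g = (\<lambda>\<xi>. c * g \<xi>)" using that by auto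
    then show ?thesis using av_generator_0[OF V, of g vacant] that(2) by (simp add: av_cmult V)
  qed
  have avF: "av V F vacant = 0" by (rule av0[OF Fgen]) (use l in simp)
  \<comment> \<open>a diagonal term is bounded by \<open>M\<^sup>2\<close>, an off-diagonal one
    is known exactly\<close>
  have sumdiag: "(\<Sum>(x, y)\<in>X \<times> X. (if x = y then M\<^sup>2 else 0) + c) = N * M\<^sup>2 + N * N * c" for c
  proof -
    have "(\<Sum>(x, y)\<in>X \<times> X. (if x = y then M\<^sup>2 else 0) + c) = (\<Sum>x\<in>X. \<Sum>y\<in>X. (if x = y then M\<^sup>2 else 0) + c)"
      by (simp add: sum.cartesian_product)
    also have "\<dots> = (\<Sum>x\<in>X. M\<^sup>2 + N * c)"
      using X by (intro sum.cong refl) (simp add: sum.distrib N_def)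
    also have "\<dots> = N * M\<^sup>2 + N * N * c" using X by (simp add: N_def algebra_simps)
    finally show ?thesis .
  qed
  have diag: "\<bar>fx x \<xi> * fx y \<xi>\<bar> \<le> M\<^sup>2" for x y \<xi>
    unfolding abs_mult power2_eq_square by (intro mult_mono fxM) (use M in auto)
  have avF2: "av V (\<lambda>\<xi>. (F \<xi>)\<^sup>2) vacant \<le> N * M\<^sup>2"
  proof -
    have "av V (\<lambda>\<xi>. (F \<xi>)\<^sup>2) vacant = (\<Sum>z\<in>X \<times> X. av V (\<lambda>\<xi>. fx (fst z) \<xi> * fx (snd z) \<xi>) vacant)"
      unfolding F2 case_prod_unfold by (simp add: av_sum V)
    also have "\<dots> \<le> (\<Sum>z\<in>X \<times> X. (if fst z = snd z then M\<^sup>2 else 0) + 0)"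
    proof (rule sum_mono)
      fix z assume z: "z \<in> X \<times> X"
      show "av V (\<lambda>\<xi>. fx (fst z) \<xi> * fx (snd z) \<xi>) vacant \<le> (if fst z = snd z then M\<^sup>2 else 0) + 0"
      proof (cases "fst z = snd z")
        case True
        have "av V (\<lambda>\<xi>. fx (fst z) \<xi> * fx (snd z) \<xi>) vacant \<le> av V (\<lambda>_. M\<^sup>2) vacant"
          by (intro av_mono V order_trans[OF abs_ge_self diag])
        then show ?thesis using True by (simp add: av_const V)
      next
        case False
        have "av V (\<lambda>\<xi>. fx (fst z) \<xi> * fx (snd z) \<xi>) vacant = 0"
          by (rule av0[OF fxy]) (use z False l in auto)
        then show ?thesis using False by simp
      qed
    qed
    also have "\<dots> = N * M\<^sup>2" using sumdiag[of 0] by (simp add: case_prod_unfold)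
    finally show ?thesis .
  qed
  have PF2: "sg V t (\<lambda>\<xi>. (F \<xi>)\<^sup>2) \<eta> \<le> N * M\<^sup>2 + (sg V t F \<eta>)\<^sup>2"
  proof -
    have "sg V t (\<lambda>\<xi>. (F \<xi>)\<^sup>2) \<eta> = (\<Sum>z\<in>X \<times> X. sg V t (\<lambda>\<xi>. fx (fst z) \<xi> * fx (snd z) \<xi>) \<eta>)"
      unfolding F2 case_prod_unfold semigroup_sum_cmult[OF V] by simp
    also have "\<dots> \<le> (\<Sum>z\<in>X \<times> X. (if fst z = snd z then M\<^sup>2 else 0) + E\<^sup>2 * M\<^sup>2)"
    proof (rule sum_mono)
      fix z assume z: "z \<in> X \<times> X"
      show "sg V t (\<lambda>\<xi>. fx (fst z) \<xi> * fx (snd z) \<xi>) \<eta> \<le> (if fst z = snd z then M\<^sup>2 else 0) + E\<^sup>2 * M\<^sup>2"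
      proof (cases "fst z = snd z")
        case True
        have "\<bar>sg V t (\<lambda>\<xi>. fx (fst z) \<xi> * fx (snd z) \<xi>) \<eta>\<bar> \<le> M\<^sup>2"
          by (intro semigroup_abs_le V t0 diag)
        then show ?thesis using True by (simp add: abs_le_iff add_increasing2)
      next
        case False
        have "sg V t (\<lambda>\<xi>. fx (fst z) \<xi> * fx (snd z) \<xi>) \<eta> = exp (- 2 * l * t) * (fx (fst z) \<eta> * fx (snd z) \<eta>)"
          by (rule semigroup_eigen[OF fxy]) (use z False in auto)
        also have "exp (- 2 * l * t) = E\<^sup>2" by (simp add: E_def power2_eq_square exp_add[symmetric])
        also have "fx (fst z) \<eta> * fx (snd z) \<eta> = M\<^sup>2" using z by (auto simp: fx\<eta> M_def power2_eq_square)
        finally show ?thesis using False by simp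
      qed
    qed
    also have "\<dots> = N * M\<^sup>2 + (sg V t F \<eta>)\<^sup>2"
      using sumdiag[of "E\<^sup>2 * M\<^sup>2"] unfolding PF by (simp add: case_prod_unfold M_def power2_eq_square mult_ac)
    finally show ?thesis .
  qed
  have "7 * (N * E * f \<zeta>)\<^sup>2 \<le> 4 * (N * M\<^sup>2)"
    using mixing_lower_L2[OF V t[folded V_def] \<eta> avF avF2 PF2] unfolding PF .
  then have "(N * M\<^sup>2) * (7 * (N * E\<^sup>2)) \<le> (N * M\<^sup>2) * 4"
    by (simp add: M_def power2_eq_square mult_ac)
  moreover have "0 < N * M\<^sup>2" using N M by simp
  ultimately have "7 * (N * E\<^sup>2) \<le> 4" by (metis mult_le_cancel_left_pos)
  then have "N * E\<^sup>2 \<le> 1" by linarith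
  moreover have "0 < N * E\<^sup>2" using N by (simp add: E_def)
  ultimately have "ln (N * E\<^sup>2) \<le> 0" by (simp add: ln_le_zero_iff)
  moreover have "ln (N * E\<^sup>2) = real d * ln (real k) - 2 * l * t"
  proof -
    have "ln (N * E\<^sup>2) = ln N + ln (E\<^sup>2)" using N by (intro ln_mult_pos) (auto simp: E_def)
    also have "ln N = real d * ln (real k)" using k2 by (simp add: N_def ln_realpow)
    also have "ln (E\<^sup>2) = - (2 * l * t)" by (simp add: E_def power2_eq_square exp_add[symmetric])
    finally show ?thesis by simp
  qed
  ultimately have "real d * ln (real k) / 2 / l \<le> t" using l by (simp add: field_simps)
  then show ?thesis
    unfolding d_def[symmetric] T_rel_def l_def[symmetric] by (simp only: divide_inverse)
qed

section \<open>Mixing times of the tree\<close>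

lemma T_mix_lower:
  assumes L: "1 \<le> L"
  shows "ln 2 / 4 * real L * T_rel k p (tball (L div 2)) \<le> T_mix k p 1 (tball L)"
  unfolding T_mix_eq
proof (rule cInf_greatest)
  show "mixed 1 (tball L) \<noteq> {}"
    using mixed_2_tree_ball[OF T_rel_facts(3,2)] mixed_2_subset_mixed_1[OF finite_tree_ball] by blast
  fix t assume t: "t \<in> mixed 1 (tball L)"
  have "real L / 2 * ln 2 \<le> real (L - L div 2) * ln (real k)"
    using k2 by (intro mult_mono) auto
  then have "ln 2 / 4 * real L * T_rel k p (tball (L div 2))
      \<le> real (L - L div 2) * ln (real k) / 2 * T_rel k p (tball (L div 2))"
    using T_rel_facts(2)[of "L div 2"] by (intro mult_right_mono) auto
  also have "\<dots> \<le> t" by (rule mixing_time_lower[OF _ t]) simp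
  finally show "ln 2 / 4 * real L * T_rel k p (tball (L div 2)) \<le> t" .
qed

lemma T_mix_1_le_2: "T_mix k p 1 (tball L) \<le> T_mix k p 2 (tball L)"
  unfolding T_mix_eq
  using mixed_2_tree_ball[OF T_rel_facts(3,2)]
  by (intro cInf_superset_mono bdd_below_mixed mixed_2_subset_mixed_1 finite_tree_ball) blast

lemma T_mix_upper:
  assumes L: "1 \<le> L"
  shows "T_mix k p 2 (tball L) \<le> ln (1 / mix_rate) * real L * T_rel k p (tball L)"
proof -
  let ?T = "T_rel k p (tball L)"
  have "T_mix k p 2 (tball L) \<le> real (Suc L) * (?T * ln (1 / mix_rate) / 2)"
    unfolding T_mix_eq by (intro cInf_lower bdd_below_mixed mixed_2_tree_ball T_rel_facts)
  also have "\<dots> \<le> (2 * real L) * (?T * ln (1 / mix_rate) / 2)"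
    using L T_rel_facts(2)[of L] mix_rate by (intro mult_right_mono) auto
  finally show ?thesis by (simp add: mult_ac)
qed

lemma mixing_times_vs_T_rel:
  shows "\<exists>c>0. \<forall>L::nat. 1 \<le> L \<longrightarrow>
       1 / c * real L * T_rel k p (tball (L div 2)) \<le> T_mix k p 1 (tball L) \<and>
       T_mix k p 1 (tball L) \<le> T_mix k p 2 (tball L) \<and>
       T_mix k p 2 (tball L) \<le> c * real L * T_rel k p (tball L)"
proof -
  define c where "c = max (4 / ln 2) (ln (1 / mix_rate))"
  have "0 < 4 / ln (2::real)" by simp
  then have c: "0 < c" "4 / ln 2 \<le> c" "ln (1 / mix_rate) \<le> c"
    unfolding c_def by linarith+
  have "1 / c \<le> 1 / (4 / ln 2)" using c by (intro divide_left_mono mult_pos_pos) auto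
  then have c': "1 / c \<le> ln 2 / 4" by simp
  have "1 / c * real L * T_rel k p (tball (L div 2)) \<le> T_mix k p 1 (tball L) \<and>
       T_mix k p 1 (tball L) \<le> T_mix k p 2 (tball L) \<and>
       T_mix k p 2 (tball L) \<le> c * real L * T_rel k p (tball L)" if L: "1 \<le> L" for L
  proof (intro conjI T_mix_1_le_2)
    have "1 / c * real L * T_rel k p (tball (L div 2)) \<le> ln 2 / 4 * real L * T_rel k p (tball (L div 2))"
      using c' T_rel_facts(2)[of "L div 2"] by (intro mult_right_mono) auto
    then show "1 / c * real L * T_rel k p (tball (L div 2)) \<le> T_mix k p 1 (tball L)"
      using T_mix_lower[OF L] by linarith
    have "ln (1 / mix_rate) * real L * T_rel k p (tball L) \<le> c * real L * T_rel k p (tball L)"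
      using c T_rel_facts(2)[of L] by (intro mult_right_mono) auto
    then show "T_mix k p 2 (tball L) \<le> c * real L * T_rel k p (tball L)"
      using T_mix_upper[OF L] by linarith
  qed
  then show ?thesis using c(1) by blast
qed

lemma T_rel_tree_ball_le: "poincare (tball L) T \<Longrightarrow> T_rel k p (tball L) \<le> T"
  using T_rel_le[OF finite_tree_ball] Nil_in_tree_ball by blast

lemma T_mix_critical:
  assumes crit: "real k * p = 1"
  shows "\<exists>c>0. \<exists>\<beta>\<ge>0. \<forall>L::nat. 1 \<le> L \<longrightarrow> 1 / c * real L ^ 3 \<le> T_mix k p 1 (tball L) \<and>
     T_mix k p 1 (tball L) \<le> c * real L powr (3 + \<beta>)"
proof -
  obtain c0 where c0: "0 < c0" "\<And>L. 1 \<le> L \<Longrightarrow>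
       1 / c0 * real L * T_rel k p (tball (L div 2)) \<le> T_mix k p 1 (tball L) \<and>
       T_mix k p 1 (tball L) \<le> T_mix k p 2 (tball L) \<and>
       T_mix k p 2 (tball L) \<le> c0 * real L * T_rel k p (tball L)"
    using mixing_times_vs_T_rel by blast
  obtain A \<beta> where A: "0 \<le> A" "\<And>L. poincare (tball L) (A * real (Suc L) ^ \<beta>)"
    using critical_poincare[OF crit] by blast
  define c where "c = max (12 * c0) (c0 * A * 2 ^ \<beta>)"
  have c: "12 * c0 \<le> c" "c0 * A * 2 ^ \<beta> \<le> c" by (auto simp: c_def)
  then have c_pos: "0 < c" using c0(1) by linarith
  have "1 / c * real L ^ 3 \<le> T_mix k p 1 (tball L) \<and>
     T_mix k p 1 (tball L) \<le> c * real L powr (3 + real \<beta>)" if L: "1 \<le> L" for L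
  proof
    have "real L / 2 \<le> real (Suc (L div 2))" by simp
    then have "(real L / 2)\<^sup>2 \<le> (real (Suc (L div 2)))\<^sup>2" by (intro power_mono) auto
    also have "\<dots> \<le> 3 * T_rel k p (tball (L div 2))"
      using critical_poincare_lower[OF crit T_rel_facts(3)[of "L div 2"]] by simp
    finally have low: "(real L)\<^sup>2 / 12 \<le> T_rel k p (tball (L div 2))" by (simp add: power_divide)
    have "1 / c * real L ^ 3 \<le> 1 / (12 * c0) * real L ^ 3"
      using c c_pos c0(1) by (intro mult_right_mono divide_left_mono mult_pos_pos) auto
    also have "\<dots> = 1 / c0 * real L * ((real L)\<^sup>2 / 12)" by (simp add: power2_eq_square power3_eq_cube)
    also have "\<dots> \<le> 1 / c0 * real L * T_rel k p (tball (L div 2))"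
      using c0(1) by (intro mult_left_mono low) auto
    finally show "1 / c * real L ^ 3 \<le> T_mix k p 1 (tball L)" using c0(2)[OF L] by linarith
    have "T_rel k p (tball L) \<le> A * real (Suc L) ^ \<beta>" by (rule T_rel_tree_ball_le[OF A(2)])
    also have "\<dots> \<le> A * (2 * real L) ^ \<beta>" using L A by (intro mult_left_mono power_mono) auto
    also have "\<dots> \<le> A * (2 ^ \<beta> * real L ^ (2 + \<beta>))"
      unfolding power_mult_distrib using L A by (intro mult_left_mono power_increasing) auto
    finally have "c0 * real L * T_rel k p (tball L) \<le> c0 * real L * (A * (2 ^ \<beta> * real L ^ (2 + \<beta>)))"
      using c0(1) by (intro mult_left_mono) auto
    also have "\<dots> = (c0 * A * 2 ^ \<beta>) * real L ^ (3 + \<beta>)" by (simp add: mult_ac eval_nat_numeral)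
    also have "\<dots> \<le> c * real L ^ (3 + \<beta>)" by (intro mult_right_mono c) auto
    also have "real L ^ (3 + \<beta>) = real L powr (3 + real \<beta>)"
      using powr_realpow[of "real L" "3 + \<beta>"] L by simp
    finally show "T_mix k p 1 (tball L) \<le> c * real L powr (3 + real \<beta>)" using c0(2)[OF L] by linarith
  qed
  then show ?thesis using c_pos of_nat_0_le_iff by blast
qed

text \<open>Bounded relaxation times make the mixing time linear. For fixed \<open>p\<close>
  below \<open>1 / k\<close> the powers of \<open>1 / k - p\<close> in the theorem are
  constants.\<close>

lemma T_mix_subcritical:
  assumes sub: "real k * p < 1"
  shows "\<exists>c>0. \<forall>L::nat. 1 \<le> L \<longrightarrow> 1 / c * real L \<le> T_mix k p 1 (tball L) \<and>
     T_mix k p 1 (tball L) \<le> c * real L"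
proof -
  obtain c0 where c0: "0 < c0" "\<And>L. 1 \<le> L \<Longrightarrow>
       1 / c0 * real L * T_rel k p (tball (L div 2)) \<le> T_mix k p 1 (tball L) \<and>
       T_mix k p 1 (tball L) \<le> T_mix k p 2 (tball L) \<and>
       T_mix k p 2 (tball L) \<le> c0 * real L * T_rel k p (tball L)"
    using mixing_times_vs_T_rel by blast
  obtain A where A: "0 \<le> A" "\<And>L. poincare (tball L) A"
    using subcritical_poincare[OF sub] by blast
  define c where "c = c0 * max 1 A"
  have c: "c0 \<le> c" "c0 * A \<le> c" unfolding c_def using c0(1) by (simp_all add: mult_left_mono)
  have c_pos: "0 < c" using c c0(1) by linarith
  have "1 / c * real L \<le> T_mix k p 1 (tball L) \<and> T_mix k p 1 (tball L) \<le> c * real L" if L: "1 \<le> L" for L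
  proof
    have "1 / c * real L * 1 \<le> 1 / c0 * real L * T_rel k p (tball (L div 2))"
      using c c_pos c0(1) poincare_ge_1[OF finite_tree_ball Nil_in_tree_ball T_rel_facts(3)]
      by (intro mult_mono divide_left_mono mult_nonneg_nonneg) auto
    then show "1 / c * real L \<le> T_mix k p 1 (tball L)" using c0(2)[OF L] by simp
    have "c0 * real L * T_rel k p (tball L) \<le> c0 * real L * A"
      using c0(1) T_rel_tree_ball_le[OF A(2)] by (intro mult_left_mono) auto
    also have "\<dots> = (c0 * A) * real L" by simp
    also have "\<dots> \<le> c * real L" by (intro mult_right_mono c) auto
    finally show "T_mix k p 1 (tball L) \<le> c * real L" using c0(2)[OF L] by linarith
  qed
  then show ?thesis using c_pos by blast
qed

end

theorem theorem3:
  fixes k :: nat and p :: real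
  assumes "2 \<le> k" and "0 < p" and "p < 1"
  shows "\<exists>c::real. c > 0 \<and>
    (\<forall>L::nat. 1 \<le> L \<longrightarrow>
       1 / c * real L * T_rel k p (tree_ball k (L div 2)) \<le> T_mix k p 1 (tree_ball k L) \<and>
       T_mix k p 1 (tree_ball k L) \<le> T_mix k p 2 (tree_ball k L) \<and>
       T_mix k p 2 (tree_ball k L) \<le> c * real L * T_rel k p (tree_ball k L)) \<and>
    (\<exists>\<alpha>::real. \<exists>\<beta>::real. 0 \<le> \<alpha> \<and> 0 \<le> \<beta> \<and>
      (\<forall>L::nat. 1 \<le> L \<longrightarrow>
        (p = p_crit k \<longrightarrow>
           1 / c * real L ^ 3 \<le> T_mix k p 1 (tree_ball k L) \<and>
           T_mix k p 1 (tree_ball k L) \<le> c * real L powr (3 + \<beta>)) \<and>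
        (p < p_crit k \<longrightarrow>
           1 / c * (p_crit k - p) powr (- 2) * real L \<le> T_mix k p 1 (tree_ball k L) \<and>
           T_mix k p 1 (tree_ball k L) \<le> c * real L * (p_crit k - p) powr (- (2 + \<alpha>)))))"
proof -
  interpret ofa k p using assms by unfold_locales
  have shrink: "1 / c' * a \<le> 1 / c * a" "c * a \<le> c' * a" if "0 < c" "c \<le> c'" "0 \<le> a" for a c c' :: real
    using that by (auto intro!: mult_right_mono divide_left_mono mult_pos_pos)
  obtain c0 where c0: "0 < c0" "\<And>L. 1 \<le> L \<Longrightarrow>
       1 / c0 * real L * T_rel k p (tree_ball k (L div 2)) \<le> T_mix k p 1 (tree_ball k L) \<and>
       T_mix k p 1 (tree_ball k L) \<le> T_mix k p 2 (tree_ball k L) \<and>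
       T_mix k p 2 (tree_ball k L) \<le> c0 * real L * T_rel k p (tree_ball k L)"
    using mixing_times_vs_T_rel by blast
  have main: "1 / c * real L * T_rel k p (tree_ball k (L div 2)) \<le> T_mix k p 1 (tree_ball k L) \<and>
       T_mix k p 1 (tree_ball k L) \<le> T_mix k p 2 (tree_ball k L) \<and>
       T_mix k p 2 (tree_ball k L) \<le> c * real L * T_rel k p (tree_ball k L)" if "c0 \<le> c" "1 \<le> L" for c L
    using c0(2)[OF that(2)] shrink[OF c0(1) that(1), of "real L * T_rel k p (tree_ball k L)"]
      shrink[OF c0(1) that(1), of "real L * T_rel k p (tree_ball k (L div 2))"]
      T_rel_facts(2)[of L] T_rel_facts(2)[of "L div 2"]
    by (simp add: mult.assoc)
  have kpos: "0 < real k" using assms by simp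
  consider "p = p_crit k" | "p < p_crit k" | "p_crit k < p" by linarith
  then show ?thesis
  proof cases
    case 1
    then have "real k * p = 1" using kpos by (simp add: p_crit_def)
    then obtain c1 \<beta> where c1: "0 < c1" "0 \<le> \<beta>" "\<And>L. 1 \<le> L \<Longrightarrow> 1 / c1 * real L ^ 3 \<le> T_mix k p 1 (tree_ball k L) \<and>
       T_mix k p 1 (tree_ball k L) \<le> c1 * real L powr (3 + \<beta>)"
      using T_mix_critical by blast
    define c where "c = max c0 c1"
    have c: "c0 \<le> c" "c1 \<le> c" "0 < c" using c0(1) by (auto simp: c_def)
    have "1 / c * real L ^ 3 \<le> T_mix k p 1 (tree_ball k L) \<and>
       T_mix k p 1 (tree_ball k L) \<le> c * real L powr (3 + \<beta>)" if "1 \<le> L" for L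
      using c1(3)[OF that] shrink(1)[OF c1(1) c(2), of "real L ^ 3"] shrink(2)[OF c1(1) c(2), of "real L powr (3 + \<beta>)"]
      by simp
    then show ?thesis
      using 1 c main[OF c(1)] c1(2) by (intro exI[of _ c] conjI exI[of _ 0] exI[of _ \<beta>]) auto
  next
    case 2
    then have "real k * p < 1" using kpos by (simp add: p_crit_def field_simps)
    then obtain c1 where c1: "0 < c1" "\<And>L. 1 \<le> L \<Longrightarrow> 1 / c1 * real L \<le> T_mix k p 1 (tree_ball k L) \<and>
       T_mix k p 1 (tree_ball k L) \<le> c1 * real L"
      using T_mix_subcritical by blast
    define e where "e = (p_crit k - p) powr (- 2)"
    have e: "0 < e" using 2 by (simp add: e_def)
    define c where "c = max c0 (max (c1 * e) (c1 / e))"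
    have c: "c0 \<le> c" "c1 * e \<le> c" "c1 / e \<le> c" "0 < c" using c0(1) by (auto simp: c_def)
    have "1 / c * e * real L \<le> T_mix k p 1 (tree_ball k L) \<and>
       T_mix k p 1 (tree_ball k L) \<le> c * real L * e" if "1 \<le> L" for L
    proof
      have "1 / c * (e * real L) \<le> 1 / (c1 * e) * (e * real L)"
        using c1(1) e c(2) by (intro shrink(1)) auto
      then show "1 / c * e * real L \<le> T_mix k p 1 (tree_ball k L)" using c1(2)[OF that] e by simp
      have "c1 / e * (real L * e) \<le> c * (real L * e)"
        using c1(1) e c(3) by (intro shrink(2)) auto
      then show "T_mix k p 1 (tree_ball k L) \<le> c * real L * e" using c1(2)[OF that] e by simp
    qed
    then show ?thesis
      using 2 c main[OF c(1)] unfolding e_def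
      by (intro exI[of _ c] conjI exI[of _ 0] exI[of _ "0::real"]) auto
  next
    case 3
    then show ?thesis
      using c0(1) main[OF order_refl] by (intro exI[of _ c0] conjI exI[of _ 0] exI[of _ "0::real"]) auto
  qed
qed

end
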